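(* Let $\varepsilon > 0$ be an arbitrary constant. Consider a data structure for the membership problem (maintain a set of at most $n$ keys from the universe $[2n]$ under insertions, and answer queries "is $x$ in the set?") running in the cell-probe model with cells of $O(B\lg n)$ bits and a state (cache) of $M$ bits. Assume $B\ge \lg n$ and $M \le n^{1-\varepsilon}$. The data structure may be randomized. Let $t_u$ be its expected amortized update time and $t_q$ its query time, where a query need only be correct with probability $1- C_\varepsilon$, with $C_\varepsilon>0$ a constant depending only on $\varepsilon$ (suitably chosen). If $t_u \le 1-\varepsilon$, then $t_q = \Omega(\lg n / \lg(B\cdot t_u))$.
   Context: Cell-probe model: the processor has $M$ bits of state preserved between operations; memory is an array of cells of $O(B\lg n)$ bits with constant-time random access; at each step the processor chooses a cell as an arbitrary function of its state and either writes it (with a value that is an arbitrary function of the state) or reads it and updates its state as an arbitrary function of the cell contents. Cost is the number of cell probes.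
   Formalization: The denominator lg(B·t_u) is replaced by lg(max(2, B·t_u)), since the literal quotient is negative or undefined for B·t_u ≤ 1 and the claim is false when B·t_u is just above 1. *)

theory Defs
  imports "HOL-Probability.Probability"
begin

text \<open>
  One operation of a cell-probe algorithm, as a decision tree. The node reached plays the role
  of the processor state during the operation: address, written value and continuation may
  depend arbitrarily on the operation, the state at its start and all cell contents read so far.
  Only the state returned at a leaf survives the operation. Addresses are unbounded.
\<close>

datatype 'r cell_prog =
    Return 'r
  | Read nat "bool list \<Rightarrow> 'r cell_prog"
  | Write nat "bool list" "'r cell_prog"

type_synonym memory = "nat \<Rightarrow> bool list"

text \<open>The result is the value returned, the final memory and the number of probes.\<close>

primrec exec :: "'r cell_prog \<Rightarrow> memory \<Rightarrow> 'r \<times> memory \<times> nat" where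
  "exec (Return r) m = (r, m, 0)"
| "exec (Read a k) m = (let (r, m', c) = exec (k (m a)) m in (r, m', Suc c))"
| "exec (Write a v p) m = (let (r, m', c) = exec p (m(a := v)) in (r, m', Suc c))"

primrec wf_prog :: "nat \<Rightarrow> ('r \<Rightarrow> bool) \<Rightarrow> 'r cell_prog \<Rightarrow> bool" where
  "wf_prog w Q (Return r) \<longleftrightarrow> Q r"
| "wf_prog w Q (Read a k) \<longleftrightarrow> (\<forall>v. length v = w \<longrightarrow> wf_prog w Q (k v))"
| "wf_prog w Q (Write a v p) \<longleftrightarrow> length v = w \<and> wf_prog w Q p"

datatype operation = Insert (key: nat) | Query (key: nat)

text \<open>
  A program returns the new processor state and an answer bit; the answer bit of an insertion is
  ignored. The initial configuration represents the empty set; its memory contents are free.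
\<close>

record det_ds =
  init_state :: "bool list"
  init_mem :: memory
  program :: "operation \<Rightarrow> bool list \<Rightarrow> (bool list \<times> bool) cell_prog"

definition universe :: "nat \<Rightarrow> nat set" where
  "universe n = {1..2 * n}"

definition wf_det_ds :: "nat \<Rightarrow> nat \<Rightarrow> nat \<Rightarrow> det_ds \<Rightarrow> bool" where
  "wf_det_ds n M w D \<longleftrightarrow>
     length (init_state D) = M \<and>
     (\<forall>a. length (init_mem D a) = w) \<and>
     (\<forall>q s. key q \<in> universe n \<longrightarrow> length s = M \<longrightarrow>
        wf_prog w (\<lambda>(s', b). length s' = M) (program D q s))"

type_synonym config = "bool list \<times> memory"

definition step :: "det_ds \<Rightarrow> operation \<Rightarrow> config \<Rightarrow> config" where
  "step D q cf = (case exec (program D q (fst cf)) (snd cf) of ((s, b), m, c) \<Rightarrow> (s, m))"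

definition answer :: "det_ds \<Rightarrow> operation \<Rightarrow> config \<Rightarrow> bool" where
  "answer D q cf = (case exec (program D q (fst cf)) (snd cf) of ((s, b), m, c) \<Rightarrow> b)"

definition probes :: "det_ds \<Rightarrow> operation \<Rightarrow> config \<Rightarrow> nat" where
  "probes D q cf = (case exec (program D q (fst cf)) (snd cf) of ((s, b), m, c) \<Rightarrow> c)"

definition config_after :: "det_ds \<Rightarrow> operation list \<Rightarrow> config" where
  "config_after D qs = fold (step D) qs (init_state D, init_mem D)"

fun is_insert :: "operation \<Rightarrow> bool" where
  "is_insert (Insert x) \<longleftrightarrow> True"
| "is_insert (Query x) \<longleftrightarrow> False"

definition num_updates :: "operation list \<Rightarrow> nat" where
  "num_updates qs = length (filter is_insert qs)"

definition update_probes :: "det_ds \<Rightarrow> operation list \<Rightarrow> nat" where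
  "update_probes D qs =
     (\<Sum>i | i < length qs \<and> is_insert (qs ! i). probes D (qs ! i) (config_after D (take i qs)))"

definition stored :: "operation list \<Rightarrow> nat set" where
  "stored qs = {x. Insert x \<in> set qs}"

definition valid_ops :: "nat \<Rightarrow> operation list \<Rightarrow> bool" where
  "valid_ops n qs \<longleftrightarrow> (\<forall>q \<in> set qs. key q \<in> universe n) \<and> card (stored qs) \<le> n"

text \<open>
  A randomized data structure is a random deterministic one, i.e. the random bits are drawn once
  and can be consulted for free by all operations. The seed has an arbitrary distribution, and
  operation sequences are fixed independently of it.
\<close>

type_synonym seed = "nat \<Rightarrow> bool"

definition randomized_ds ::
  "nat \<Rightarrow> nat \<Rightarrow> nat \<Rightarrow> seed measure \<Rightarrow> (seed \<Rightarrow> det_ds) \<Rightarrow> bool" where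
  "randomized_ds n M w P D \<longleftrightarrow> prob_space P \<and> (\<forall>\<omega> \<in> space P. wf_det_ds n M w (D \<omega>))"

definition solves_membership ::
  "nat \<Rightarrow> real \<Rightarrow> seed measure \<Rightarrow> (seed \<Rightarrow> det_ds) \<Rightarrow> bool" where
  "solves_membership n C P D \<longleftrightarrow>
     (\<forall>qs x. valid_ops n qs \<longrightarrow> x \<in> universe n \<longrightarrow>
        (let E = {\<omega> \<in> space P.
                    answer (D \<omega>) (Query x) (config_after (D \<omega>) qs) \<longleftrightarrow> x \<in> stored qs}
         in E \<in> sets P \<and> measure P E \<ge> 1 - C))"

definition expected_amortized_update_time_le ::
  "nat \<Rightarrow> seed measure \<Rightarrow> (seed \<Rightarrow> det_ds) \<Rightarrow> real \<Rightarrow> bool" where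
  "expected_amortized_update_time_le n P D t \<longleftrightarrow>
     (\<forall>qs. valid_ops n qs \<longrightarrow>
        integrable P (\<lambda>\<omega>. real (update_probes (D \<omega>) qs)) \<and>
        (\<integral>\<omega>. real (update_probes (D \<omega>) qs) \<partial>P) \<le> t * real (num_updates qs))"

text \<open>Expected over the seed, but neither amortized nor averaged over queries.\<close>

definition query_time_le ::
  "nat \<Rightarrow> seed measure \<Rightarrow> (seed \<Rightarrow> det_ds) \<Rightarrow> real \<Rightarrow> bool" where
  "query_time_le n P D t \<longleftrightarrow>
     (\<forall>qs x. valid_ops n qs \<longrightarrow> x \<in> universe n \<longrightarrow>
        integrable P (\<lambda>\<omega>. real (probes (D \<omega>) (Query x) (config_after (D \<omega>) qs))) \<and>
        (\<integral>\<omega>. real (probes (D \<omega>) (Query x) (config_after (D \<omega>) qs)) \<partial>P) \<le> t)"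

end

theory Submission
  imports Defs
begin

text \<open>
  Insert uniformly random keys and query at a random time \<open>T\<close>. Divide the past of \<open>T\<close> into epochs of
  sizes \<open>k, k b, k b\<^sup>2, \<dots>\<close> with \<open>b\<close> polynomial in \<open>B t\<^sub>u\<close>; there are \<open>\<Omega>(lg n / lg (B t\<^sub>u))\<close> of them, and
  each turns out to cost a random query a constant number of probes on average.

  An observer who knows all keys outside of an epoch follows the later insertions from the contents
  of the cells that these read and that were last written in the epoch. A read of this kind
  connects two points of time, and it is separated by the end of an epoch of size \<open>l\<close> for few query
  times if its length is far from \<open>l\<close>. Hence, averaged over epochs and query times, the observer
  needs fewer bits than the epoch has keys. (This remains true for constant \<open>B t\<^sub>u\<close>, where the
  epochs one by one would allow for too many bits.)

  Fix what the observer sees. All but a few of the keys of the epoch must then be covered by the sets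
  of queries that probe one of the cells written in the epoch. There are fewer cells than keys, as
  \<open>t\<^sub>u < 1\<close>, so many keys share a cell with another one. If a random query seldom probes a cell of
  the epoch, and seldom probes a cell that about \<open>1 / l\<close> of all queries probe, this happens with
  exponentially small probability: the more popular cells are few and can be enumerated, and the
  less popular ones are hardly ever shared. As each cell is relevant for only \<open>O(1)\<close> epochs, a fast
  query contradicts this.
\<close>

section \<open>Executions seen by an observer\<close>

text \<open>The failures of an epoch are handled by a union bound in linear form: for every epoch, 1
  is at most the indicator that it is \<open>good\<close> plus one quotient for each way of failing.
  Such an inequality can be summed over epochs, query times and sequences and integrated over the
  seed, so no seed and no typical sequence has to be selected. The critical quotient is the number
  of cells written per key. Its mean is about 1 - \<epsilon> and its threshold 1 - \<epsilon> / 2,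
  which leaves a share of 3 \<epsilon> / 8 of the epochs. All other losses are kept small against
  this share, and \<epsilon> / 4 remains to be paid by the probes of queries. In a good epoch, wrong
  answers may spoil a share of \<epsilon> / 4 of the keys, so a share of 1 - \<epsilon> / 4 is
  covered by at most 1 - \<epsilon> / 2 cells per key, and a share of \<epsilon> / 4 must share
  cells with others. The probability of one such coincidence has to be a constant so small that its
  power \<epsilon> / 4 beats all constant factors per key; the admissible error probability is
  proportional to it. For the same reason only a small constant fraction of \<open>n\<close> keys is
  inserted: positive answers must be rare among random queries.\<close>

primrec probed :: "'r cell_prog \<Rightarrow> memory \<Rightarrow> nat set" where
  "probed (Return r) m = {}"
| "probed (Read a k) m = insert a (probed (k (m a)) m)"
| "probed (Write a v p) m = insert a (probed p (m(a := v)))"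

primrec written :: "'r cell_prog \<Rightarrow> memory \<Rightarrow> nat set" where
  "written (Return r) m = {}"
| "written (Read a k) m = written (k (m a)) m"
| "written (Write a v p) m = insert a (written p (m(a := v)))"

text \<open>
  The secret cells \<open>S\<close> are those whose contents an observer cannot reconstruct; a cell ceases to be
  secret when it is overwritten. The transcript tells the observer exactly what is needed to follow
  the execution, and it is prefix-free, so no addresses have to be encoded.
\<close>

primrec transcript :: "'r cell_prog \<Rightarrow> memory \<Rightarrow> nat set \<Rightarrow> bool list" where
  "transcript (Return r) m S = []"
| "transcript (Read a k) m S = (if a \<in> S then True # m a else [False]) @ transcript (k (m a)) m S"
| "transcript (Write a v p) m S = transcript p (m(a := v)) (S - {a})"

primrec secret_reads :: "'r cell_prog \<Rightarrow> memory \<Rightarrow> nat set \<Rightarrow> nat" where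
  "secret_reads (Return r) m S = 0"
| "secret_reads (Read a k) m S = (if a \<in> S then 1 else 0) + secret_reads (k (m a)) m S"
| "secret_reads (Write a v p) m S = secret_reads p (m(a := v)) (S - {a})"

abbreviation exec_mem :: "'r cell_prog \<Rightarrow> memory \<Rightarrow> memory" where
  "exec_mem p m \<equiv> fst (snd (exec p m))"

abbreviation exec_cost :: "'r cell_prog \<Rightarrow> memory \<Rightarrow> nat" where
  "exec_cost p m \<equiv> snd (snd (exec p m))"

lemma exec_mem_unwritten: "a \<notin> written p m \<Longrightarrow> exec_mem p m a = m a"
  by (induction p arbitrary: m) (auto simp: Let_def split_beta)

lemma finite_probed [simp]: "finite (probed p m)"
  by (induction p arbitrary: m) auto

lemma card_probed_le: "card (probed p m) \<le> exec_cost p m"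
proof (induction p arbitrary: m)
  case (Read a k)
  have "card (probed (k (m a)) m) \<le> exec_cost (k (m a)) m" by (rule Read) simp
  then show ?case by (auto simp: Let_def split_beta card_insert_if)
next
  case (Write a v p)
  have "card (probed p (m(a := v))) \<le> exec_cost p (m(a := v))" by (rule Write)
  then show ?case by (auto simp: Let_def split_beta card_insert_if)
qed auto

lemma finite_written [simp]: "finite (written p m)"
  by (induction p arbitrary: m) auto

lemma card_written_le: "card (written p m) \<le> exec_cost p m"
proof (induction p arbitrary: m)
  case (Read a k)
  have "card (written (k (m a)) m) \<le> exec_cost (k (m a)) m" by (rule Read) simp
  then show ?case by (auto simp: Let_def split_beta)
next
  case (Write a v p)
  have "card (written p (m(a := v))) \<le> exec_cost p (m(a := v))" by (rule Write)
  then show ?case by (auto simp: Let_def split_beta card_insert_if)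
qed auto

text \<open>Both runs proceed identically until they probe a cell with different contents. The first
  such cell would lie in both probed sets, so agreement on their intersection is enough.\<close>

lemma exec_cong_probed:
  assumes "\<And>a. a \<in> probed p m \<Longrightarrow> a \<in> probed p m' \<Longrightarrow> m a = m' a"
  shows "fst (exec p m) = fst (exec p m') \<and> probed p m = probed p m'"
  using assms
proof (induction p arbitrary: m m')
  case (Read a k)
  have "m a = m' a" using Read.prems by simp
  moreover have "fst (exec (k (m a)) m) = fst (exec (k (m a)) m') \<and>
      probed (k (m a)) m = probed (k (m a)) m'"
    using Read.prems calculation by (intro Read.IH) auto
  ultimately show ?case by (simp add: Let_def split_beta)
next
  case (Write a v p)
  have "fst (exec p (m(a := v))) = fst (exec p (m'(a := v))) \<and>
      probed p (m(a := v)) = probed p (m'(a := v))"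
  proof (rule Write.IH)
    fix b assume "b \<in> probed p (m(a := v))" "b \<in> probed p (m'(a := v))"
    then show "(m(a := v)) b = (m'(a := v)) b"
      using Write.prems[of b] by (simp only: probed.simps fun_upd_apply insert_iff) simp
  qed
  then show ?case by (simp add: Let_def split_beta)
qed auto

lemma wf_exec:
  assumes "wf_prog w Q p" and "\<And>a. length (m a) = w"
  shows "Q (fst (exec p m)) \<and> (\<forall>a. length (exec_mem p m a) = w)"
  using assms by (induction p arbitrary: m) (auto simp: Let_def split_beta)

text \<open>\<open>u\<close> and \<open>u'\<close> are the unread rests of two bit streams; their
  equality is what lets transcripts be concatenated without separators. At a read, the common flag
  decides: after \<open>True\<close> come the \<open>w\<close> bits of the cell, and after
  \<open>False\<close> the cell is outside of both \<open>S\<close> and \<open>S'\<close>, so its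
  contents agree by hypothesis.\<close>

lemma transcript_eqD:
  assumes "transcript p m S @ u = transcript p m' S' @ u'"
    and "wf_prog w Q p" and "\<And>a. length (m a) = w" and "\<And>a. length (m' a) = w"
    and "\<And>a. a \<notin> S \<Longrightarrow> a \<notin> S' \<Longrightarrow> m a = m' a"
  shows "fst (exec p m) = fst (exec p m') \<and> u = u' \<and>
    (\<forall>a. a \<notin> S - written p m \<longrightarrow> a \<notin> S' - written p m' \<longrightarrow> exec_mem p m a = exec_mem p m' a)"
  using assms
proof (induction p arbitrary: m m' S S')
  case (Return r)
  then show ?case by auto
next
  case (Read a k)
  have eq: "m a = m' a"
    and tr: "transcript (k (m a)) m S @ u = transcript (k (m a)) m' S' @ u'"
    using Read.prems(1,3,4,5) by (auto split: if_splits)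
  have "fst (exec (k (m a)) m) = fst (exec (k (m a)) m') \<and> u = u' \<and>
    (\<forall>b. b \<notin> S - written (k (m a)) m \<longrightarrow> b \<notin> S' - written (k (m a)) m' \<longrightarrow>
      exec_mem (k (m a)) m b = exec_mem (k (m a)) m' b)"
    by (rule Read.IH[OF _ tr]) (use Read.prems in auto)
  then show ?case using eq by (simp add: Let_def split_beta)
next
  case (Write a v p)
  have "fst (exec p (m(a := v))) = fst (exec p (m'(a := v))) \<and> u = u' \<and>
    (\<forall>b. b \<notin> (S - {a}) - written p (m(a := v)) \<longrightarrow>
      b \<notin> (S' - {a}) - written p (m'(a := v)) \<longrightarrow>
      exec_mem p (m(a := v)) b = exec_mem p (m'(a := v)) b)"
  proof (rule Write.IH)
    show "transcript p (m(a := v)) (S - {a}) @ u = transcript p (m'(a := v)) (S' - {a}) @ u'"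
      using Write.prems(1) by simp
    show "wf_prog w Q p" using Write.prems(2) by simp
    show "length ((m(a := v)) b) = w" "length ((m'(a := v)) b) = w" for b
      using Write.prems(2,3,4) by simp_all
    show "(m(a := v)) b = (m'(a := v)) b" if "b \<notin> S - {a}" "b \<notin> S' - {a}" for b
    proof (cases "b = a")
      case False
      then have "b \<notin> S" "b \<notin> S'" using that by blast+
      from Write.prems(5)[OF this] False show ?thesis by simp
    qed simp
  qed
  moreover have "S - written (Write a v p) m = S - {a} - written p (m(a := v))"
    "S' - written (Write a v p) m' = S' - {a} - written p (m'(a := v))" by auto
  moreover have "fst (exec (Write a v p) m) = fst (exec p (m(a := v)))"
    "exec_mem (Write a v p) m = exec_mem p (m(a := v))" for m
    by (simp_all add: Let_def split_beta)
  ultimately show ?case by presburger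
qed

lemma length_transcript_le:
  assumes "\<And>a. length (m a) = w" "wf_prog w Q p"
  shows "length (transcript p m S) \<le> exec_cost p m + w * secret_reads p m S"
  using assms
proof (induction p arbitrary: m S)
  case (Read a k)
  have "length (transcript (k (m a)) m S) \<le> exec_cost (k (m a)) m + w * secret_reads (k (m a)) m S"
    by (rule Read.IH) (use Read.prems in auto)
  then show ?case using Read.prems by (auto simp: Let_def split_beta)
next
  case (Write a v p)
  have "length (transcript p (m(a := v)) (S - {a}))
      \<le> exec_cost p (m(a := v)) + w * secret_reads p (m(a := v)) (S - {a})"
    by (rule Write.IH) (use Write.prems in auto)
  then show ?case by (auto simp: Let_def split_beta)
qed simp

text \<open>A read cell belongs to at most one \<open>F i\<close>, and a write removes its cell from
  every \<open>F i\<close>. This serves to split secret reads according to the insertion that last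
  wrote the cell.\<close>

lemma secret_reads_UN:
  assumes "finite I" "disjoint_family_on F I"
  shows "secret_reads p m (\<Union>i\<in>I. F i) = (\<Sum>i\<in>I. secret_reads p m (F i))"
  using assms(2)
proof (induction p arbitrary: m F)
  case (Read a k)
  have "(if a \<in> (\<Union>i\<in>I. F i) then 1 else 0 :: nat) = (\<Sum>i\<in>I. if a \<in> F i then 1 else 0)"
  proof (cases "a \<in> (\<Union>i\<in>I. F i)")
    case True
    then obtain j where j: "j \<in> I" "a \<in> F j" by auto
    have "(\<Sum>i\<in>I. if a \<in> F i then 1 else 0 :: nat) = (\<Sum>i\<in>I. if i = j then 1 else 0)"
      using Read.prems j by (intro sum.cong) (auto simp: disjoint_family_on_def)
    then show ?thesis using j assms(1) by auto
  qed auto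
  with Read show ?case by (simp add: sum.distrib)
next
  case (Write a v p)
  have "(\<Union>i\<in>I. F i) - {a} = (\<Union>i\<in>I. F i - {a})" by auto
  then show ?case
    using Write.IH[of "\<lambda>i. F i - {a}"] Write.prems by (fastforce simp: disjoint_family_on_def)
qed simp

lemma secret_reads_le_cost: "secret_reads p m S \<le> exec_cost p m"
proof (induction p arbitrary: m S)
  case (Read a k)
  have "secret_reads (k (m a)) m S \<le> exec_cost (k (m a)) m" by (rule Read) simp
  then show ?case by (auto simp: Let_def split_beta)
qed (auto simp: Let_def split_beta le_SucI)

section \<open>Covering random lists by few cells\<close>

definition lists_of :: "'a set \<Rightarrow> nat \<Rightarrow> 'a list set" where
  "lists_of U l = {xs. set xs \<subseteq> U \<and> length xs = l}"

lemma finite_lists_of [simp]: "finite U \<Longrightarrow> finite (lists_of U l)"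
  by (simp add: lists_of_def finite_lists_length_eq)

lemma card_lists_of: "finite U \<Longrightarrow> card (lists_of U l) = card U ^ l"
  by (simp add: lists_of_def card_lists_length_eq)

lemma sum_lists_of_append:
  "(\<Sum>xs\<in>lists_of U (k + l). f xs) = (\<Sum>xs\<in>lists_of U k. \<Sum>ys\<in>lists_of U l. f (xs @ ys))"
proof -
  have "bij_betw (\<lambda>(xs, ys). xs @ ys) (lists_of U k \<times> lists_of U l) (lists_of U (k + l))"
    by (rule bij_betw_byWitness[where f' = "\<lambda>zs. (take k zs, drop k zs)"])
      (auto simp: lists_of_def dest: in_set_takeD in_set_dropD)
  then have "(\<Sum>xs\<in>lists_of U (k + l). f xs)
      = (\<Sum>(xs, ys)\<in>lists_of U k \<times> lists_of U l. f (xs @ ys))"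
    by (subst sum.reindex_bij_betw[symmetric]) (auto simp: case_prod_unfold)
  then show ?thesis by (simp add: sum.cartesian_product)
qed

lemma lists_of_Suc: "lists_of U (Suc l) = (\<lambda>(x, xs). x # xs) ` (U \<times> lists_of U l)"
  by (force simp: lists_of_def length_Suc_conv image_iff)

lemma sum_lists_of_Suc:
  "(\<Sum>xs\<in>lists_of U (Suc l). f xs) = (\<Sum>xs\<in>lists_of U l. \<Sum>x\<in>U. f (x # xs))"
proof -
  have "inj_on (\<lambda>(x, xs). x # xs) (U \<times> lists_of U l)" by (auto simp: inj_on_def)
  then have "(\<Sum>xs\<in>lists_of U (Suc l). f xs) = (\<Sum>(x, xs)\<in>U \<times> lists_of U l. f (x # xs))"
    by (simp add: lists_of_Suc sum.reindex case_prod_unfold)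
  also have "\<dots> = (\<Sum>x\<in>U. \<Sum>xs\<in>lists_of U l. f (x # xs))"
    by (simp add: sum.cartesian_product)
  finally show ?thesis by (simp add: sum.swap[of _ U])
qed

text \<open>The list is revealed from its end, so an entry is compared with the entries after it.
  \<open>Z\<close> will hold exceptional keys and \<open>nb y\<close> the keys that share an
  unpopular cell with \<open>y\<close>.\<close>

primrec repeats :: "'a set \<Rightarrow> ('a \<Rightarrow> 'a set) \<Rightarrow> 'a list \<Rightarrow> nat" where
  "repeats Z nb [] = 0"
| "repeats Z nb (x # xs) = (if x \<in> Z \<or> (\<exists>y\<in>set xs. x \<in> nb y) then 1 else 0) + repeats Z nb xs"

text \<open>An exponential moment: whatever the tail is, at most z + l q \<le> \<rho> |U| values
  turn the new entry into a repetition, so each entry contributes a factor of at most |U| (1 +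
  \<rho> t). The induction runs over \<open>n\<close>, while the bound for the tail uses the fixed
  \<open>l\<close>.\<close>

lemma sum_power_repeats_le:
  fixes t :: real
  assumes U: "finite U" "U \<noteq> {}" and t: "t \<ge> 1" and Z: "Z \<subseteq> U" "real (card Z) \<le> z"
    and nb: "\<And>y. y \<in> U \<Longrightarrow> nb y \<subseteq> U \<and> real (card (nb y)) \<le> q"
    and n: "n \<le> l" and zq: "z + real l * q \<le> \<rho> * real (card U)"
  shows "(\<Sum>xs\<in>lists_of U n. t ^ repeats Z nb xs) \<le> (real (card U) * (1 + \<rho> * t)) ^ n"
  using n
proof (induction n)
  case 0
  have "lists_of U 0 = {[]}" by (auto simp: lists_of_def)
  then show ?case by simp
next
  case (Suc n)
  have q: "0 \<le> q" using U nb by (metis ex_in_conv of_nat_0_le_iff order_trans)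
  have step: "(\<Sum>x\<in>U. t ^ repeats Z nb (x # xs))
      \<le> t ^ repeats Z nb xs * (real (card U) * (1 + \<rho> * t))" if xs: "xs \<in> lists_of U n" for xs
  proof -
    define R where "R = Z \<union> (\<Union>y\<in>set xs. nb y)"
    have xsU: "set xs \<subseteq> U" "length xs = n" using xs by (auto simp: lists_of_def)
    have RU: "R \<subseteq> U" using Z nb xsU by (auto simp: R_def)
    have "real (card R) \<le> real (card Z) + real (card (\<Union>y\<in>set xs. nb y))"
      unfolding R_def using card_Un_le by (metis of_nat_add of_nat_mono)
    also have "real (card (\<Union>y\<in>set xs. nb y)) \<le> (\<Sum>y\<in>set xs. real (card (nb y)))"
      using card_UN_le[of "set xs" nb] by (metis List.finite_set of_nat_mono of_nat_sum)
    also have "\<dots> \<le> (\<Sum>y\<in>set xs. q)" using nb xsU by (intro sum_mono) auto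
    also have "\<dots> = real (card (set xs)) * q" by simp
    also have "\<dots> \<le> real l * q"
    proof -
      have "card (set xs) \<le> l" using card_length[of xs] xsU Suc.prems by linarith
      then show ?thesis using q by (intro mult_right_mono) auto
    qed
    finally have cR: "real (card R) \<le> \<rho> * real (card U)" using Z zq by linarith
    have "(\<Sum>x\<in>U. if x \<in> R then t else 1) \<le> (\<Sum>x\<in>U. 1 + (if x \<in> R then t else 0))"
      using t by (intro sum_mono) auto
    also have "\<dots> = real (card U) + (\<Sum>x\<in>U \<inter> R. t)"
      by (simp only: sum.distrib sum.inter_restrict[OF U(1)]) simp
    also have "\<dots> = real (card U) + real (card R) * t" using RU by (simp add: Int_absorb1)
    also have "\<dots> \<le> real (card U) + \<rho> * real (card U) * t"
      using cR t by (intro add_left_mono mult_right_mono) auto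
    finally have "(\<Sum>x\<in>U. if x \<in> R then t else 1) \<le> real (card U) * (1 + \<rho> * t)"
      by (simp add: algebra_simps)
    then have "t ^ repeats Z nb xs * (\<Sum>x\<in>U. if x \<in> R then t else 1)
        \<le> t ^ repeats Z nb xs * (real (card U) * (1 + \<rho> * t))"
      using t by (intro mult_left_mono) auto
    moreover have "(\<Sum>x\<in>U. t ^ repeats Z nb (x # xs))
        = (\<Sum>x\<in>U. t ^ repeats Z nb xs * (if x \<in> R then t else 1))"
      by (intro sum.cong) (auto simp: R_def)
    ultimately show ?thesis by (simp add: sum_distrib_left)
  qed
  have "0 \<le> \<rho> * real (card U)"
    using zq Z q by (smt (verit) mult_nonneg_nonneg of_nat_0_le_iff)
  then have nonneg: "0 \<le> real (card U) * (1 + \<rho> * t)"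
    using t by (simp add: distrib_left mult.assoc[symmetric] mult.commute[of "real (card U)"])
  have "(\<Sum>xs\<in>lists_of U (Suc n). t ^ repeats Z nb xs)
      \<le> (\<Sum>xs\<in>lists_of U n. t ^ repeats Z nb xs * (real (card U) * (1 + \<rho> * t)))"
    unfolding sum_lists_of_Suc by (intro sum_mono step)
  also have "\<dots> = (\<Sum>xs\<in>lists_of U n. t ^ repeats Z nb xs) * (real (card U) * (1 + \<rho> * t))"
    by (simp add: sum_distrib_right)
  also have "\<dots> \<le> (real (card U) * (1 + \<rho> * t)) ^ n * (real (card U) * (1 + \<rho> * t))"
    using Suc nonneg by (intro mult_right_mono) auto
  finally show ?case by (simp add: mult.commute)
qed

lemma card_many_repeats_le:
  assumes U: "finite U" "U \<noteq> {}" and Z: "Z \<subseteq> U" "real (card Z) \<le> z"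
    and nb: "\<And>y. y \<in> U \<Longrightarrow> nb y \<subseteq> U \<and> real (card (nb y)) \<le> q"
    and zq: "z + real l * q \<le> \<rho> * real (card U)" and \<rho>: "0 < \<rho>" "\<rho> \<le> 1"
  shows "real (card {xs \<in> lists_of U l. s \<le> real (repeats Z nb xs)})
    \<le> (2 * real (card U)) ^ l * \<rho> powr s"
proof -
  let ?E = "{xs \<in> lists_of U l. s \<le> real (repeats Z nb xs)}"
  \<comment> \<open>Markov's inequality for the exponential moment: with this \<open>t\<close> an
    entry costs the factor 1 + \<rho> t = 2, and every required repetition gains a factor
    \<rho>.\<close>
  define t where "t = 1 / \<rho>"
  have t: "1 \<le> t" using \<rho> by (simp add: t_def)
  have "real (card ?E) * t powr s = (\<Sum>xs\<in>?E. t powr s)" by simp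
  also have "\<dots> \<le> (\<Sum>xs\<in>?E. t ^ repeats Z nb xs)"
  proof (rule sum_mono)
    fix xs assume "xs \<in> ?E"
    then have "t powr s \<le> t powr real (repeats Z nb xs)" using t by (intro powr_mono) auto
    then show "t powr s \<le> t ^ repeats Z nb xs" using t by (simp add: powr_realpow)
  qed
  also have "\<dots> \<le> (\<Sum>xs\<in>lists_of U l. t ^ repeats Z nb xs)"
    using U t by (intro sum_mono2) auto
  also have "\<dots> \<le> (real (card U) * (1 + \<rho> * t)) ^ l"
    by (rule sum_power_repeats_le[OF U t Z nb order_refl zq])
  also have "real (card U) * (1 + \<rho> * t) = 2 * real (card U)" using \<rho> by (simp add: t_def)
  finally have "real (card ?E) * t powr s \<le> (2 * real (card U)) ^ l" .
  moreover have "t powr s = 1 / \<rho> powr s" using \<rho> by (simp add: t_def powr_divide)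
  ultimately show ?thesis using \<rho> by (simp add: field_simps)
qed

section \<open>Heavy and light cells\<close>

definition load :: "'a set \<Rightarrow> ('a \<Rightarrow> nat set) \<Rightarrow> nat \<Rightarrow> real" where
  "load U A c = real (card {x \<in> U. c \<in> A x}) / real (card U)"

text \<open>
  A cell helps to write \<open>l\<close> random keys with fewer than one cell per key only if about one of these
  keys uses it. The potential counts the cells of \<open>x\<close>, discounted by how far they are from this.
\<close>

definition potential :: "'a set \<Rightarrow> ('a \<Rightarrow> nat set) \<Rightarrow> nat \<Rightarrow> 'a \<Rightarrow> real" where
  "potential U A l x = (\<Sum>c\<in>A x. min (load U A c * real l) (1 / (load U A c * real l)))"

lemma load_nonneg: "0 \<le> load U A c"
  by (simp add: load_def)

lemma load_pos: "finite U \<Longrightarrow> x \<in> U \<Longrightarrow> c \<in> A x \<Longrightarrow> 0 < load U A c"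
  by (auto simp: load_def card_gt_0_iff intro!: divide_pos_pos)

text \<open>A covered key that is outside of \<open>Z\<close> and no repetition has a cell of
  \<open>C - H\<close> that no later key outside of \<open>Z\<close> uses, and is charged to this
  cell. It cannot be covered by \<open>C \<inter> H\<close>, as all keys using these cells are in
  \<open>Z\<close>.\<close>

lemma covering_uses_repeats:
  fixes A :: "'a \<Rightarrow> nat set"
  assumes C: "finite C" and X: "set X \<subseteq> U" and YZ: "Y \<subseteq> Z"
    and CH: "\<And>x. x \<in> U \<Longrightarrow> A x \<inter> C \<inter> H \<noteq> {} \<Longrightarrow> x \<in> Z"
    and nb: "\<And>x y. x \<in> U \<Longrightarrow> y \<in> U \<Longrightarrow> y \<notin> Z \<Longrightarrow> A x \<inter> A y - H \<noteq> {} \<Longrightarrow> x \<in> nb y"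
  shows "length (filter (\<lambda>x. x \<in> Y \<or> A x \<inter> C \<noteq> {}) X)
    \<le> repeats Z nb X + card (C \<inter> (\<Union>x\<in>set X - Z. A x - H))"
  using X
proof (induction X)
  case (Cons x X)
  let ?V = "\<lambda>X. C \<inter> (\<Union>x\<in>set X - Z. A x - H)"
  have IH: "length (filter (\<lambda>x. x \<in> Y \<or> A x \<inter> C \<noteq> {}) X) \<le> repeats Z nb X + card (?V X)"
    using Cons by auto
  have mono: "card (?V X) \<le> card (?V (x # X))" using C by (intro card_mono) auto
  consider "\<not> (x \<in> Y \<or> A x \<inter> C \<noteq> {})" | "x \<in> Z \<or> (\<exists>y\<in>set X. x \<in> nb y)"
    | "x \<in> Y \<or> A x \<inter> C \<noteq> {}" "x \<notin> Z" "\<forall>y\<in>set X. x \<notin> nb y" by auto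
  then show ?case
  proof cases
    case 3
    then obtain c where c: "c \<in> A x" "c \<in> C" "c \<notin> H" using YZ CH[of x] Cons.prems by auto
    have "c \<notin> ?V X"
    proof
      assume "c \<in> ?V X"
      then obtain y where "y \<in> set X" "y \<notin> Z" "c \<in> A y" by auto
      then have "x \<in> nb y" using c Cons.prems by (intro nb) auto
      then show False using 3 \<open>y \<in> set X\<close> by auto
    qed
    moreover have "insert c (?V X) \<subseteq> ?V (x # X)" using c 3 by auto
    ultimately have "Suc (card (?V X)) \<le> card (?V (x # X))"
      using C by (metis card_insert_disjoint card_mono finite_Int)
    then show ?thesis using IH 3 by auto
  qed (use IH mono in auto)
qed simp

text \<open>A union bound over the heavy part of the covering set is enough: once it is fixed,
  \<open>Z\<close> and \<open>nb\<close> are fixed as well, and at least (b - a) l entries must be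
  repetitions. \<rho> adds up the densities of \<open>Y\<close> (\<delta>1), of the other keys that
  use the heavy part (\<delta>2), of the exceptional set \<open>W\<close> and of the neighbours of
  \<open>l\<close> keys (sqrt \<eta> each).\<close>

lemma card_covered_lists_le:
  fixes A :: "'a \<Rightarrow> nat set"
  assumes U: "finite U" "U \<noteq> {}" and l: "0 < l" and A: "\<And>x. x \<in> U \<Longrightarrow> finite (A x)"
    and Y: "Y \<subseteq> U" "real (card Y) \<le> \<delta>1 * real (card U)"
    and \<eta>: "0 < \<eta>" and pot: "(\<Sum>x\<in>U. potential U A l x) \<le> \<eta> * real (card U)"
    and \<delta>: "0 \<le> \<delta>1" "0 \<le> \<delta>2" and \<rho>: "\<delta>1 + \<delta>2 + 2 * sqrt \<eta> \<le> \<rho>" "\<rho> \<le> 1"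
  shows "real (card {X \<in> lists_of U l. \<exists>C. finite C \<and> real (card C) \<le> a * real l \<and>
      real (card {x \<in> U - Y. A x \<inter> C \<noteq> {}}) \<le> \<delta>2 * real (card U) \<and>
      b * real l \<le> real (length (filter (\<lambda>x. x \<in> Y \<or> A x \<inter> C \<noteq> {}) X))})
    \<le> 2 powr (\<eta> * real l) * ((2 * real (card U)) ^ l * \<rho> powr ((b - a) * real l))"
proof -
  define N where "N = real (card U)"
  \<comment> \<open>The expected number of the \<open>l\<close> random keys whose query probes
    \<open>c\<close>. Heavy cells are those where it reaches one.\<close>
  define r where "r c = load U A c * real l" for c
  define H where "H = {c \<in> (\<Union>x\<in>U. A x). 1 \<le> r c}"
  define light where "light x = (\<Sum>c\<in>A x - H. r c)" for x
  define W where "W = {x \<in> U. sqrt \<eta> < light x}"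
  define Z where "Z C = Y \<union> {x \<in> U - Y. A x \<inter> C \<noteq> {}} \<union> W" for C
  define nb where "nb C y = (if y \<in> Z C then {} else {x \<in> U. A x \<inter> A y - H \<noteq> {}})" for C y
  define \<H> where "\<H> = {C. C \<subseteq> H \<and> real (card {x \<in> U - Y. A x \<inter> C \<noteq> {}}) \<le> \<delta>2 * N}"
  have N: "0 < N" using U by (simp add: N_def card_gt_0_iff)
  have finH: "finite H" using U A by (auto simp: H_def)
  have finHs: "finite \<H>" using finH by (simp add: \<H>_def)
  have rpos: "0 < r c" if "x \<in> U" "c \<in> A x" for x c
    unfolding r_def using l that by (intro mult_pos_pos load_pos[OF U(1)]) auto
  have rnn: "0 \<le> r c" for c by (simp add: r_def load_nonneg)
  have rN: "r c * N / real l = real (card {x \<in> U. c \<in> A x})" for c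
    using l N by (simp add: r_def load_def N_def)
  have pot': "(\<Sum>x\<in>U. \<Sum>c\<in>A x. min (r c) (1 / r c)) \<le> \<eta> * N"
    using pot by (simp add: potential_def r_def N_def)

  \<comment> \<open>A heavy cell is used by r N / l keys and adds 1 / r to the potential of each,
    hence N / l in total. The potential thus has room for only \<eta> l heavy cells.\<close>
  have cardH: "real (card H) \<le> \<eta> * real l"
  proof -
    have "real (card H) * (N / real l) = (\<Sum>c\<in>H. N / real l)" by simp
    also have "\<dots> = (\<Sum>c\<in>H. \<Sum>x\<in>{x \<in> U. c \<in> A x}. 1 / r c)"
    proof (rule sum.cong)
      fix c assume "c \<in> H"
      then have "1 \<le> r c" by (simp add: H_def)
      have "(\<Sum>x\<in>{x \<in> U. c \<in> A x}. 1 / r c) = (r c * N / real l) * (1 / r c)"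
        unfolding rN by simp
      also have "\<dots> = N / real l" using \<open>1 \<le> r c\<close> by simp
      finally show "N / real l = (\<Sum>x\<in>{x \<in> U. c \<in> A x}. 1 / r c)" ..
    qed simp
    also have "\<dots> = (\<Sum>c\<in>H. \<Sum>x\<in>U. if c \<in> A x then 1 / r c else 0)"
      by (simp only: sum.inter_filter[OF U(1)])
    also have "\<dots> = (\<Sum>x\<in>U. \<Sum>c\<in>H. if c \<in> A x then 1 / r c else 0)" by (rule sum.swap)
    also have "\<dots> \<le> (\<Sum>x\<in>U. \<Sum>c\<in>A x. min (r c) (1 / r c))"
    proof (rule sum_mono)
      fix x assume x: "x \<in> U"
      have "(\<Sum>c\<in>H. if c \<in> A x then 1 / r c else 0) = (\<Sum>c\<in>{c \<in> H. c \<in> A x}. 1 / r c)"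
        using finH by (simp add: sum.inter_filter)
      also have "\<dots> = (\<Sum>c\<in>{c \<in> H. c \<in> A x}. min (r c) (1 / r c))"
      proof (intro sum.cong refl)
        fix c assume "c \<in> {c \<in> H. c \<in> A x}"
        then have "1 \<le> r c" by (simp add: H_def)
        then have "1 / r c \<le> r c" by (smt (verit) divide_le_eq_1)
        then show "1 / r c = min (r c) (1 / r c)" by simp
      qed
      also have "\<dots> \<le> (\<Sum>c\<in>A x. min (r c) (1 / r c))"
        using A x rnn by (intro sum_mono2) auto
      finally show "(\<Sum>c\<in>H. if c \<in> A x then 1 / r c else 0) \<le> (\<Sum>c\<in>A x. min (r c) (1 / r c))" .
    qed
    also note pot'
    finally show ?thesis using N l by (simp add: field_simps)
  qed

  have sumlight: "(\<Sum>x\<in>U. light x) \<le> \<eta> * N"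
  proof -
    have "(\<Sum>x\<in>U. light x) \<le> (\<Sum>x\<in>U. \<Sum>c\<in>A x. min (r c) (1 / r c))"
    proof (rule sum_mono)
      fix x assume x: "x \<in> U"
      have "light x = (\<Sum>c\<in>A x - H. min (r c) (1 / r c))"
        unfolding light_def
      proof (intro sum.cong refl)
        fix c assume "c \<in> A x - H"
        then have "r c < 1" "0 < r c" using x rpos by (auto simp: H_def)
        then have "r c \<le> 1 / r c" by (smt (verit) le_divide_eq_1)
        then show "r c = min (r c) (1 / r c)" by simp
      qed
      also have "\<dots> \<le> (\<Sum>c\<in>A x. min (r c) (1 / r c))"
        using A x rnn by (intro sum_mono2) auto
      finally show "light x \<le> (\<Sum>c\<in>A x. min (r c) (1 / r c))" .
    qed
    with pot' show ?thesis by linarith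
  qed
  have lightnn: "0 \<le> light x" for x by (simp add: light_def rnn sum_nonneg)
  \<comment> \<open>The mean of \<open>light\<close> is at most \<eta>. Markov's inequality at the
    threshold sqrt \<eta> balances the share of exceptional keys against the number of neighbours of
    the others.\<close>
  have cardW: "real (card W) \<le> sqrt \<eta> * N"
  proof -
    have "real (card W) * sqrt \<eta> = (\<Sum>x\<in>W. sqrt \<eta>)" by simp
    also have "\<dots> \<le> (\<Sum>x\<in>W. light x)" by (intro sum_mono) (simp add: W_def)
    also have "\<dots> \<le> (\<Sum>x\<in>U. light x)" using U lightnn by (intro sum_mono2) (auto simp: W_def)
    also have "\<dots> \<le> \<eta> * N" by (rule sumlight)
    finally have "real (card W) * sqrt \<eta> \<le> \<eta> * N" .
    also have "\<eta> * N = (sqrt \<eta> * N) * sqrt \<eta>"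
      using \<eta> by (simp add: mult.commute mult.left_commute mult.assoc[symmetric])
    finally have "real (card W) * sqrt \<eta> \<le> (sqrt \<eta> * N) * sqrt \<eta>" .
    then show ?thesis using \<eta> by (simp add: mult.commute)
  qed

  have bound: "real (card {X \<in> lists_of U l. (b - a) * real l \<le> real (repeats (Z C) (nb C) X)})
      \<le> (2 * N) ^ l * \<rho> powr ((b - a) * real l)" if C: "C \<in> \<H>" for C
    unfolding N_def
  proof (rule card_many_repeats_le[OF U, where z = "(\<delta>1 + \<delta>2 + sqrt \<eta>) * N"
        and q = "sqrt \<eta> * N / real l"])
    show "Z C \<subseteq> U" using Y by (auto simp: Z_def W_def)
    have "card (Z C) \<le> card Y + card {x \<in> U - Y. A x \<inter> C \<noteq> {}} + card W"
      unfolding Z_def by (meson card_Un_le add_le_mono order_refl order_trans)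
    then have "real (card (Z C)) \<le> real (card Y) + real (card {x \<in> U - Y. A x \<inter> C \<noteq> {}}) + real (card W)"
      by linarith
    moreover have "real (card {x \<in> U - Y. A x \<inter> C \<noteq> {}}) \<le> \<delta>2 * N" using C by (simp add: \<H>_def)
    ultimately show "real (card (Z C)) \<le> (\<delta>1 + \<delta>2 + sqrt \<eta>) * N"
      using Y cardW unfolding N_def by (simp add: algebra_simps)
    show "nb C y \<subseteq> U \<and> real (card (nb C y)) \<le> sqrt \<eta> * N / real l" if y: "y \<in> U" for y
    proof (cases "y \<in> Z C")
      case True
      then show ?thesis using \<eta> N by (simp add: nb_def)
    next
      case False
      \<comment> \<open>A light cell \<open>c\<close> of \<open>y\<close> makes r c N / l keys
        neighbours of \<open>y\<close>, so \<open>light y\<close> measures the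
        neighbourhood.\<close>
      have "nb C y \<subseteq> (\<Union>c\<in>A y - H. {x \<in> U. c \<in> A x})" using False by (auto simp: nb_def)
      then have "card (nb C y) \<le> card (\<Union>c\<in>A y - H. {x \<in> U. c \<in> A x})"
        using U A y by (intro card_mono) auto
      also have "\<dots> \<le> (\<Sum>c\<in>A y - H. card {x \<in> U. c \<in> A x})" using A y by (intro card_UN_le) auto
      finally have "real (card (nb C y)) \<le> (\<Sum>c\<in>A y - H. real (card {x \<in> U. c \<in> A x}))"
        by (simp only: of_nat_sum[symmetric] of_nat_le_iff)
      also have "\<dots> = light y * N / real l"
        unfolding rN[symmetric] by (simp add: light_def sum_distrib_right sum_divide_distrib)
      also have "\<dots> \<le> sqrt \<eta> * N / real l"
        using False y N by (intro divide_right_mono mult_right_mono) (auto simp: Z_def W_def)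
      finally show ?thesis by (auto simp: nb_def)
    qed
    have "(\<delta>1 + \<delta>2 + sqrt \<eta>) * N + real l * (sqrt \<eta> * N / real l) = (\<delta>1 + \<delta>2 + 2 * sqrt \<eta>) * N"
      using l by (simp add: algebra_simps)
    also have "\<dots> \<le> \<rho> * N" using \<rho> N by (intro mult_right_mono) auto
    finally show "(\<delta>1 + \<delta>2 + sqrt \<eta>) * N + real l * (sqrt \<eta> * N / real l) \<le> \<rho> * real (card U)"
      by (simp add: N_def)
    show "0 < \<rho>" using \<rho> \<delta> \<eta> by (smt (verit) real_sqrt_gt_zero)
  qed (use \<rho> in auto)

  let ?B = "{X \<in> lists_of U l. \<exists>C. finite C \<and> real (card C) \<le> a * real l \<and>
      real (card {x \<in> U - Y. A x \<inter> C \<noteq> {}}) \<le> \<delta>2 * real (card U) \<and>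
      b * real l \<le> real (length (filter (\<lambda>x. x \<in> Y \<or> A x \<inter> C \<noteq> {}) X))}"
  \<comment> \<open>The union is indexed by \<open>C \<inter> H\<close> instead of \<open>C\<close>:
    light cells enter only through their number, which is at most a l.\<close>
  have "?B \<subseteq> (\<Union>C\<in>\<H>. {X \<in> lists_of U l. (b - a) * real l \<le> real (repeats (Z C) (nb C) X)})"
  proof
    fix X assume "X \<in> ?B"
    then obtain C where X: "X \<in> lists_of U l" and C: "finite C" "real (card C) \<le> a * real l"
      "real (card {x \<in> U - Y. A x \<inter> C \<noteq> {}}) \<le> \<delta>2 * N"
      "b * real l \<le> real (length (filter (\<lambda>x. x \<in> Y \<or> A x \<inter> C \<noteq> {}) X))"
      by (auto simp: N_def)
    have "card {x \<in> U - Y. A x \<inter> (C \<inter> H) \<noteq> {}} \<le> card {x \<in> U - Y. A x \<inter> C \<noteq> {}}"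
      using U by (intro card_mono) auto
    then have CH: "C \<inter> H \<in> \<H>" using C by (auto simp: \<H>_def)
    have "length (filter (\<lambda>x. x \<in> Y \<or> A x \<inter> C \<noteq> {}) X) \<le> repeats (Z (C \<inter> H)) (nb (C \<inter> H)) X
        + card (C \<inter> (\<Union>x\<in>set X - Z (C \<inter> H). A x - H))"
    proof (rule covering_uses_repeats[where U = U])
      show "set X \<subseteq> U" using X by (simp add: lists_of_def)
      show "Y \<subseteq> Z (C \<inter> H)" by (auto simp: Z_def)
      show "x \<in> Z (C \<inter> H)" if "x \<in> U" "A x \<inter> C \<inter> H \<noteq> {}" for x
        using that by (auto simp: Z_def)
      show "x \<in> nb (C \<inter> H) y"
        if "x \<in> U" "y \<in> U" "y \<notin> Z (C \<inter> H)" "A x \<inter> A y - H \<noteq> {}" for x y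
        using that by (simp add: nb_def)
    qed (rule C)
    moreover have "card (C \<inter> (\<Union>x\<in>set X - Z (C \<inter> H). A x - H)) \<le> card C"
      using C by (intro card_mono) auto
    ultimately have "(b - a) * real l \<le> real (repeats (Z (C \<inter> H)) (nb (C \<inter> H)) X)"
      using C(2,4) unfolding left_diff_distrib by linarith
    then show "X \<in> (\<Union>C\<in>\<H>. {X \<in> lists_of U l. (b - a) * real l \<le> real (repeats (Z C) (nb C) X)})"
      using CH X by blast
  qed
  then have "card ?B \<le> card (\<Union>C\<in>\<H>. {X \<in> lists_of U l.
      (b - a) * real l \<le> real (repeats (Z C) (nb C) X)})"
    using finHs U by (intro card_mono) auto
  also have "\<dots> \<le> (\<Sum>C\<in>\<H>. card {X \<in> lists_of U l.
      (b - a) * real l \<le> real (repeats (Z C) (nb C) X)})"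
    by (rule card_UN_le[OF finHs])
  finally have "real (card ?B) \<le> (\<Sum>C\<in>\<H>. real (card {X \<in> lists_of U l.
      (b - a) * real l \<le> real (repeats (Z C) (nb C) X)}))"
    by (simp only: of_nat_sum[symmetric] of_nat_le_iff)
  also have "\<dots> \<le> (\<Sum>C\<in>\<H>. (2 * N) ^ l * \<rho> powr ((b - a) * real l))"
    by (intro sum_mono bound)
  also have "\<dots> = real (card \<H>) * ((2 * N) ^ l * \<rho> powr ((b - a) * real l))" by simp
  also have "\<dots> \<le> 2 powr (\<eta> * real l) * ((2 * N) ^ l * \<rho> powr ((b - a) * real l))"
  proof (rule mult_right_mono)
    have "card \<H> \<le> card (Pow H)" using finH by (intro card_mono) (auto simp: \<H>_def)
    then have "real (card \<H>) \<le> 2 powr real (card H)"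
      by (simp add: card_Pow finH powr_realpow)
    also have "\<dots> \<le> 2 powr (\<eta> * real l)" using cardH by simp
    finally show "real (card \<H>) \<le> 2 powr (\<eta> * real l)" .
  qed (use N in simp)
  finally show ?thesis by (simp add: N_def)
qed

section \<open>A single epoch\<close>

definition conf :: "det_ds \<Rightarrow> nat list \<Rightarrow> nat \<Rightarrow> config" where
  "conf D xs t = config_after D (map Insert (take t xs))"

abbreviation insert_prog :: "det_ds \<Rightarrow> nat list \<Rightarrow> nat \<Rightarrow> (bool list \<times> bool) cell_prog" where
  "insert_prog D xs t \<equiv> program D (Insert (xs ! t)) (fst (conf D xs t))"

definition cells_written :: "det_ds \<Rightarrow> nat list \<Rightarrow> nat \<Rightarrow> nat set" where
  "cells_written D xs t = written (insert_prog D xs t) (snd (conf D xs t))"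

definition insert_cost :: "det_ds \<Rightarrow> nat list \<Rightarrow> nat \<Rightarrow> nat" where
  "insert_cost D xs t = exec_cost (insert_prog D xs t) (snd (conf D xs t))"

definition secret :: "det_ds \<Rightarrow> nat list \<Rightarrow> nat \<Rightarrow> nat \<Rightarrow> nat \<Rightarrow> nat set" where
  "secret D xs lo hi t =
     (\<Union>s\<in>{lo..<hi}. cells_written D xs s) - (\<Union>s\<in>{hi..<t}. cells_written D xs s)"

text \<open>The bits the observer is charged for. The keys outside of the window are known in
  advance, and they determine the memory at time \<open>hi\<close> except for the cells written in
  the window.\<close>

definition observation :: "det_ds \<Rightarrow> nat list \<Rightarrow> nat \<Rightarrow> nat \<Rightarrow> nat \<Rightarrow> bool list" where
  "observation D xs lo hi T = fst (conf D xs hi) @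
     concat (map (\<lambda>t. transcript (insert_prog D xs t) (snd (conf D xs t)) (secret D xs lo hi t))
       [hi..<T])"

definition query_cells :: "det_ds \<Rightarrow> nat list \<Rightarrow> nat \<Rightarrow> nat \<Rightarrow> nat set" where
  "query_cells D xs T x = probed (program D (Query x) (fst (conf D xs T))) (snd (conf D xs T))"

definition query_answer :: "det_ds \<Rightarrow> nat list \<Rightarrow> nat \<Rightarrow> nat \<Rightarrow> bool" where
  "query_answer D xs T x = answer D (Query x) (conf D xs T)"

section \<open>Reconstruction from an observation\<close>

lemma conf_Suc:
  "t < length xs \<Longrightarrow> conf D xs (Suc t) = step D (Insert (xs ! t)) (conf D xs t)"
  by (simp add: conf_def config_after_def take_Suc_conv_app_nth)

lemma fst_conf_Suc: "t < length xs \<Longrightarrow>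
    fst (conf D xs (Suc t)) = fst (fst (exec (insert_prog D xs t) (snd (conf D xs t))))"
  and snd_conf_Suc: "t < length xs \<Longrightarrow>
    snd (conf D xs (Suc t)) = exec_mem (insert_prog D xs t) (snd (conf D xs t))"
  by (simp_all add: conf_Suc step_def split_beta)

lemma conf_cong: "take t xs = take t ys \<Longrightarrow> conf D xs t = conf D ys t"
  by (simp add: conf_def)

lemma wf_insert_prog:
  assumes "wf_det_ds n M w D" "set xs \<subseteq> universe n" "t < length xs" "length (fst (conf D xs t)) = M"
  shows "wf_prog w (\<lambda>(s, b). length s = M) (insert_prog D xs t)"
proof -
  have "xs ! t \<in> universe n" using assms(2,3) by (meson nth_mem subsetD)
  then show ?thesis using assms(1,4) by (simp add: wf_det_ds_def)
qed

lemma wf_conf: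
  assumes D: "wf_det_ds n M w D" and xs: "set xs \<subseteq> universe n" and "t \<le> length xs"
  shows "length (fst (conf D xs t)) = M \<and> (\<forall>a. length (snd (conf D xs t) a) = w)"
  using assms(3)
proof (induction t)
  case 0
  then show ?case using D by (simp add: conf_def config_after_def wf_det_ds_def)
next
  case (Suc t)
  then have IH: "length (fst (conf D xs t)) = M" "\<And>a. length (snd (conf D xs t) a) = w" by auto
  from wf_exec[OF wf_insert_prog[OF D xs _ IH(1)] IH(2)] Suc.prems
  show ?case by (simp add: fst_conf_Suc snd_conf_Suc split_beta)
qed

lemma memory_unwritten:
  assumes "lo \<le> t" "t \<le> length xs" "a \<notin> (\<Union>s\<in>{lo..<t}. cells_written D xs s)"
  shows "snd (conf D xs t) a = snd (conf D xs lo) a"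
  using assms
proof (induction t)
  case (Suc t)
  show ?case
  proof (cases "lo \<le> t")
    case True
    have "a \<notin> cells_written D xs t" using Suc.prems True by auto
    then have "snd (conf D xs (Suc t)) a = snd (conf D xs t) a"
      using Suc.prems by (simp add: snd_conf_Suc cells_written_def exec_mem_unwritten)
    also have "\<dots> = snd (conf D xs lo) a" using Suc.prems True by (intro Suc.IH) auto
    finally show ?thesis .
  next
    case False
    then show ?thesis using Suc.prems by (simp add: le_Suc_eq)
  qed
qed simp

lemma secret_Suc:
  "hi \<le> t \<Longrightarrow> secret D xs lo hi (Suc t) = secret D xs lo hi t - cells_written D xs t"
  by (auto simp: secret_def atLeastLessThanSuc)

text \<open>The state at \<open>hi\<close> has \<open>M\<close> bits in both runs, so it can be cut
  off the stream, and non-secret memory at \<open>hi\<close> is that at \<open>lo\<close>.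
  Afterwards equal states and equal keys run the same program, whose transcript keeps the runs
  together. The rests \<open>u\<close> and \<open>u'\<close> let the induction split off the last
  transcript.\<close>

lemma observation_eqD:
  assumes D: "wf_det_ds n M w D"
    and xs: "set xs \<subseteq> universe n" and ys: "set ys \<subseteq> universe n" and len: "length xs = length ys"
    and T: "lo \<le> hi" "hi \<le> T" "T \<le> length xs"
    and before: "take lo xs = take lo ys"
    and after: "\<And>t. hi \<le> t \<Longrightarrow> t < T \<Longrightarrow> xs ! t = ys ! t"
    and eq: "observation D xs lo hi T @ u = observation D ys lo hi T @ u'"
  shows "fst (conf D xs T) = fst (conf D ys T) \<and> u = u' \<and>
    (\<forall>a. a \<notin> secret D xs lo hi T \<longrightarrow> a \<notin> secret D ys lo hi T \<longrightarrow>
      snd (conf D xs T) a = snd (conf D ys T) a)"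
  using T(2,3) after eq
proof (induction T arbitrary: u u' rule: dec_induct)
  case base
  have lens: "length (fst (conf D xs hi)) = length (fst (conf D ys hi))"
    using wf_conf[OF D xs, of hi] wf_conf[OF D ys, of hi] base len by simp
  have eq: "fst (conf D xs hi) = fst (conf D ys hi)" "u = u'"
    using base lens by (auto simp: observation_def)
  moreover have "snd (conf D xs hi) a = snd (conf D ys hi) a"
    if "a \<notin> secret D xs lo hi hi" "a \<notin> secret D ys lo hi hi" for a
    using that memory_unwritten[of lo hi xs a D] memory_unwritten[of lo hi ys a D]
      base len T(1) conf_cong[OF before, of D] by (simp add: secret_def)
  ultimately show ?case by blast
next
  case (step t)
  let ?tr = "\<lambda>xs. transcript (insert_prog D xs t) (snd (conf D xs t)) (secret D xs lo hi t)"
  have t: "t < length xs" "t < length ys" using step.prems len by auto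
  have "observation D xs lo hi t @ (?tr xs @ u) = observation D ys lo hi t @ (?tr ys @ u')"
    using step.prems(3) step.hyps(1) by (simp add: observation_def)
  from step.IH[OF _ _ this] step.prems(1,2)
  have state: "fst (conf D xs t) = fst (conf D ys t)" and tr: "?tr xs @ u = ?tr ys @ u'"
    and mem: "\<And>a. a \<notin> secret D xs lo hi t \<Longrightarrow> a \<notin> secret D ys lo hi t \<Longrightarrow>
      snd (conf D xs t) a = snd (conf D ys t) a" by auto
  have prog: "insert_prog D ys t = insert_prog D xs t"
    using state step.prems(2)[of t] step.hyps by simp
  have wx: "length (fst (conf D xs t)) = M" "\<And>a. length (snd (conf D xs t) a) = w"
    using wf_conf[OF D xs, of t] t by auto
  have wy: "\<And>a. length (snd (conf D ys t) a) = w" using wf_conf[OF D ys, of t] t by auto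
  have "fst (exec (insert_prog D xs t) (snd (conf D xs t)))
      = fst (exec (insert_prog D xs t) (snd (conf D ys t))) \<and> u = u' \<and>
    (\<forall>a. a \<notin> secret D xs lo hi t - written (insert_prog D xs t) (snd (conf D xs t)) \<longrightarrow>
      a \<notin> secret D ys lo hi t - written (insert_prog D xs t) (snd (conf D ys t)) \<longrightarrow>
      exec_mem (insert_prog D xs t) (snd (conf D xs t)) a
        = exec_mem (insert_prog D xs t) (snd (conf D ys t)) a)"
    by (rule transcript_eqD[OF _ wf_insert_prog[OF D xs t(1) wx(1)] wx(2) wy mem])
      (use tr prog in \<open>simp_all\<close>)
  then show ?case
    using step.hyps t prog
    by (simp only: fst_conf_Suc snd_conf_Suc secret_Suc cells_written_def) simp
qed

lemma length_filter_le_filter: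
  "(\<And>x. x \<in> set xs \<Longrightarrow> P x \<Longrightarrow> Q x) \<Longrightarrow> length (filter P xs) \<le> length (filter Q xs)"
  by (induction xs) (auto simp: le_SucI)

text \<open>Each clause bounds a quantity whose mean is controlled elsewhere, so that its failure
  can be charged to this mean. Of interest is \<alpha> + \<beta> < 1: then the keys that are
  recognised outnumber the cells written for them.\<close>

definition good :: "det_ds \<Rightarrow> nat set \<Rightarrow> real \<Rightarrow> real \<Rightarrow> real \<Rightarrow> real \<Rightarrow> nat \<Rightarrow> nat \<Rightarrow> nat \<Rightarrow> nat list \<Rightarrow> bool"
  where
  "good D U \<eta> \<delta> \<alpha> \<beta> lo hi T xs \<longleftrightarrow>
     length (observation D xs lo hi T) \<le> hi - lo \<and>
     (\<Sum>x\<in>U. potential U (query_cells D xs T) (hi - lo) x) \<le> \<eta> * real (card U) \<and>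
     real (card {x \<in> U. query_cells D xs T x \<inter> secret D xs lo hi T \<noteq> {}}) \<le> \<delta> * real (card U) \<and>
     real (card {x \<in> U. query_answer D xs T x}) \<le> \<delta> * real (card U) \<and>
     real (length (filter (\<lambda>x. \<not> query_answer D xs T x) (take (hi - lo) (drop lo xs))))
       \<le> \<beta> * real (hi - lo) \<and>
     real (card (\<Union>s\<in>{lo..<hi}. cells_written D xs s)) \<le> \<alpha> * real (hi - lo)"

lemma finite_query_cells [simp]: "finite (query_cells D xs T x)"
  by (simp add: query_cells_def)

lemma finite_cells_written [simp]: "finite (cells_written D xs t)"
  by (simp add: cells_written_def)

text \<open>
  All sequences with the same observation are compared with a single one of them: outside the few queries
  that probe secret cells of the latter, its probes and answers are those of every other one.
\<close>

lemma card_good_le: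
  assumes D: "wf_det_ds n M w D" and U: "U = universe n" "U \<noteq> {}"
    and pre: "pre \<in> lists_of U lo" and post: "set post \<subseteq> U"
    and l: "0 < l" and T: "lo + l \<le> T" "T \<le> lo + l + length post"
    and \<eta>: "0 < \<eta>" and \<delta>: "0 \<le> \<delta>" and \<rho>: "3 * \<delta> + 2 * sqrt \<eta> \<le> \<rho>" "\<rho> \<le> 1"
  shows "real (card {X \<in> lists_of U l. good D U \<eta> \<delta> \<alpha> \<beta> lo (lo + l) T (pre @ X @ post)})
    \<le> 2 ^ Suc l * (2 powr (\<eta> * real l) * ((2 * real (card U)) ^ l * \<rho> powr ((1 - \<beta> - \<alpha>) * real l)))"
proof -
  define N where "N = real (card U)"
  define hi where "hi = lo + l"
  define \<xi> where "\<xi> X = pre @ X @ post" for X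
  define G where "G = {X \<in> lists_of U l. good D U \<eta> \<delta> \<alpha> \<beta> lo hi T (\<xi> X)}"
  define b where "b = 2 powr (\<eta> * real l) * ((2 * real (card U)) ^ l * \<rho> powr ((1 - \<beta> - \<alpha>) * real l))"
  \<comment> \<open>The possible observations of good sequences; a shorter one may be a prefix of a
    longer one, which is why all lengths up to \<open>l\<close> are counted.\<close>
  define Zs where "Zs = {z :: bool list. length z \<le> l}"
  have finU: "finite U" using U by (simp add: universe_def)
  have finZs: "finite Zs" and cardZs: "card Zs \<le> 2 ^ Suc l"
  proof -
    have Zs: "Zs = {z. set z \<subseteq> UNIV \<and> length z \<le> l}" by (auto simp: Zs_def)
    show "finite Zs" unfolding Zs by (rule finite_lists_length_le) simp
    have "card Zs = (\<Sum>i\<le>l. 2 ^ i)" unfolding Zs by (subst card_lists_length_le) auto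
    also have "\<dots> = 2 ^ Suc l - 1" using sum_power2[of "Suc l"] by (simp only: atLeast0LessThan lessThan_Suc_atMost)
    finally show "card Zs \<le> 2 ^ Suc l" by simp
  qed
  have b: "real (card {X \<in> G. observation D (\<xi> X) lo hi T = z}) \<le> b" for z
  proof (cases "{X \<in> G. observation D (\<xi> X) lo hi T = z} = {}")
    case False
    then obtain X' where X': "X' \<in> lists_of U l" "good D U \<eta> \<delta> \<alpha> \<beta> lo hi T (\<xi> X')"
      "observation D (\<xi> X') lo hi T = z" by (auto simp: G_def)
    define A where "A = query_cells D (\<xi> X') T"
    define C' where "C' = secret D (\<xi> X') lo hi T"
    \<comment> \<open>The queries exempt from the comparison: those that probe a secret cell in the
      reference run, and those that it answers positively anyway. Both kinds are rare as the
      reference sequence is good itself.\<close>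
    define Y where "Y = {x \<in> U. A x \<inter> C' \<noteq> {}} \<union> {x \<in> U. query_answer D (\<xi> X') T x}"
    have Y: "Y \<subseteq> U" by (auto simp: Y_def)
    have "real (card Y) \<le> real (card {x \<in> U. A x \<inter> C' \<noteq> {}}) + real (card {x \<in> U. query_answer D (\<xi> X') T x})"
      unfolding Y_def of_nat_add[symmetric] of_nat_le_iff by (rule card_Un_le)
    also have "\<dots> \<le> 2 * \<delta> * real (card U)"
      using X' by (simp add: good_def A_def C'_def)
    finally have cardY: "real (card Y) \<le> 2 * \<delta> * real (card U)" .
    have pot: "(\<Sum>x\<in>U. potential U A l x) \<le> \<eta> * real (card U)"
      using X' by (simp add: good_def A_def hi_def)
    have "{X \<in> G. observation D (\<xi> X) lo hi T = z} \<subseteq> {X \<in> lists_of U l. \<exists>C. finite C \<and>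
        real (card C) \<le> \<alpha> * real l \<and> real (card {x \<in> U - Y. A x \<inter> C \<noteq> {}}) \<le> \<delta> * real (card U) \<and>
        (1 - \<beta>) * real l \<le> real (length (filter (\<lambda>x. x \<in> Y \<or> A x \<inter> C \<noteq> {}) X))}"
    proof
      fix X assume "X \<in> {X \<in> G. observation D (\<xi> X) lo hi T = z}"
      then have X: "X \<in> lists_of U l" "good D U \<eta> \<delta> \<alpha> \<beta> lo hi T (\<xi> X)"
        "observation D (\<xi> X) lo hi T = z" by (auto simp: G_def)
      define C where "C = secret D (\<xi> X) lo hi T"
      have len: "length X = l" "length X' = l" "length pre = lo"
        using X X' pre by (auto simp: lists_of_def)
      have "fst (conf D (\<xi> X) T) = fst (conf D (\<xi> X') T) \<and> ([] :: bool list) = [] \<and>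
        (\<forall>a. a \<notin> secret D (\<xi> X) lo hi T \<longrightarrow> a \<notin> secret D (\<xi> X') lo hi T \<longrightarrow>
          snd (conf D (\<xi> X) T) a = snd (conf D (\<xi> X') T) a)"
      proof (rule observation_eqD[OF D])
        show "set (\<xi> X) \<subseteq> universe n" "set (\<xi> X') \<subseteq> universe n"
          using X X' pre post U by (auto simp: \<xi>_def lists_of_def)
        show "\<xi> X ! t = \<xi> X' ! t" if "hi \<le> t" "t < T" for t
        proof -
          have "\<not> t < lo" "\<not> t - lo < l" using that by (auto simp: hi_def)
          then show ?thesis using len by (simp add: \<xi>_def nth_append)
        qed
      qed (use X X' T len in \<open>auto simp: \<xi>_def hi_def\<close>)
      then have state: "fst (conf D (\<xi> X) T) = fst (conf D (\<xi> X') T)"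
        and mem: "\<And>a. a \<notin> C \<Longrightarrow> a \<notin> C' \<Longrightarrow> snd (conf D (\<xi> X) T) a = snd (conf D (\<xi> X') T) a"
        by (auto simp: C_def C'_def)
      \<comment> \<open>To separate the two runs, a secret cell of one of them has to be probed by
        both.\<close>
      have same: "query_answer D (\<xi> X) T x = query_answer D (\<xi> X') T x \<and> query_cells D (\<xi> X) T x = A x"
        if "A x \<inter> query_cells D (\<xi> X) T x \<inter> (C \<union> C') = {}" for x
      proof -
        have "fst (exec (program D (Query x) (fst (conf D (\<xi> X) T))) (snd (conf D (\<xi> X) T)))
          = fst (exec (program D (Query x) (fst (conf D (\<xi> X) T))) (snd (conf D (\<xi> X') T))) \<and>
          probed (program D (Query x) (fst (conf D (\<xi> X) T))) (snd (conf D (\<xi> X) T))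
          = probed (program D (Query x) (fst (conf D (\<xi> X) T))) (snd (conf D (\<xi> X') T))"
        proof (rule exec_cong_probed)
          fix a
          assume "a \<in> probed (program D (Query x) (fst (conf D (\<xi> X) T))) (snd (conf D (\<xi> X) T))"
            "a \<in> probed (program D (Query x) (fst (conf D (\<xi> X) T))) (snd (conf D (\<xi> X') T))"
          then have "a \<in> A x \<inter> query_cells D (\<xi> X) T x"
            by (simp add: A_def query_cells_def state)
          then show "snd (conf D (\<xi> X) T) a = snd (conf D (\<xi> X') T) a"
            using that by (intro mem) auto
        qed
        then show ?thesis
          by (simp add: query_answer_def query_cells_def answer_def A_def split_beta state)
      qed
      have "finite C" by (simp add: C_def secret_def)
      moreover have "real (card C) \<le> \<alpha> * real l"
      proof -
        have "card C \<le> card (\<Union>s\<in>{lo..<hi}. cells_written D (\<xi> X) s)"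
          unfolding C_def secret_def by (intro card_mono) auto
        then show ?thesis using X by (simp add: good_def hi_def)
      qed
      moreover have "real (card {x \<in> U - Y. A x \<inter> C \<noteq> {}}) \<le> \<delta> * real (card U)"
      proof -
        \<comment> \<open>Outside of \<open>Y\<close> the reference query avoids \<open>C'\<close>.
          If the actual query avoided \<open>C\<close>, both would probe the same cells, and
          \<open>A x\<close> would avoid \<open>C\<close> as well.\<close>
        have "{x \<in> U - Y. A x \<inter> C \<noteq> {}} \<subseteq> {x \<in> U. query_cells D (\<xi> X) T x \<inter> C \<noteq> {}}"
          using same by (fastforce simp: Y_def)
        then have "card {x \<in> U - Y. A x \<inter> C \<noteq> {}} \<le> card {x \<in> U. query_cells D (\<xi> X) T x \<inter> C \<noteq> {}}"
          using finU by (intro card_mono) auto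
        then show ?thesis using X by (simp add: good_def C_def)
      qed
      moreover have "(1 - \<beta>) * real l \<le> real (length (filter (\<lambda>x. x \<in> Y \<or> A x \<inter> C \<noteq> {}) X))"
      proof -
        \<comment> \<open>A key answered positively here that is neither in \<open>Y\<close> nor
          touches \<open>C\<close> would be answered positively by the reference run too, which
          would put it into \<open>Y\<close>.\<close>
        have "length (filter (\<lambda>x. query_answer D (\<xi> X) T x) X)
            \<le> length (filter (\<lambda>x. x \<in> Y \<or> A x \<inter> C \<noteq> {}) X)"
        proof (rule length_filter_le_filter)
          fix x assume x: "x \<in> set X" "query_answer D (\<xi> X) T x"
          then have "x \<in> U" using X by (auto simp: lists_of_def)
          then show "x \<in> Y \<or> A x \<inter> C \<noteq> {}"
            using x same[of x] by (auto simp: Y_def)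
        qed
        moreover have "length (filter (\<lambda>x. query_answer D (\<xi> X) T x) X)
            + length (filter (\<lambda>x. \<not> query_answer D (\<xi> X) T x) X) = l"
          using sum_length_filter_compl[of "query_answer D (\<xi> X) T" X] len by simp
        moreover have "take l (drop lo (\<xi> X)) = X" using len by (simp add: \<xi>_def)
        then have "real (length (filter (\<lambda>x. \<not> query_answer D (\<xi> X) T x) X)) \<le> \<beta> * real l"
          using X by (simp add: good_def hi_def)
        ultimately show ?thesis by (simp add: algebra_simps)
      qed
      ultimately show "X \<in> {X \<in> lists_of U l. \<exists>C. finite C \<and>
        real (card C) \<le> \<alpha> * real l \<and> real (card {x \<in> U - Y. A x \<inter> C \<noteq> {}}) \<le> \<delta> * real (card U) \<and>
        (1 - \<beta>) * real l \<le> real (length (filter (\<lambda>x. x \<in> Y \<or> A x \<inter> C \<noteq> {}) X))}"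
        using X(1) by blast
    qed
    from card_mono[OF _ this]
    have "real (card {X \<in> G. observation D (\<xi> X) lo hi T = z}) \<le> real (card {X \<in> lists_of U l. \<exists>C. finite C \<and>
        real (card C) \<le> \<alpha> * real l \<and> real (card {x \<in> U - Y. A x \<inter> C \<noteq> {}}) \<le> \<delta> * real (card U) \<and>
        (1 - \<beta>) * real l \<le> real (length (filter (\<lambda>x. x \<in> Y \<or> A x \<inter> C \<noteq> {}) X))})"
      using finU by simp
    also have "\<dots> \<le> b"
      unfolding b_def
      by (rule card_covered_lists_le[OF finU U(2) l _ Y cardY \<eta> pot _ \<delta> _ \<rho>(2)])
        (use \<delta> \<rho> in \<open>auto simp: A_def\<close>)
    finally show ?thesis .
  next
    case True
    then show ?thesis by (simp only: card.empty) (simp add: b_def)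
  qed
  have "G \<subseteq> (\<Union>z\<in>Zs. {X \<in> G. observation D (\<xi> X) lo hi T = z})"
    by (auto simp: G_def good_def Zs_def hi_def)
  then have "card G \<le> card (\<Union>z\<in>Zs. {X \<in> G. observation D (\<xi> X) lo hi T = z})"
    using finZs finU by (intro card_mono) (auto simp: G_def)
  also have "\<dots> \<le> (\<Sum>z\<in>Zs. card {X \<in> G. observation D (\<xi> X) lo hi T = z})"
    by (rule card_UN_le[OF finZs])
  finally have "real (card G) \<le> (\<Sum>z\<in>Zs. real (card {X \<in> G. observation D (\<xi> X) lo hi T = z}))"
    by (simp only: of_nat_sum[symmetric] of_nat_le_iff)
  also have "\<dots> \<le> (\<Sum>z\<in>Zs. b)" by (intro sum_mono b)
  also have "\<dots> = real (card Zs) * b" by simp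
  also have "\<dots> \<le> 2 ^ Suc l * b"
  proof (rule mult_right_mono)
    show "real (card Zs) \<le> 2 ^ Suc l" using cardZs by (metis of_nat_le_iff of_nat_numeral of_nat_power)
  qed (simp add: b_def)
  finally show ?thesis by (simp add: G_def b_def \<xi>_def hi_def)
qed

section \<open>Averaging over epochs and query times\<close>

text \<open>With the keys outside of the window fixed, each key of the window costs a factor 2 for
  the observation, 2 for the heavy cells (as \<eta> \<le> 1) and 2 for the exponential moment,
  against 1 / 32. The remaining 1 / 4 per key absorbs the last factor 2, since \<open>l\<close> is
  positive.\<close>

lemma card_good_all_le:
  assumes D: "wf_det_ds n M w D" and U: "U = universe n" "U \<noteq> {}"
    and l: "0 < l" and T: "lo + l \<le> T" "T \<le> L"
    and \<eta>: "0 < \<eta>" "\<eta> \<le> 1" and \<delta>: "0 \<le> \<delta>" and \<rho>: "3 * \<delta> + 2 * sqrt \<eta> \<le> \<rho>" "\<rho> \<le> 1"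
    and small: "\<rho> powr (1 - \<beta> - \<alpha>) \<le> 1 / 32"
  shows "(\<Sum>xs\<in>lists_of U L. of_bool (good D U \<eta> \<delta> \<alpha> \<beta> lo (lo + l) T xs))
    \<le> (1 / 2) ^ l * real (card (lists_of U L))"
proof -
  define N where "N = real (card U)"
  define r where "r = L - (lo + l)"
  have L: "L = lo + (l + r)" using T by (simp add: r_def)
  have finU: "finite U" using U by (simp add: universe_def)
  let ?g = "\<lambda>xs. of_bool (good D U \<eta> \<delta> \<alpha> \<beta> lo (lo + l) T xs) :: real"
  have "2 powr (\<eta> * real l) \<le> (2 :: real) ^ l"
    using \<eta> l by (subst powr_realpow[symmetric]) (auto intro: powr_mono)
  moreover have "\<rho> powr ((1 - \<beta> - \<alpha>) * real l) \<le> (1 / 32) ^ l"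
  proof -
    have "0 < \<rho>" using \<rho> \<delta> \<eta> by (smt (verit) real_sqrt_gt_zero)
    then have "\<rho> powr ((1 - \<beta> - \<alpha>) * real l) = (\<rho> powr (1 - \<beta> - \<alpha>)) ^ l"
      by (simp add: powr_powr[symmetric] powr_realpow)
    also have "\<dots> \<le> (1 / 32) ^ l" using small by (intro power_mono) auto
    finally show ?thesis .
  qed
  ultimately have "2 ^ Suc l * (2 powr (\<eta> * real l) * ((2 * N) ^ l * \<rho> powr ((1 - \<beta> - \<alpha>) * real l)))
      \<le> 2 ^ Suc l * (2 ^ l * ((2 * N) ^ l * (1 / 32) ^ l))"
    by (intro mult_left_mono mult_mono) (auto simp: N_def)
  also have "\<dots> = 2 * (1 / 4) ^ l * N ^ l"
  proof -
    have "(1 / 4 :: real) ^ l = (2 * 2 * 2 * (1 / 32)) ^ l" by simp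
    then show ?thesis by (simp only: power_mult_distrib power_Suc mult_ac)
  qed
  also have "\<dots> \<le> (1 / 2) ^ l * N ^ l"
  proof (rule mult_right_mono)
    have "(1 / 2 :: real) ^ l \<le> (1 / 2) ^ 1" using l by (intro power_decreasing) auto
    then have "2 * ((1 / 2) ^ l * (1 / 2) ^ l) \<le> (1 / 2 :: real) ^ l" by simp
    moreover have "(1 / 4 :: real) ^ l = (1 / 2 * (1 / 2)) ^ l" by simp
    ultimately show "2 * (1 / 4) ^ l \<le> (1 / 2 :: real) ^ l" by (simp only: power_mult_distrib)
  qed (simp add: N_def)
  finally have bound: "2 ^ Suc l * (2 powr (\<eta> * real l) * ((2 * N) ^ l * \<rho> powr ((1 - \<beta> - \<alpha>) * real l)))
      \<le> (1 / 2) ^ l * N ^ l" .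
  have "(\<Sum>xs\<in>lists_of U L. ?g xs)
      = (\<Sum>pre\<in>lists_of U lo. \<Sum>X\<in>lists_of U l. \<Sum>post\<in>lists_of U r. ?g (pre @ X @ post))"
    by (simp only: L sum_lists_of_append)
  also have "\<dots> = (\<Sum>pre\<in>lists_of U lo. \<Sum>post\<in>lists_of U r. \<Sum>X\<in>lists_of U l. ?g (pre @ X @ post))"
    by (intro sum.cong refl sum.swap)
  also have "\<dots> \<le> (\<Sum>pre\<in>lists_of U lo. \<Sum>post\<in>lists_of U r. (1 / 2) ^ l * N ^ l)"
  proof (intro sum_mono)
    fix pre post assume pre: "pre \<in> lists_of U lo" and post: "post \<in> lists_of U r"
    have "(\<Sum>X\<in>lists_of U l. ?g (pre @ X @ post))
        = real (card {X \<in> lists_of U l. good D U \<eta> \<delta> \<alpha> \<beta> lo (lo + l) T (pre @ X @ post)})"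
      using finU by (simp add: Int_def)
    also have "\<dots> \<le> 2 ^ Suc l * (2 powr (\<eta> * real l) *
        ((2 * real (card U)) ^ l * \<rho> powr ((1 - \<beta> - \<alpha>) * real l)))"
      using post T L by (intro card_good_le[OF D U pre _ l _ _ \<eta>(1) \<delta> \<rho>]) (auto simp: lists_of_def)
    finally show "(\<Sum>X\<in>lists_of U l. ?g (pre @ X @ post)) \<le> (1 / 2) ^ l * N ^ l"
      using bound by (simp add: N_def)
  qed
  also have "\<dots> = (1 / 2) ^ l * real (card (lists_of U L))"
    using finU by (simp add: card_lists_of L N_def power_add)
  finally show ?thesis .
qed

section \<open>Information transfer between insertions\<close>

definition last_written :: "det_ds \<Rightarrow> nat list \<Rightarrow> nat \<Rightarrow> nat \<Rightarrow> nat set" where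
  "last_written D xs s t = cells_written D xs s - (\<Union>s'\<in>{s<..<t}. cells_written D xs s')"

text \<open>Indexed by pairs of insertions, this depends neither on the query time nor on the
  division into epochs, which permits double counting over both.\<close>

definition transfer :: "det_ds \<Rightarrow> nat list \<Rightarrow> nat \<Rightarrow> nat \<Rightarrow> nat" where
  "transfer D xs s t =
     secret_reads (insert_prog D xs t) (snd (conf D xs t)) (last_written D xs s t)"

lemma disjoint_last_written: "disjoint_family_on (\<lambda>s. last_written D xs s t) {..<t}"
proof -
  have "last_written D xs s t \<inter> last_written D xs s' t = {}" if "s < s'" "s' < t" for s s'
    using that by (auto simp: last_written_def)
  then show ?thesis unfolding disjoint_family_on_def
    by (metis Int_commute lessThan_iff linorder_neqE_nat)
qed

lemma secret_eq_UN_last_written: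
  assumes "hi \<le> t"
  shows "secret D xs lo hi t = (\<Union>s\<in>{lo..<hi}. last_written D xs s t)"
proof
  show "(\<Union>s\<in>{lo..<hi}. last_written D xs s t) \<subseteq> secret D xs lo hi t"
    by (force simp: secret_def last_written_def)
  show "secret D xs lo hi t \<subseteq> (\<Union>s\<in>{lo..<hi}. last_written D xs s t)"
  proof
    fix a assume a: "a \<in> secret D xs lo hi t"
    define S where "S = {s \<in> {lo..<hi}. a \<in> cells_written D xs s}"
    have S: "finite S" "S \<noteq> {}" using a by (auto simp: S_def secret_def)
    define s where "s = Max S"
    have s: "s \<in> S" using S by (simp add: s_def)
    have "a \<notin> cells_written D xs s'" if "s < s'" "s' < t" for s'
    proof (cases "s' < hi")
      case True
      have "s' \<notin> S"
      proof
        assume "s' \<in> S"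
        then have "s' \<le> s" using S by (simp add: s_def)
        then show False using that by simp
      qed
      then show ?thesis using True s that by (simp add: S_def)
    next
      case False
      then show ?thesis using a that by (auto simp: secret_def)
    qed
    then have "a \<in> last_written D xs s t" using s by (auto simp: last_written_def S_def)
    then show "a \<in> (\<Union>s\<in>{lo..<hi}. last_written D xs s t)" using s by (auto simp: S_def)
  qed
qed

lemma sum_transfer_le: "(\<Sum>s<t. transfer D xs s t) \<le> insert_cost D xs t"
proof -
  have "(\<Sum>s<t. transfer D xs s t) = secret_reads (insert_prog D xs t) (snd (conf D xs t))
      (\<Union>s\<in>{..<t}. last_written D xs s t)"
    unfolding transfer_def by (rule secret_reads_UN[symmetric]) (auto intro: disjoint_last_written)
  also have "\<dots> \<le> insert_cost D xs t" unfolding insert_cost_def by (rule secret_reads_le_cost)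
  finally show ?thesis .
qed

text \<open>The state takes \<open>M\<close> bits, the flags at most one bit per probe, and the
  contents \<open>w\<close> bits per secret read; the secret reads are sorted by the last writer of
  the cell.\<close>

lemma length_observation_le:
  assumes D: "wf_det_ds n M w D" and xs: "set xs \<subseteq> universe n" and T: "hi \<le> T" "T \<le> length xs"
  shows "length (observation D xs lo hi T)
    \<le> M + (\<Sum>t\<in>{hi..<T}. insert_cost D xs t) + w * (\<Sum>t\<in>{hi..<T}. \<Sum>s\<in>{lo..<hi}. transfer D xs s t)"
proof -
  let ?tr = "\<lambda>t. transcript (insert_prog D xs t) (snd (conf D xs t)) (secret D xs lo hi t)"
  have "length (observation D xs lo hi T) = M + (\<Sum>t\<in>{hi..<T}. length (?tr t))"
    using wf_conf[OF D xs, of hi] T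
    by (simp add: observation_def length_concat comp_def interv_sum_list_conv_sum_set_nat)
  also have "(\<Sum>t\<in>{hi..<T}. length (?tr t))
      \<le> (\<Sum>t\<in>{hi..<T}. insert_cost D xs t + w * (\<Sum>s\<in>{lo..<hi}. transfer D xs s t))"
  proof (rule sum_mono)
    fix t assume t: "t \<in> {hi..<T}"
    then have wf: "length (fst (conf D xs t)) = M" "\<And>a. length (snd (conf D xs t) a) = w"
      using wf_conf[OF D xs, of t] T by auto
    have "length (?tr t) \<le> insert_cost D xs t
        + w * secret_reads (insert_prog D xs t) (snd (conf D xs t)) (secret D xs lo hi t)"
      unfolding insert_cost_def
      by (rule length_transcript_le[OF wf(2) wf_insert_prog[OF D xs _ wf(1)]]) (use t T in auto)
    also have "secret_reads (insert_prog D xs t) (snd (conf D xs t)) (secret D xs lo hi t)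
        = (\<Sum>s\<in>{lo..<hi}. transfer D xs s t)"
      unfolding transfer_def using t
      by (subst secret_eq_UN_last_written) (auto intro!: secret_reads_UN
          disjoint_family_on_mono[OF _ disjoint_last_written])
    finally show "length (?tr t) \<le> insert_cost D xs t + w * (\<Sum>s\<in>{lo..<hi}. transfer D xs s t)" .
  qed
  finally show ?thesis by (simp add: sum.distrib sum_distrib_left)
qed

section \<open>Sums over geometric scales\<close>

lemma sum_min_geometric_le:
  fixes r :: real and b :: nat
  assumes "0 \<le> r" "2 \<le> b"
  shows "(\<Sum>i<m. min (r * real b ^ i) (1 / (r * real b ^ i))) \<le> 4"
proof -
  \<comment> \<open>A bound for the partial sum in terms of its next argument: up to 2, the earlier
    terms are dominated by a geometric series ending there; beyond 2, the amount 4 / y is reserved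
    for the decaying rest. Both formulas give 2 at y = 2.\<close>
  define f where "f y = (if y \<le> 2 then y else 4 - 4 / y)" for y :: real
  have "(\<Sum>i<m. min (r * real b ^ i) (1 / (r * real b ^ i))) \<le> f (r * real b ^ m)"
  proof (induction m)
    case 0
    have "4 / r \<le> 4" if "2 < r" using that by (simp add: field_simps)
    then show ?case using assms by (simp add: f_def)
  next
    case (Suc m)
    define y where "y = r * real b ^ m"
    have y: "0 \<le> y" using assms by (simp add: y_def)
    have "f y + min y (1 / y) \<le> f (2 * y)"
    proof -
      consider "y \<le> 1" | "1 < y" "y \<le> 2" | "2 < y" by linarith
      then show ?thesis
      proof cases
        case 1
        then show ?thesis using y by (simp add: f_def)
      next
        case 2
        have "(y - 1) * (y - 3) \<le> 0" using 2 by (intro mult_nonneg_nonpos) auto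
        then have "y * y + 3 \<le> 4 * y" by (simp add: algebra_simps)
        then have "y + 3 / y \<le> 4" using 2 by (simp add: field_simps)
        moreover have "min y (1 / y) \<le> 1 / y" by simp
        ultimately show ?thesis using 2 by (simp add: f_def)
      next
        case 3
        have "min y (1 / y) \<le> 1 / y" by simp
        moreover have "f y = 4 - 4 * (1 / y)" "f (2 * y) = 4 - 2 * (1 / y)" using 3 by (simp_all add: f_def)
        moreover have "0 < 1 / y" using 3 by simp
        ultimately show ?thesis by linarith
      qed
    qed
    also have "f (2 * y) \<le> f (real b * y)"
    proof -
      have le: "2 * y \<le> real b * y" using assms y by (intro mult_right_mono) auto
      have mono: "f u \<le> f v" if "u \<le> v" for u v
      proof -
        have "4 / v \<le> 4 / u" if "2 < u" using that \<open>u \<le> v\<close> by (simp add: frac_le)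
        moreover have "4 / v \<le> 2" if "2 < v" using that by (simp add: field_simps)
        ultimately show ?thesis using that by (auto simp: f_def)
      qed
      show ?thesis by (rule mono[OF le])
    qed
    finally show ?case using Suc by (simp add: y_def mult_ac)
  qed
  also have "f (r * real b ^ m) \<le> 4"
    using assms by (simp add: f_def divide_nonneg_nonneg)
  finally show ?thesis .
qed

text \<open>Distances back from the query time: epoch \<open>i\<close> consists of the insertions
  from \<open>T - epoch_end k b (Suc i)\<close> up to, but excluding,
  \<open>T - epoch_end k b i\<close>. Epoch 0 is the latest and shortest.\<close>

primrec epoch_end :: "nat \<Rightarrow> nat \<Rightarrow> nat \<Rightarrow> nat" where
  "epoch_end k b 0 = 0"
| "epoch_end k b (Suc i) = epoch_end k b i + k * b ^ i"

lemma epoch_end_eq: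
  assumes "2 \<le> b"
  shows "real (epoch_end k b i) * (real b - 1) = real k * real b ^ i - real k"
  using assms by (induction i) (auto simp: algebra_simps)

lemma epoch_end_le:
  assumes "2 \<le> b"
  shows "real (epoch_end k b i) \<le> real (k * b ^ i) / (real b - 1)"
  using epoch_end_eq[OF assms, of k i] assms by (simp add: field_simps)

lemma epoch_end_Suc_le:
  assumes "2 \<le> b"
  shows "real (epoch_end k b (Suc i)) \<le> 2 * real (k * b ^ i)"
proof -
  have "real (k * b ^ i) / (real b - 1) \<le> real (k * b ^ i) / 1"
    using assms by (intro divide_left_mono) auto
  then show ?thesis using epoch_end_le[OF assms, of k i] by simp
qed

lemma epoch_end_mono: "i \<le> j \<Longrightarrow> epoch_end k b i \<le> epoch_end k b j"
  by (induction rule: dec_induct) auto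

text \<open>\<open>d\<close> is the distance between a write and a read. The term of
  \<open>i\<close> bounds the number of query times that put the write into epoch \<open>i\<close>
  and the read after it, divided by the epoch length. The first epoch reaching beyond
  \<open>d\<close> contributes at most 1 / (b - 1), because all later insertions together are that
  short in comparison; from there on d / l decays geometrically.\<close>

lemma sum_crossings_le:
  fixes d :: real
  assumes "2 \<le> b" "0 < k" "0 \<le> d"
  shows "(\<Sum>i<m. if d < real (epoch_end k b (Suc i))
      then min d (real (epoch_end k b i)) / real (k * b ^ i) else 0) \<le> 3 / (real b - 1)"
proof -
  let ?e = "\<lambda>i. real (epoch_end k b i)" and ?l = "\<lambda>i. real (k * b ^ i)"
  let ?f = "\<lambda>i. if d < ?e (Suc i) then min d (?e i) / ?l i else 0"
  have l: "0 < ?l i" for i using assms by simp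
  \<comment> \<open>The invariant reserves the tail of the geometric series: d / l m + d / l (m + 1)
    + ... equals (d b / l m) / (b - 1).\<close>
  have "(\<Sum>i<m. ?f i) \<le> (if d < ?e m then (3 - d * real b / ?l m) / (real b - 1) else 0)"
  proof (induction m)
    case 0
    then show ?case using assms by simp
  next
    case (Suc m)
    have lS: "d * real b / ?l (Suc m) = d / ?l m" using assms by simp
    consider "\<not> d < ?e (Suc m)" | "\<not> d < ?e m" "d < ?e (Suc m)" | "d < ?e m" "d < ?e (Suc m)"
      by linarith
    then show ?case
    proof cases
      case 1
      moreover have "?e m \<le> ?e (Suc m)" by simp
      ultimately have "\<not> d < ?e m" by linarith
      then show ?thesis using Suc 1 by simp
    next
      case 2
      \<comment> \<open>Epoch \<open>m\<close> is the first to reach beyond \<open>d\<close>. The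
        constant 3 consists of 1 for its own term and 2 for the tail after it.\<close>
      have "d / ?l m \<le> 2"
        using 2 epoch_end_Suc_le[OF assms(1), of k m] l[of m] by (simp add: field_simps)
      then have "1 / (real b - 1) \<le> (3 - d / ?l m) / (real b - 1)"
        using assms by (intro divide_right_mono) auto
      moreover have "min d (?e m) / ?l m \<le> ?e m / ?l m"
        using l[of m] by (intro divide_right_mono) auto
      moreover have "?e m / ?l m \<le> 1 / (real b - 1)"
        using epoch_end_le[OF assms(1), of k m] l[of m] assms by (simp add: field_simps)
      ultimately show ?thesis using Suc 2 unfolding lS by (simp del: epoch_end.simps)
    next
      case 3
      have "min d (?e m) / ?l m \<le> d / ?l m" using l[of m] by (intro divide_right_mono) auto
      moreover have "(3 - d * real b / ?l m) / (real b - 1) + d / ?l m = (3 - d / ?l m) / (real b - 1)"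
        using assms l[of m] by (simp add: field_simps)
      ultimately show ?thesis using Suc 3 unfolding lS by (simp del: epoch_end.simps)
    qed
  qed
  also have "\<dots> \<le> 3 / (real b - 1)"
    using assms l[of m] by (auto intro!: divide_right_mono)
  finally show ?thesis .
qed

section \<open>Accounting by epochs and query times\<close>

definition query_cost :: "det_ds \<Rightarrow> nat list \<Rightarrow> nat \<Rightarrow> nat \<Rightarrow> nat" where
  "query_cost D xs T x = probes D (Query x) (conf D xs T)"

definition query_error :: "det_ds \<Rightarrow> nat list \<Rightarrow> nat \<Rightarrow> nat \<Rightarrow> real" where
  "query_error D xs T x = of_bool (query_answer D xs T x \<noteq> (x \<in> set (take T xs)))"

lemma card_query_cells_le: "card (query_cells D xs T x) \<le> query_cost D xs T x"
  unfolding query_cells_def query_cost_def probes_def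
  by (simp add: split_beta card_probed_le)

text \<open>If every quotient is at most 1, the window is good; otherwise a single quotient already
  exceeds 1. The summand \<open>L\<close> allows for keys that are answered positively because they
  have been inserted.\<close>

lemma window_bound:
  assumes D: "wf_det_ds n M w D" and U: "U = universe n" "U \<noteq> {}" and xs: "xs \<in> lists_of U L"
    and l: "0 < l" and T: "lo + l = hi" "hi \<le> T" "T \<le> L"
    and pos: "0 < \<eta>" "0 < \<delta>" "0 < \<alpha>" "0 < \<beta>"
  shows "1 \<le> of_bool (good D U \<eta> \<delta> \<alpha> \<beta> lo hi T xs)
    + (real M / real l + (\<Sum>t\<in>{hi..<T}. real (insert_cost D xs t)) / real l
       + real w * ((\<Sum>t\<in>{hi..<T}. \<Sum>s\<in>{lo..<hi}. real (transfer D xs s t)) / real l))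
    + (\<Sum>x\<in>U. potential U (query_cells D xs T) l x) / (\<eta> * real (card U))
    + real (card {x \<in> U. query_cells D xs T x \<inter> secret D xs lo hi T \<noteq> {}}) / (\<delta> * real (card U))
    + ((\<Sum>x\<in>U. query_error D xs T x) + real L) / (\<delta> * real (card U))
    + (\<Sum>t\<in>{lo..<hi}. query_error D xs T (xs ! t)) / (\<beta> * real l)
    + (\<Sum>t\<in>{lo..<hi}. real (insert_cost D xs t)) / (\<alpha> * real l)"
proof -
  have finU: "finite U" using U by (simp add: universe_def)
  have N: "0 < real (card U)" using U(2) finU by (simp add: card_gt_0_iff)
  have lenxs: "length xs = L" and setxs: "set xs \<subseteq> U" using xs by (auto simp: lists_of_def)
  have ll: "hi - lo = l" using T by simp
  have trace: "real (length (observation D xs lo hi T)) / real l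
    \<le> real M / real l + (\<Sum>t\<in>{hi..<T}. real (insert_cost D xs t)) / real l
       + real w * ((\<Sum>t\<in>{hi..<T}. \<Sum>s\<in>{lo..<hi}. real (transfer D xs s t)) / real l)"
  proof -
    have "length (observation D xs lo hi T) \<le> M + (\<Sum>t\<in>{hi..<T}. insert_cost D xs t)
        + w * (\<Sum>t\<in>{hi..<T}. \<Sum>s\<in>{lo..<hi}. transfer D xs s t)"
      using setxs T lenxs U by (intro length_observation_le[OF D]) auto
    then have "real (length (observation D xs lo hi T)) \<le> real (M + (\<Sum>t\<in>{hi..<T}. insert_cost D xs t)
        + w * (\<Sum>t\<in>{hi..<T}. \<Sum>s\<in>{lo..<hi}. transfer D xs s t))"
      by (simp only: of_nat_le_iff)
    then have "real (length (observation D xs lo hi T)) / real l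
        \<le> (real M + (\<Sum>t\<in>{hi..<T}. real (insert_cost D xs t))
        + real w * (\<Sum>t\<in>{hi..<T}. \<Sum>s\<in>{lo..<hi}. real (transfer D xs s t))) / real l"
      by (intro divide_right_mono) simp_all
    then show ?thesis by (simp add: add_divide_distrib)
  qed
  have answers: "real (card {x \<in> U. query_answer D xs T x}) \<le> (\<Sum>x\<in>U. query_error D xs T x) + real L"
  proof -
    have "real (card {x \<in> U. query_answer D xs T x}) = (\<Sum>x\<in>U. of_bool (query_answer D xs T x))"
      using finU by (simp add: Int_def)
    also have "\<dots> \<le> (\<Sum>x\<in>U. query_error D xs T x + of_bool (x \<in> set (take T xs)))"
      by (intro sum_mono) (simp add: query_error_def)
    also have "\<dots> = (\<Sum>x\<in>U. query_error D xs T x) + real (card (U \<inter> set (take T xs)))"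
      using finU by (simp add: sum.distrib)
    also have "card (U \<inter> set (take T xs)) \<le> card (set (take T xs))" by (intro card_mono) auto
    also have "\<dots> \<le> T" by (rule order_trans[OF card_length]) simp
    finally show ?thesis using T by simp
  qed
  have wrong: "real (length (filter (\<lambda>x. \<not> query_answer D xs T x) (take (hi - lo) (drop lo xs))))
    \<le> (\<Sum>t\<in>{lo..<hi}. query_error D xs T (xs ! t))"
  proof -
    let ?X = "take l (drop lo xs)"
    have "length (filter (\<lambda>x. \<not> query_answer D xs T x) ?X)
        = card {i. i < length ?X \<and> \<not> query_answer D xs T (?X ! i)}"
      by (rule length_filter_conv_card)
    also have "{i. i < length ?X \<and> \<not> query_answer D xs T (?X ! i)}
        = {i \<in> {..<l}. \<not> query_answer D xs T (xs ! (lo + i))}"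
      using T lenxs by auto
    finally have "real (length (filter (\<lambda>x. \<not> query_answer D xs T x) ?X))
        = (\<Sum>i<l. of_bool (\<not> query_answer D xs T (xs ! (lo + i))))"
      by (simp add: Int_def)
    also have "\<dots> \<le> (\<Sum>i<l. query_error D xs T (xs ! (lo + i)))"
    proof (rule sum_mono)
      fix i assume "i \<in> {..<l}"
      then have "xs ! (lo + i) \<in> set (take T xs)"
        using T lenxs by (auto simp: in_set_conv_nth intro!: exI[of _ "lo + i"])
      then show "of_bool (\<not> query_answer D xs T (xs ! (lo + i))) \<le> query_error D xs T (xs ! (lo + i))"
        by (simp add: query_error_def)
    qed
    also have "\<dots> = (\<Sum>t\<in>{lo..<hi}. query_error D xs T (xs ! t))"
      using sum.shift_bounds_nat_ivl[of "\<lambda>t. query_error D xs T (xs ! t)" 0 lo l] T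
      by (simp add: atLeast0LessThan add.commute)
    finally show ?thesis by (simp add: ll)
  qed
  have cells: "real (card (\<Union>s\<in>{lo..<hi}. cells_written D xs s))
      \<le> (\<Sum>t\<in>{lo..<hi}. real (insert_cost D xs t))"
  proof -
    have "card (\<Union>s\<in>{lo..<hi}. cells_written D xs s) \<le> (\<Sum>s\<in>{lo..<hi}. card (cells_written D xs s))"
      by (intro card_UN_le) simp
    also have "\<dots> \<le> (\<Sum>s\<in>{lo..<hi}. insert_cost D xs s)"
      by (intro sum_mono) (simp add: cells_written_def insert_cost_def card_written_le)
    finally show ?thesis by (simp only: of_nat_sum[symmetric] of_nat_le_iff)
  qed
  define q1 where "q1 = real M / real l + (\<Sum>t\<in>{hi..<T}. real (insert_cost D xs t)) / real l
       + real w * ((\<Sum>t\<in>{hi..<T}. \<Sum>s\<in>{lo..<hi}. real (transfer D xs s t)) / real l)"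
  define q2 where "q2 = (\<Sum>x\<in>U. potential U (query_cells D xs T) l x) / (\<eta> * real (card U))"
  define q3 where "q3 = real (card {x \<in> U. query_cells D xs T x \<inter> secret D xs lo hi T \<noteq> {}}) / (\<delta> * real (card U))"
  define q4 where "q4 = ((\<Sum>x\<in>U. query_error D xs T x) + real L) / (\<delta> * real (card U))"
  define q5 where "q5 = (\<Sum>t\<in>{lo..<hi}. query_error D xs T (xs ! t)) / (\<beta> * real l)"
  define q6 where "q6 = (\<Sum>t\<in>{lo..<hi}. real (insert_cost D xs t)) / (\<alpha> * real l)"
  have potnn: "0 \<le> potential U A l x" for A x
    unfolding potential_def by (intro sum_nonneg) (simp add: load_nonneg)
  have nonneg: "0 \<le> q1" "0 \<le> q2" "0 \<le> q3" "0 \<le> q4" "0 \<le> q5" "0 \<le> q6"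
    using pos potnn
    unfolding q1_def q2_def q3_def q4_def q5_def q6_def query_error_def
    by (auto intro!: add_nonneg_nonneg divide_nonneg_nonneg sum_nonneg mult_nonneg_nonneg)
  have "1 \<le> of_bool (good D U \<eta> \<delta> \<alpha> \<beta> lo hi T xs) + q1 + q2 + q3 + q4 + q5 + q6"
  proof (cases "q1 \<le> 1 \<and> q2 \<le> 1 \<and> q3 \<le> 1 \<and> q4 \<le> 1 \<and> q5 \<le> 1 \<and> q6 \<le> 1")
    case True
    have "good D U \<eta> \<delta> \<alpha> \<beta> lo hi T xs"
      unfolding good_def ll
    proof (intro conjI)
      have "real (length (observation D xs lo hi T)) / real l \<le> 1" using trace True by (simp add: q1_def)
      then show "length (observation D xs lo hi T) \<le> l" using l by (simp add: field_simps)
      show "(\<Sum>x\<in>U. potential U (query_cells D xs T) l x) \<le> \<eta> * real (card U)"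
        using True pos N by (simp add: q2_def)
      show "real (card {x \<in> U. query_cells D xs T x \<inter> secret D xs lo hi T \<noteq> {}}) \<le> \<delta> * real (card U)"
        using True pos N by (simp add: q3_def)
      have "(\<Sum>x\<in>U. query_error D xs T x) + real L \<le> \<delta> * real (card U)"
        using True pos N by (simp add: q4_def)
      with answers show "real (card {x \<in> U. query_answer D xs T x}) \<le> \<delta> * real (card U)" by linarith
      have "(\<Sum>t\<in>{lo..<hi}. query_error D xs T (xs ! t)) \<le> \<beta> * real l"
        using True pos l by (simp add: q5_def)
      with wrong show "real (length (filter (\<lambda>x. \<not> query_answer D xs T x) (take l (drop lo xs)))) \<le> \<beta> * real l"
        by (simp add: ll)
      have "(\<Sum>t\<in>{lo..<hi}. real (insert_cost D xs t)) \<le> \<alpha> * real l"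
        using True pos l by (simp add: q6_def)
      with cells show "real (card (\<Union>s\<in>{lo..<hi}. cells_written D xs s)) \<le> \<alpha> * real l" by linarith
    qed
    then show ?thesis using nonneg by simp
  next
    case False
    then show ?thesis using nonneg by (smt (verit) of_bool_def)
  qed
  then show ?thesis unfolding q1_def q2_def q3_def q4_def q5_def q6_def by linarith
qed

lemma sum_potential_le:
  assumes "2 \<le> b" "finite (A x)"
  shows "(\<Sum>i<m. potential U A (k * b ^ i) x) \<le> 4 * real (card (A x))"
proof -
  have "(\<Sum>i<m. potential U A (k * b ^ i) x) = (\<Sum>c\<in>A x. \<Sum>i<m.
      min (load U A c * real k * real b ^ i) (1 / (load U A c * real k * real b ^ i)))"
    unfolding potential_def by (subst sum.swap) (simp add: mult_ac)
  also have "\<dots> \<le> (\<Sum>c\<in>A x. 4)"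
    using assms by (intro sum_mono sum_min_geometric_le) (auto simp: load_nonneg)
  finally show ?thesis by simp
qed

lemma sum_hits_le:
  assumes "finite A" "disjoint_family_on S {..<m :: nat}"
  shows "(\<Sum>i<m. of_bool (A \<inter> S i \<noteq> {})) \<le> real (card A)"
proof -
  have "(\<Sum>i<m. of_bool (A \<inter> S i \<noteq> {})) \<le> (\<Sum>i<m. real (card (A \<inter> S i)))"
  proof (rule sum_mono)
    fix i
    have "A \<inter> S i \<noteq> {} \<Longrightarrow> 1 \<le> card (A \<inter> S i)" using assms(1) by (simp add: Suc_le_eq card_gt_0_iff)
    then show "of_bool (A \<inter> S i \<noteq> {}) \<le> real (card (A \<inter> S i))" by simp
  qed
  also have "\<dots> = real (card (\<Union>i<m. A \<inter> S i))"
    using assms by (subst card_UN_disjoint) (auto simp: disjoint_family_on_def)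
  also have "\<dots> \<le> real (card A)" 
    unfolding of_nat_le_iff using assms(1) by (intro card_mono) auto
  finally show ?thesis .
qed

text \<open>A cell counts for the epoch of its latest write only: the secret cells of an older epoch
  exclude everything written since, in particular in a younger epoch.\<close>

lemma disjoint_secret:
  "disjoint_family_on (\<lambda>i. secret D xs (T - epoch_end k b (Suc i)) (T - epoch_end k b i) T) {..<m}"
proof -
  have "secret D xs (T - epoch_end k b (Suc i)) (T - epoch_end k b i) T \<inter>
      secret D xs (T - epoch_end k b (Suc j)) (T - epoch_end k b j) T = {}" if "i < j" for i j
  proof -
    have "epoch_end k b (Suc i) \<le> epoch_end k b j" using that by (intro epoch_end_mono) simp
    then have "{T - epoch_end k b (Suc i)..<T - epoch_end k b i} \<subseteq> {T - epoch_end k b j..<T}" by auto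
    then show ?thesis unfolding secret_def by blast
  qed
  then show ?thesis unfolding disjoint_family_on_def by (metis Int_commute linorder_neqE_nat)
qed

text \<open>Queries enter through two quotients, and a probed cell is charged O(1) for each over all
  epochs together: at most 4 for the potential, since its load matches few scales, and at most 1 for
  being secret. Hence the query cost carries no factor \<open>m\<close>, which is the source of the
  lower bound.\<close>

lemma epochs_bound:
  assumes D: "wf_det_ds n M w D" and U: "U = universe n" "U \<noteq> {}" and xs: "xs \<in> lists_of U L"
    and k: "0 < k" "2 \<le> b" and T: "epoch_end k b m \<le> T" "T \<le> L"
    and pos: "0 < \<eta>" "0 < \<delta>" "0 < \<alpha>" "0 < \<beta>"
  defines "N \<equiv> real (card U)"
    and "lo \<equiv> \<lambda>i. T - epoch_end k b (Suc i)" and "hi \<equiv> \<lambda>i. T - epoch_end k b i"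
    and "l \<equiv> \<lambda>i. real (k * b ^ i)"
  shows "real m \<le> (\<Sum>i<m. of_bool (good D U \<eta> \<delta> \<alpha> \<beta> (lo i) (hi i) T xs))
    + real m * (real M / real k)
    + (\<Sum>i<m. (\<Sum>t\<in>{hi i..<T}. real (insert_cost D xs t)) / l i)
    + real w * (\<Sum>i<m. (\<Sum>t\<in>{hi i..<T}. \<Sum>s\<in>{lo i..<hi i}. real (transfer D xs s t)) / l i)
    + (4 / \<eta> + 1 / \<delta>) / N * (\<Sum>x\<in>U. real (query_cost D xs T x))
    + real m * (((\<Sum>x\<in>U. query_error D xs T x) + real L) / (\<delta> * N))
    + (\<Sum>i<m. (\<Sum>t\<in>{lo i..<hi i}. query_error D xs T (xs ! t)) / (\<beta> * l i))
    + (\<Sum>i<m. (\<Sum>t\<in>{lo i..<hi i}. real (insert_cost D xs t)) / (\<alpha> * l i))"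
proof -
  have finU: "finite U" using U by (simp add: universe_def)
  have N: "0 < N" using U(2) finU by (simp add: card_gt_0_iff N_def)
  have "(\<Sum>i<m. 1 :: real) \<le> (\<Sum>i<m. of_bool (good D U \<eta> \<delta> \<alpha> \<beta> (lo i) (hi i) T xs)
    + (real M / l i + (\<Sum>t\<in>{hi i..<T}. real (insert_cost D xs t)) / l i
       + real w * ((\<Sum>t\<in>{hi i..<T}. \<Sum>s\<in>{lo i..<hi i}. real (transfer D xs s t)) / l i))
    + (\<Sum>x\<in>U. potential U (query_cells D xs T) (k * b ^ i) x) / (\<eta> * N)
    + real (card {x \<in> U. query_cells D xs T x \<inter> secret D xs (lo i) (hi i) T \<noteq> {}}) / (\<delta> * N)
    + ((\<Sum>x\<in>U. query_error D xs T x) + real L) / (\<delta> * N)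
    + (\<Sum>t\<in>{lo i..<hi i}. query_error D xs T (xs ! t)) / (\<beta> * l i)
    + (\<Sum>t\<in>{lo i..<hi i}. real (insert_cost D xs t)) / (\<alpha> * l i))"
  proof (rule sum_mono)
    fix i assume "i \<in> {..<m}"
    then have "epoch_end k b (Suc i) \<le> epoch_end k b m" by (intro epoch_end_mono) simp
    then have "epoch_end k b (Suc i) \<le> T" using T by simp
    then have "lo i + k * b ^ i = hi i" "hi i \<le> T" by (auto simp: lo_def hi_def)
    moreover have "0 < k * b ^ i" using k by simp
    ultimately show "1 \<le> of_bool (good D U \<eta> \<delta> \<alpha> \<beta> (lo i) (hi i) T xs)
    + (real M / l i + (\<Sum>t\<in>{hi i..<T}. real (insert_cost D xs t)) / l i
       + real w * ((\<Sum>t\<in>{hi i..<T}. \<Sum>s\<in>{lo i..<hi i}. real (transfer D xs s t)) / l i))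
    + (\<Sum>x\<in>U. potential U (query_cells D xs T) (k * b ^ i) x) / (\<eta> * N)
    + real (card {x \<in> U. query_cells D xs T x \<inter> secret D xs (lo i) (hi i) T \<noteq> {}}) / (\<delta> * N)
    + ((\<Sum>x\<in>U. query_error D xs T x) + real L) / (\<delta> * N)
    + (\<Sum>t\<in>{lo i..<hi i}. query_error D xs T (xs ! t)) / (\<beta> * l i)
    + (\<Sum>t\<in>{lo i..<hi i}. real (insert_cost D xs t)) / (\<alpha> * l i)"
      unfolding l_def N_def using T pos
      by (intro window_bound[OF D U xs, where hi = "hi i" and lo = "lo i"]) auto
  qed
  also have "\<dots> = (\<Sum>i<m. of_bool (good D U \<eta> \<delta> \<alpha> \<beta> (lo i) (hi i) T xs))
    + (\<Sum>i<m. real M / l i) + (\<Sum>i<m. (\<Sum>t\<in>{hi i..<T}. real (insert_cost D xs t)) / l i)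
    + real w * (\<Sum>i<m. (\<Sum>t\<in>{hi i..<T}. \<Sum>s\<in>{lo i..<hi i}. real (transfer D xs s t)) / l i)
    + (\<Sum>i<m. \<Sum>x\<in>U. potential U (query_cells D xs T) (k * b ^ i) x) / (\<eta> * N)
    + (\<Sum>i<m. real (card {x \<in> U. query_cells D xs T x \<inter> secret D xs (lo i) (hi i) T \<noteq> {}})) / (\<delta> * N)
    + real m * (((\<Sum>x\<in>U. query_error D xs T x) + real L) / (\<delta> * N))
    + (\<Sum>i<m. (\<Sum>t\<in>{lo i..<hi i}. query_error D xs T (xs ! t)) / (\<beta> * l i))
    + (\<Sum>i<m. (\<Sum>t\<in>{lo i..<hi i}. real (insert_cost D xs t)) / (\<alpha> * l i))"
    by (simp only: sum.distrib sum_divide_distrib sum_distrib_left sum_constant card_lessThan)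
  finally have main: "real m \<le> \<dots>" by simp
  have memory: "(\<Sum>i<m. real M / l i) \<le> real m * (real M / real k)"
  proof -
    have "(\<Sum>i<m. real M / l i) \<le> (\<Sum>i<m. real M / real k)"
    proof (intro sum_mono divide_left_mono)
      show "real k \<le> l i" for i
        unfolding l_def of_nat_le_iff using k by simp
      show "0 < l i * real k" for i using k by (simp add: l_def)
    qed simp
    then show ?thesis by simp
  qed
  have cells: "(\<Sum>x\<in>U. real (card (query_cells D xs T x))) \<le> (\<Sum>x\<in>U. real (query_cost D xs T x))"
    by (intro sum_mono) (simp add: card_query_cells_le)
  have "(\<Sum>i<m. \<Sum>x\<in>U. potential U (query_cells D xs T) (k * b ^ i) x)
      = (\<Sum>x\<in>U. \<Sum>i<m. potential U (query_cells D xs T) (k * b ^ i) x)" by (rule sum.swap)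
  also have "\<dots> \<le> (\<Sum>x\<in>U. 4 * real (card (query_cells D xs T x)))"
    using k by (intro sum_mono sum_potential_le) auto
  also have "\<dots> \<le> 4 * (\<Sum>x\<in>U. real (query_cost D xs T x))"
    using cells by (simp add: sum_distrib_left[symmetric])
  finally have "(\<Sum>i<m. \<Sum>x\<in>U. potential U (query_cells D xs T) (k * b ^ i) x) / (\<eta> * N)
      \<le> 4 * (\<Sum>x\<in>U. real (query_cost D xs T x)) / (\<eta> * N)"
    using pos N by (intro divide_right_mono) auto
  moreover have "(\<Sum>i<m. real (card {x \<in> U. query_cells D xs T x \<inter> secret D xs (lo i) (hi i) T \<noteq> {}})) / (\<delta> * N)
      \<le> (\<Sum>x\<in>U. real (query_cost D xs T x)) / (\<delta> * N)"
  proof (rule divide_right_mono)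
    have "(\<Sum>i<m. real (card {x \<in> U. query_cells D xs T x \<inter> secret D xs (lo i) (hi i) T \<noteq> {}}))
        = (\<Sum>i<m. \<Sum>x\<in>U. of_bool (query_cells D xs T x \<inter> secret D xs (lo i) (hi i) T \<noteq> {}))"
      using finU by (simp add: Int_def)
    also have "\<dots> = (\<Sum>x\<in>U. \<Sum>i<m. of_bool (query_cells D xs T x \<inter> secret D xs (lo i) (hi i) T \<noteq> {}))"
      by (rule sum.swap)
    also have "\<dots> \<le> (\<Sum>x\<in>U. real (card (query_cells D xs T x)))"
      unfolding lo_def hi_def by (intro sum_mono sum_hits_le disjoint_secret) simp
    finally show "(\<Sum>i<m. real (card {x \<in> U. query_cells D xs T x \<inter> secret D xs (lo i) (hi i) T \<noteq> {}}))
        \<le> (\<Sum>x\<in>U. real (query_cost D xs T x))" using cells by linarith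
  qed (use pos N in simp)
  moreover have "4 * (\<Sum>x\<in>U. real (query_cost D xs T x)) / (\<eta> * N) + (\<Sum>x\<in>U. real (query_cost D xs T x)) / (\<delta> * N)
      = (4 / \<eta> + 1 / \<delta>) / N * (\<Sum>x\<in>U. real (query_cost D xs T x))"
    using pos N by (simp add: field_simps)
  ultimately show ?thesis using main memory by linarith
qed

text \<open>Double counting: insertion \<open>t\<close> is in the window of \<open>T\<close> iff t +
  q < T \<le> t + p, which leaves at most p - q choices of \<open>T\<close>. Since T > a \<ge> p,
  the subtractions do not truncate.\<close>

lemma sum_windows_le:
  fixes f :: "nat \<Rightarrow> real"
  assumes f: "\<And>t. 0 \<le> f t" and pq: "q \<le> p" "p \<le> a"
  shows "(\<Sum>T\<in>{a<..L}. \<Sum>t\<in>{T - p..<T - q}. f t) \<le> real (p - q) * (\<Sum>t<L. f t)"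
proof -
  have "(\<Sum>T\<in>{a<..L}. \<Sum>t\<in>{T - p..<T - q}. f t)
      = (\<Sum>T\<in>{a<..L}. \<Sum>t<L. if T \<in> {t + q<..t + p} then f t else 0)"
  proof (rule sum.cong)
    fix T assume "T \<in> {a<..L}"
    then have "{T - p..<T - q} = {t \<in> {..<L}. T \<in> {t + q<..t + p}}" using pq by auto
    then show "(\<Sum>t\<in>{T - p..<T - q}. f t) = (\<Sum>t<L. if T \<in> {t + q<..t + p} then f t else 0)"
      by (simp only: sum.inter_filter finite_lessThan)
  qed simp
  also have "\<dots> = (\<Sum>t<L. \<Sum>T\<in>{a<..L}. if T \<in> {t + q<..t + p} then f t else 0)" by (rule sum.swap)
  also have "\<dots> \<le> (\<Sum>t<L. real (p - q) * f t)"
  proof (rule sum_mono)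
    fix t
    have "(\<Sum>T\<in>{a<..L}. if T \<in> {t + q<..t + p} then f t else 0)
        = (\<Sum>T\<in>{T \<in> {a<..L}. T \<in> {t + q<..t + p}}. f t)"
      by (rule sum.inter_filter[symmetric]) simp
    also have "\<dots> = real (card {T \<in> {a<..L}. T \<in> {t + q<..t + p}}) * f t" by simp
    also have "card {T \<in> {a<..L}. T \<in> {t + q<..t + p}} \<le> card {t + q<..t + p}"
      by (intro card_mono) auto
    then have "real (card {T \<in> {a<..L}. T \<in> {t + q<..t + p}}) * f t \<le> real (p - q) * f t"
      using f[of t] by (intro mult_right_mono) auto
    finally show "(\<Sum>T\<in>{a<..L}. if T \<in> {t + q<..t + p} then f t else 0) \<le> real (p - q) * f t" .
  qed
  finally show ?thesis by (simp add: sum_distrib_left)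
qed

text \<open>
  A pair of insertions at distance \<open>d\<close> is separated by the end of the epochs of a given scale for at
  most \<open>d\<close> of the query times, and the scales grow geometrically. This is why the transfers of all
  epochs together are paid for by the probes of a single sequence.
\<close>

lemma sum_transfers_le:
  assumes k: "0 < k" "2 \<le> b" and E: "epoch_end k b m \<le> E"
  shows "(\<Sum>T\<in>{E<..L}. \<Sum>i<m. (\<Sum>t\<in>{T - epoch_end k b i..<T}.
      \<Sum>s\<in>{T - epoch_end k b (Suc i)..<T - epoch_end k b i}. real (transfer D xs s t)) / real (k * b ^ i))
    \<le> 3 / (real b - 1) * (\<Sum>t<L. real (insert_cost D xs t))"
proof -
  define e where "e = epoch_end k b"
  \<comment> \<open>At query time \<open>T\<close>, insertion \<open>s\<close> lies in epoch
    \<open>i\<close> and insertion \<open>t\<close> after that epoch; stated without subtraction so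
    that \<open>T\<close> can be counted for fixed \<open>s\<close> and \<open>t\<close>.\<close>
  define P where "P T i t s \<longleftrightarrow> t < T \<and> T \<le> t + e i \<and> s + e i < T \<and> T \<le> s + e (Suc i)" for T i t s
  let ?l = "\<lambda>i. real (k * b ^ i)"
  have l: "0 < ?l i" for i using k by simp
  have eE: "e i \<le> E" if "i \<le> m" for i
    using epoch_end_mono[OF that, of k b] E by (simp add: e_def)
  have "(\<Sum>T\<in>{E<..L}. \<Sum>i<m. (\<Sum>t\<in>{T - e i..<T}. \<Sum>s\<in>{T - e (Suc i)..<T - e i}.
        real (transfer D xs s t)) / ?l i)
      = (\<Sum>T\<in>{E<..L}. \<Sum>i<m. \<Sum>t<L. \<Sum>s<t. real (transfer D xs s t) * (of_bool (P T i t s) / ?l i))"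
  proof (intro sum.cong refl)
    fix T i assume T: "T \<in> {E<..L}" and i: "i \<in> {..<m}"
    have e: "e i < T" "e (Suc i) < T" using eE[of i] eE[of "Suc i"] T i by auto
    have "(\<Sum>t\<in>{T - e i..<T}. \<Sum>s\<in>{T - e (Suc i)..<T - e i}. real (transfer D xs s t))
        = (\<Sum>t\<in>{T - e i..<T}. \<Sum>s<t. real (transfer D xs s t) * of_bool (P T i t s))"
    proof (rule sum.cong)
      fix t assume t: "t \<in> {T - e i..<T}"
      have "{T - e (Suc i)..<T - e i} = {s \<in> {..<t}. P T i t s}" using t e by (auto simp: P_def)
      then have "(\<Sum>s\<in>{T - e (Suc i)..<T - e i}. real (transfer D xs s t))
          = (\<Sum>s<t. if P T i t s then real (transfer D xs s t) else 0)"
        by (simp only: sum.inter_filter finite_lessThan)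
      also have "\<dots> = (\<Sum>s<t. real (transfer D xs s t) * of_bool (P T i t s))"
        by (intro sum.cong) auto
      finally show "(\<Sum>s\<in>{T - e (Suc i)..<T - e i}. real (transfer D xs s t))
          = (\<Sum>s<t. real (transfer D xs s t) * of_bool (P T i t s))" .
    qed simp
    also have "\<dots> = (\<Sum>t<L. \<Sum>s<t. real (transfer D xs s t) * of_bool (P T i t s))"
      by (rule sum.mono_neutral_left) (use T e in \<open>auto simp: P_def intro!: sum.neutral\<close>)
    finally show "(\<Sum>t\<in>{T - e i..<T}. \<Sum>s\<in>{T - e (Suc i)..<T - e i}. real (transfer D xs s t)) / ?l i
        = (\<Sum>t<L. \<Sum>s<t. real (transfer D xs s t) * (of_bool (P T i t s) / ?l i))"
      by (simp only: sum_divide_distrib times_divide_eq_right)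
  qed
  also have "\<dots> = (\<Sum>T\<in>{E<..L}. \<Sum>t<L. \<Sum>i<m. \<Sum>s<t. real (transfer D xs s t) * (of_bool (P T i t s) / ?l i))"
    by (intro sum.cong refl sum.swap)
  also have "\<dots> = (\<Sum>t<L. \<Sum>T\<in>{E<..L}. \<Sum>i<m. \<Sum>s<t. real (transfer D xs s t) * (of_bool (P T i t s) / ?l i))"
    by (rule sum.swap)
  also have "\<dots> = (\<Sum>t<L. \<Sum>T\<in>{E<..L}. \<Sum>s<t. \<Sum>i<m. real (transfer D xs s t) * (of_bool (P T i t s) / ?l i))"
    by (intro sum.cong refl sum.swap)
  also have "\<dots> = (\<Sum>t<L. \<Sum>s<t. \<Sum>T\<in>{E<..L}. \<Sum>i<m. real (transfer D xs s t) * (of_bool (P T i t s) / ?l i))"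
    by (intro sum.cong refl sum.swap)
  also have "\<dots> = (\<Sum>t<L. \<Sum>s<t. real (transfer D xs s t) * (\<Sum>i<m. \<Sum>T\<in>{E<..L}. of_bool (P T i t s) / ?l i))"
    by (intro sum.cong refl) (subst sum.swap, simp add: sum_distrib_left)
  also have "\<dots> \<le> (\<Sum>t<L. \<Sum>s<t. real (transfer D xs s t) * (3 / (real b - 1)))"
  proof (intro sum_mono mult_left_mono)
    fix t s :: nat assume "s \<in> {..<t}"
    then have st: "s < t" by simp
    have "(\<Sum>i<m. \<Sum>T\<in>{E<..L}. of_bool (P T i t s) / ?l i)
        \<le> (\<Sum>i<m. if real (t - s) < real (e (Suc i)) then min (real (t - s)) (real (e i)) / ?l i else 0)"
    proof (rule sum_mono)
      fix i
      have "(\<Sum>T\<in>{E<..L}. of_bool (P T i t s) / ?l i) = real (card ({E<..L} \<inter> {T. P T i t s})) / ?l i"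
        by (simp add: sum_divide_distrib[symmetric])
      also have "\<dots> \<le> (if real (t - s) < real (e (Suc i)) then min (real (t - s)) (real (e i)) / ?l i else 0)"
      proof (cases "t - s < e (Suc i)")
        case True
        \<comment> \<open>\<open>T\<close> is above both \<open>s + e i\<close> and
          \<open>t\<close>, and at most \<open>t + e i\<close>. The two intervals have
          \<open>t - s\<close> and \<open>e i\<close> elements.\<close>
        have "card ({E<..L} \<inter> {T. P T i t s}) \<le> card {s + e i<..t + e i}"
          "card ({E<..L} \<inter> {T. P T i t s}) \<le> card {t<..t + e i}"
          by (intro card_mono; auto simp: P_def)+
        then have "card ({E<..L} \<inter> {T. P T i t s}) \<le> t - s"
          "card ({E<..L} \<inter> {T. P T i t s}) \<le> e i" by auto
        then have "real (card ({E<..L} \<inter> {T. P T i t s})) \<le> min (real (t - s)) (real (e i))" by simp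
        then show ?thesis using True l[of i] by (simp add: divide_right_mono)
      next
        case False
        then have "{E<..L} \<inter> {T. P T i t s} = {}" using st by (auto simp: P_def)
        then show ?thesis using False by simp
      qed
      finally show "(\<Sum>T\<in>{E<..L}. of_bool (P T i t s) / ?l i)
        \<le> (if real (t - s) < real (e (Suc i)) then min (real (t - s)) (real (e i)) / ?l i else 0)" .
    qed
    also have "\<dots> \<le> 3 / (real b - 1)"
      unfolding e_def by (rule sum_crossings_le) (use k in auto)
    finally show "(\<Sum>i<m. \<Sum>T\<in>{E<..L}. of_bool (P T i t s) / ?l i) \<le> 3 / (real b - 1)" .
  qed simp
  also have "\<dots> = 3 / (real b - 1) * (\<Sum>t<L. real (\<Sum>s<t. transfer D xs s t))"
    by (simp add: sum_distrib_left mult.commute)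
  also have "\<dots> \<le> 3 / (real b - 1) * (\<Sum>t<L. real (insert_cost D xs t))"
    using k by (intro mult_left_mono sum_mono) (auto simp only: of_nat_le_iff sum_transfer_le, auto)
  finally show ?thesis by (simp add: e_def)
qed

text \<open>An insertion lies in epoch \<open>i\<close> for at most l i query times and after it for
  at most l i / (b - 1). So flags and transfers are suppressed by b - 1, but the cells written in
  the epochs cost m / \<alpha> per probe: this is where it matters that an update makes fewer than
  one probe.\<close>

lemma query_times_bound:
  assumes D: "wf_det_ds n M w D" and U: "U = universe n" "U \<noteq> {}" and xs: "xs \<in> lists_of U L"
    and k: "0 < k" "2 \<le> b" and E: "E = epoch_end k b m" "E \<le> L"
    and pos: "0 < \<eta>" "0 < \<delta>" "0 < \<alpha>" "0 < \<beta>"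
  defines "N \<equiv> real (card U)" and "R \<equiv> real (L - E)"
    and "lo \<equiv> \<lambda>T i. T - epoch_end k b (Suc i)" and "hi \<equiv> \<lambda>T i. T - epoch_end k b i"
    and "l \<equiv> \<lambda>i. real (k * b ^ i)"
  shows "R * real m \<le> (\<Sum>T\<in>{E<..L}. \<Sum>i<m. of_bool (good D U \<eta> \<delta> \<alpha> \<beta> (lo T i) (hi T i) T xs))
    + R * real m * (real M / real k + real L / (\<delta> * N))
    + ((real m + 3 * real w) / (real b - 1) + real m / \<alpha>) * (\<Sum>t<L. real (insert_cost D xs t))
    + (4 / \<eta> + 1 / \<delta>) / N * (\<Sum>T\<in>{E<..L}. \<Sum>x\<in>U. real (query_cost D xs T x))
    + real m / (\<delta> * N) * (\<Sum>T\<in>{E<..L}. \<Sum>x\<in>U. query_error D xs T x)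
    + (\<Sum>T\<in>{E<..L}. \<Sum>i<m. (\<Sum>t\<in>{lo T i..<hi T i}. query_error D xs T (xs ! t)) / (\<beta> * l i))"
proof -
  define c where "c = (\<Sum>t<L. real (insert_cost D xs t))"
  have c0: "0 \<le> c" by (simp add: c_def sum_nonneg)
  have l: "0 < l i" for i using k by (simp add: l_def)
  have eE: "epoch_end k b i \<le> E" if "i \<le> m" for i
    using epoch_end_mono[OF that, of k b] E by simp
  have "(\<Sum>T\<in>{E<..L}. real m) \<le> (\<Sum>T\<in>{E<..L}. (\<Sum>i<m. of_bool (good D U \<eta> \<delta> \<alpha> \<beta> (lo T i) (hi T i) T xs))
    + real m * (real M / real k)
    + (\<Sum>i<m. (\<Sum>t\<in>{hi T i..<T}. real (insert_cost D xs t)) / l i)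
    + real w * (\<Sum>i<m. (\<Sum>t\<in>{hi T i..<T}. \<Sum>s\<in>{lo T i..<hi T i}. real (transfer D xs s t)) / l i)
    + (4 / \<eta> + 1 / \<delta>) / N * (\<Sum>x\<in>U. real (query_cost D xs T x))
    + real m * (((\<Sum>x\<in>U. query_error D xs T x) + real L) / (\<delta> * N))
    + (\<Sum>i<m. (\<Sum>t\<in>{lo T i..<hi T i}. query_error D xs T (xs ! t)) / (\<beta> * l i))
    + (\<Sum>i<m. (\<Sum>t\<in>{lo T i..<hi T i}. real (insert_cost D xs t)) / (\<alpha> * l i)))"
    unfolding N_def lo_def hi_def l_def
    by (intro sum_mono epochs_bound[OF D U xs k _ _ pos]) (use E in auto)
  also have "\<dots> = (\<Sum>T\<in>{E<..L}. \<Sum>i<m. of_bool (good D U \<eta> \<delta> \<alpha> \<beta> (lo T i) (hi T i) T xs))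
    + R * (real m * (real M / real k))
    + (\<Sum>T\<in>{E<..L}. \<Sum>i<m. (\<Sum>t\<in>{hi T i..<T}. real (insert_cost D xs t)) / l i)
    + real w * (\<Sum>T\<in>{E<..L}. \<Sum>i<m. (\<Sum>t\<in>{hi T i..<T}. \<Sum>s\<in>{lo T i..<hi T i}. real (transfer D xs s t)) / l i)
    + (4 / \<eta> + 1 / \<delta>) / N * (\<Sum>T\<in>{E<..L}. \<Sum>x\<in>U. real (query_cost D xs T x))
    + real m * (((\<Sum>T\<in>{E<..L}. \<Sum>x\<in>U. query_error D xs T x) + R * real L) / (\<delta> * N))
    + (\<Sum>T\<in>{E<..L}. \<Sum>i<m. (\<Sum>t\<in>{lo T i..<hi T i}. query_error D xs T (xs ! t)) / (\<beta> * l i))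
    + (\<Sum>T\<in>{E<..L}. \<Sum>i<m. (\<Sum>t\<in>{lo T i..<hi T i}. real (insert_cost D xs t)) / (\<alpha> * l i))"
    by (simp only: sum.distrib sum_divide_distrib[symmetric] sum_distrib_left[symmetric] sum_constant
        card_greaterThanAtMost R_def) simp
  finally have main: "R * real m \<le> \<dots>" by (simp add: R_def)
  have "(\<Sum>T\<in>{E<..L}. \<Sum>i<m. (\<Sum>t\<in>{hi T i..<T}. real (insert_cost D xs t)) / l i)
      = (\<Sum>i<m. (\<Sum>T\<in>{E<..L}. \<Sum>t\<in>{T - epoch_end k b i..<T - 0}. real (insert_cost D xs t)) / l i)"
    by (subst sum.swap) (simp add: sum_divide_distrib hi_def)
  also have "\<dots> \<le> (\<Sum>i<m. c / (real b - 1))"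
  proof (rule sum_mono)
    fix i assume "i \<in> {..<m}"
    then have "(\<Sum>T\<in>{E<..L}. \<Sum>t\<in>{T - epoch_end k b i..<T - 0}. real (insert_cost D xs t))
        \<le> real (epoch_end k b i - 0) * c"
      unfolding c_def by (intro sum_windows_le eE) auto
    also have "\<dots> \<le> l i / (real b - 1) * c"
      using epoch_end_le[OF k(2), of k i] c0 unfolding l_def by (intro mult_right_mono) auto
    finally show "(\<Sum>T\<in>{E<..L}. \<Sum>t\<in>{T - epoch_end k b i..<T - 0}. real (insert_cost D xs t)) / l i
        \<le> c / (real b - 1)" using l[of i] k by (simp add: field_simps)
  qed
  finally have c1: "(\<Sum>T\<in>{E<..L}. \<Sum>i<m. (\<Sum>t\<in>{hi T i..<T}. real (insert_cost D xs t)) / l i)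
      \<le> real m * (c / (real b - 1))" by simp
  have "(\<Sum>T\<in>{E<..L}. \<Sum>i<m. (\<Sum>t\<in>{lo T i..<hi T i}. real (insert_cost D xs t)) / (\<alpha> * l i))
      = (\<Sum>i<m. (\<Sum>T\<in>{E<..L}. \<Sum>t\<in>{lo T i..<hi T i}. real (insert_cost D xs t)) / (\<alpha> * l i))"
    by (subst sum.swap) (simp add: sum_divide_distrib)
  also have "\<dots> \<le> (\<Sum>i<m. c / \<alpha>)"
  proof (rule sum_mono)
    fix i assume "i \<in> {..<m}"
    then have "(\<Sum>T\<in>{E<..L}. \<Sum>t\<in>{lo T i..<hi T i}. real (insert_cost D xs t))
        \<le> real (epoch_end k b (Suc i) - epoch_end k b i) * c"
      unfolding c_def lo_def hi_def by (intro sum_windows_le eE) auto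
    also have "\<dots> = l i * c" by (simp add: l_def)
    finally show "(\<Sum>T\<in>{E<..L}. \<Sum>t\<in>{lo T i..<hi T i}. real (insert_cost D xs t)) / (\<alpha> * l i) \<le> c / \<alpha>"
      using l[of i] pos by (simp add: field_simps)
  qed
  finally have c2: "(\<Sum>T\<in>{E<..L}. \<Sum>i<m. (\<Sum>t\<in>{lo T i..<hi T i}. real (insert_cost D xs t)) / (\<alpha> * l i))
      \<le> real m * (c / \<alpha>)" by simp
  have "(\<Sum>T\<in>{E<..L}. \<Sum>i<m. (\<Sum>t\<in>{hi T i..<T}. \<Sum>s\<in>{lo T i..<hi T i}. real (transfer D xs s t)) / l i)
      \<le> 3 / (real b - 1) * c"
    unfolding c_def hi_def lo_def l_def by (rule sum_transfers_le[OF k]) (simp add: E)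
  then have c3: "real w * (\<Sum>T\<in>{E<..L}. \<Sum>i<m. (\<Sum>t\<in>{hi T i..<T}. \<Sum>s\<in>{lo T i..<hi T i}.
      real (transfer D xs s t)) / l i) \<le> real w * (3 / (real b - 1) * c)"
    by (intro mult_left_mono) auto
  have "real m * (c / (real b - 1)) + real w * (3 / (real b - 1) * c) + real m * (c / \<alpha>)
      = ((real m + 3 * real w) / (real b - 1) + real m / \<alpha>) * c"
    by (simp add: add_divide_distrib ring_distribs)
  moreover have "R * (real m * (real M / real k)) + real m * (((\<Sum>T\<in>{E<..L}. \<Sum>x\<in>U. query_error D xs T x) + R * real L) / (\<delta> * N))
      = R * real m * (real M / real k + real L / (\<delta> * N))
        + real m / (\<delta> * N) * (\<Sum>T\<in>{E<..L}. \<Sum>x\<in>U. query_error D xs T x)"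
    by (simp add: add_divide_distrib ring_distribs mult_ac)
  ultimately show ?thesis using main c1 c2 c3 unfolding c_def by linarith
qed

text \<open>Averaging over all sequences is needed for the good windows alone: per query time and
  epoch, at most a share (1 / 2) ^ k of the sequences is good, as no epoch is shorter than
  \<open>k\<close>.\<close>

lemma deterministic_bound:
  assumes D: "wf_det_ds n M w D" and U: "U = universe n" "U \<noteq> {}"
    and k: "0 < k" "2 \<le> b" and E: "E = epoch_end k b m" "E \<le> L"
    and pos: "0 < \<eta>" "0 < \<delta>" "0 < \<alpha>" "0 < \<beta>"
    and \<rho>: "\<eta> \<le> 1" "3 * \<delta> + 2 * sqrt \<eta> \<le> \<rho>" "\<rho> \<le> 1" "\<rho> powr (1 - \<beta> - \<alpha>) \<le> 1 / 32"
  defines "S \<equiv> lists_of U L" and "N \<equiv> real (card U)" and "R \<equiv> real (L - E)"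
    and "l \<equiv> \<lambda>i. real (k * b ^ i)"
  shows "R * real m * real (card S) \<le>
      R * real m * real (card S) * ((1 / 2) ^ k + real M / real k + real L / (\<delta> * N))
    + ((real m + 3 * real w) / (real b - 1) + real m / \<alpha>) * (\<Sum>xs\<in>S. \<Sum>t<L. real (insert_cost D xs t))
    + (4 / \<eta> + 1 / \<delta>) / N * (\<Sum>xs\<in>S. \<Sum>T\<in>{E<..L}. \<Sum>x\<in>U. real (query_cost D xs T x))
    + real m / (\<delta> * N) * (\<Sum>xs\<in>S. \<Sum>T\<in>{E<..L}. \<Sum>x\<in>U. query_error D xs T x)
    + (\<Sum>xs\<in>S. \<Sum>T\<in>{E<..L}. \<Sum>i<m. (\<Sum>t\<in>{T - epoch_end k b (Suc i)..<T - epoch_end k b i}.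
        query_error D xs T (xs ! t)) / (\<beta> * l i))"
proof -
  let ?g = "\<lambda>xs T i. of_bool (good D U \<eta> \<delta> \<alpha> \<beta> (T - epoch_end k b (Suc i)) (T - epoch_end k b i) T xs) :: real"
  have "(\<Sum>xs\<in>S. R * real m) \<le> (\<Sum>xs\<in>S. (\<Sum>T\<in>{E<..L}. \<Sum>i<m. ?g xs T i)
    + R * real m * (real M / real k + real L / (\<delta> * N))
    + ((real m + 3 * real w) / (real b - 1) + real m / \<alpha>) * (\<Sum>t<L. real (insert_cost D xs t))
    + (4 / \<eta> + 1 / \<delta>) / N * (\<Sum>T\<in>{E<..L}. \<Sum>x\<in>U. real (query_cost D xs T x))
    + real m / (\<delta> * N) * (\<Sum>T\<in>{E<..L}. \<Sum>x\<in>U. query_error D xs T x)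
    + (\<Sum>T\<in>{E<..L}. \<Sum>i<m. (\<Sum>t\<in>{T - epoch_end k b (Suc i)..<T - epoch_end k b i}.
        query_error D xs T (xs ! t)) / (\<beta> * l i)))"
    unfolding N_def R_def l_def S_def
    by (intro sum_mono query_times_bound[OF D U _ k E pos])
  also have "\<dots> = (\<Sum>xs\<in>S. \<Sum>T\<in>{E<..L}. \<Sum>i<m. ?g xs T i)
    + real (card S) * (R * real m * (real M / real k + real L / (\<delta> * N)))
    + ((real m + 3 * real w) / (real b - 1) + real m / \<alpha>) * (\<Sum>xs\<in>S. \<Sum>t<L. real (insert_cost D xs t))
    + (4 / \<eta> + 1 / \<delta>) / N * (\<Sum>xs\<in>S. \<Sum>T\<in>{E<..L}. \<Sum>x\<in>U. real (query_cost D xs T x))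
    + real m / (\<delta> * N) * (\<Sum>xs\<in>S. \<Sum>T\<in>{E<..L}. \<Sum>x\<in>U. query_error D xs T x)
    + (\<Sum>xs\<in>S. \<Sum>T\<in>{E<..L}. \<Sum>i<m. (\<Sum>t\<in>{T - epoch_end k b (Suc i)..<T - epoch_end k b i}.
        query_error D xs T (xs ! t)) / (\<beta> * l i))"
    by (simp only: sum.distrib sum_distrib_left[symmetric] sum_constant)
      (simp add: distrib_left mult_ac)
  finally have main: "real (card S) * (R * real m) \<le> \<dots>" by simp
  have "(\<Sum>xs\<in>S. \<Sum>T\<in>{E<..L}. \<Sum>i<m. ?g xs T i) = (\<Sum>T\<in>{E<..L}. \<Sum>xs\<in>S. \<Sum>i<m. ?g xs T i)"
    by (rule sum.swap)
  also have "\<dots> = (\<Sum>T\<in>{E<..L}. \<Sum>i<m. \<Sum>xs\<in>S. ?g xs T i)" by (intro sum.cong refl sum.swap)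
  also have "\<dots> \<le> (\<Sum>T\<in>{E<..L}. \<Sum>i<m. (1 / 2) ^ k * real (card S))"
  proof (intro sum_mono)
    fix T i assume T: "T \<in> {E<..L}" and "i \<in> {..<m}"
    then have "epoch_end k b (Suc i) \<le> E" unfolding E by (intro epoch_end_mono) simp
    then have lo: "T - epoch_end k b i = (T - epoch_end k b (Suc i)) + k * b ^ i" using T by simp
    have "(\<Sum>xs\<in>S. ?g xs T i) \<le> (1 / 2) ^ (k * b ^ i) * real (card S)"
      unfolding S_def lo using T lo k pos
      by (intro card_good_all_le[OF D U _ _ _ pos(1) \<rho>(1) _ \<rho>(2-4)]) auto
    also have "\<dots> \<le> (1 / 2) ^ k * real (card S)"
      using k by (intro mult_right_mono power_decreasing) auto
    finally show "(\<Sum>xs\<in>S. ?g xs T i) \<le> (1 / 2) ^ k * real (card S)" .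
  qed
  also have "\<dots> = R * real m * real (card S) * (1 / 2) ^ k" by (simp add: R_def)
  finally have "(\<Sum>xs\<in>S. \<Sum>T\<in>{E<..L}. \<Sum>i<m. ?g xs T i) \<le> R * real m * real (card S) * (1 / 2) ^ k" .
  with main show ?thesis by (simp add: algebra_simps)
qed

section \<open>Randomized data structures\<close>

lemma update_probes_eq:
  "update_probes D (map Insert xs) = (\<Sum>t<length xs. insert_cost D xs t)"
  unfolding update_probes_def
  by (intro sum.cong)
    (auto simp: insert_cost_def probes_def conf_def take_map split_beta)

lemma valid_insertions:
  assumes "set xs \<subseteq> universe n" "length xs \<le> n"
  shows "valid_ops n (map Insert xs)"
proof -
  have "stored (map Insert xs) = set xs" by (auto simp: stored_def)
  then show ?thesis using assms card_length[of xs] by (auto simp: valid_ops_def)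
qed

lemma integral_sum_le:
  fixes f :: "'i \<Rightarrow> 'a \<Rightarrow> real"
  assumes "\<And>i. i \<in> I \<Longrightarrow> integrable P (f i) \<and> (\<integral>\<omega>. f i \<omega> \<partial>P) \<le> c i"
  shows "integrable P (\<lambda>\<omega>. \<Sum>i\<in>I. f i \<omega>) \<and> (\<integral>\<omega>. (\<Sum>i\<in>I. f i \<omega>) \<partial>P) \<le> (\<Sum>i\<in>I. c i)"
  using assms by (auto intro!: sum_mono simp: Bochner_Integration.integral_sum)

text \<open>The deterministic inequality is linear with nonnegative coefficients, so the means of
  costs and errors can be inserted after integration. All inputs are independent of the seed: each
  is a prefix of a fixed sequence with a fixed key, even when the key is one of the epoch itself, as
  in \<open>f4\<close>.\<close>

lemma randomized_bound:
  assumes ds: "randomized_ds n M w P D" and correct: "solves_membership n C P D"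
    and update: "expected_amortized_update_time_le n P D t"
    and query: "query_time_le n P D q"
    and n: "0 < n" and C: "0 \<le> C"
    and k: "0 < k" "2 \<le> b" and E: "E = epoch_end k b m" "E \<le> L" "L \<le> n"
    and pos: "0 < \<eta>" "0 < \<delta>" "0 < \<alpha>" "0 < \<beta>"
    and \<rho>: "\<eta> \<le> 1" "3 * \<delta> + 2 * sqrt \<eta> \<le> \<rho>" "\<rho> \<le> 1" "\<rho> powr (1 - \<beta> - \<alpha>) \<le> 1 / 32"
  defines "R \<equiv> real (L - E)"
  shows "R * real m \<le> R * real m * ((1 / 2) ^ k + real M / real k + real L / (\<delta> * (2 * real n)))
    + ((real m + 3 * real w) / (real b - 1) + real m / \<alpha>) * (t * real L)
    + (4 / \<eta> + 1 / \<delta>) * (R * q) + R * real m * (C / \<delta> + C / \<beta>)"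
proof -
  define U where "U = universe n"
  define S where "S = lists_of U L"
  define N where "N = real (card U)"
  define W where "W T i = {T - epoch_end k b (Suc i)..<T - epoch_end k b i}" for T i
  let ?l = "\<lambda>i. real (k * b ^ i)"
  interpret prob_space P using ds by (simp add: randomized_ds_def)
  have wf: "wf_det_ds n M w (D \<omega>)" if "\<omega> \<in> space P" for \<omega>
    using ds that by (simp add: randomized_ds_def)
  have N: "N = 2 * real n" "0 < N" using n by (simp_all add: N_def U_def universe_def)
  have U: "U \<noteq> {}" "finite U" using n by (auto simp: U_def universe_def)
  have S: "0 < real (card S)" using U N by (simp add: S_def card_lists_of N_def)
  have seq: "set xs \<subseteq> universe n" "length xs = L" if "xs \<in> S" for xs
    using that by (auto simp: S_def lists_of_def U_def)
  have valid: "valid_ops n (map Insert (take T xs))" if "xs \<in> S" for xs T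
    using seq[OF that] E by (intro valid_insertions) (auto dest: in_set_takeD)

  define f1 where "f1 \<omega> = (\<Sum>xs\<in>S. \<Sum>t<L. real (insert_cost (D \<omega>) xs t))" for \<omega>
  define f2 where "f2 \<omega> = (\<Sum>xs\<in>S. \<Sum>T\<in>{E<..L}. \<Sum>x\<in>U. real (query_cost (D \<omega>) xs T x))" for \<omega>
  define f3 where "f3 \<omega> = (\<Sum>xs\<in>S. \<Sum>T\<in>{E<..L}. \<Sum>x\<in>U. query_error (D \<omega>) xs T x)" for \<omega>
  define f4 where "f4 \<omega> = (\<Sum>xs\<in>S. \<Sum>T\<in>{E<..L}. \<Sum>i<m. (\<Sum>t\<in>W T i.
      query_error (D \<omega>) xs T (xs ! t)) / (\<beta> * ?l i))" for \<omega>

  have f1: "integrable P f1 \<and> (\<integral>\<omega>. f1 \<omega> \<partial>P) \<le> (\<Sum>xs\<in>S. t * real L)"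
    unfolding f1_def
  proof (rule integral_sum_le)
    fix xs assume xs: "xs \<in> S"
    have eq: "real (update_probes (D \<omega>) (map Insert xs)) = (\<Sum>t<L. real (insert_cost (D \<omega>) xs t))" for \<omega>
      using seq[OF xs] by (simp add: update_probes_eq)
    have num: "num_updates (map Insert xs) = L" using seq[OF xs] by (simp add: num_updates_def comp_def)
    have "valid_ops n (map Insert xs)" using valid[OF xs, of L] seq[OF xs] by simp
    from update[unfolded expected_amortized_update_time_le_def, rule_format, OF this]
    show "integrable P (\<lambda>\<omega>. \<Sum>t<L. real (insert_cost (D \<omega>) xs t)) \<and>
        (\<integral>\<omega>. (\<Sum>t<L. real (insert_cost (D \<omega>) xs t)) \<partial>P) \<le> t * real L"
      unfolding eq num .
  qed
  have f2: "integrable P f2 \<and> (\<integral>\<omega>. f2 \<omega> \<partial>P) \<le> (\<Sum>xs\<in>S. \<Sum>T\<in>{E<..L}. \<Sum>x\<in>U. q)"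
    unfolding f2_def
  proof (intro integral_sum_le)
    fix xs T x assume "xs \<in> S" "x \<in> U"
    then have "valid_ops n (map Insert (take T xs))" "x \<in> universe n"
      by (simp_all add: valid U_def)
    from query[unfolded query_time_le_def, rule_format, OF this]
    show "integrable P (\<lambda>\<omega>. real (query_cost (D \<omega>) xs T x)) \<and>
        (\<integral>\<omega>. real (query_cost (D \<omega>) xs T x) \<partial>P) \<le> q"
      unfolding query_cost_def conf_def .
  qed
  have error: "integrable P (\<lambda>\<omega>. query_error (D \<omega>) xs T x) \<and>
      (\<integral>\<omega>. query_error (D \<omega>) xs T x \<partial>P) \<le> C" if xs: "xs \<in> S" and x: "x \<in> U" for xs T x
  proof -
    let ?qs = "map Insert (take T xs)"
    define G where "G = {\<omega> \<in> space P. answer (D \<omega>) (Query x) (config_after (D \<omega>) ?qs) \<longleftrightarrow> x \<in> stored ?qs}"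
    have G: "G \<in> sets P" "1 - C \<le> measure P G"
      using correct[unfolded solves_membership_def Let_def, rule_format, OF valid[OF xs, of T], of x] x
      unfolding U_def G_def by auto
    have "stored ?qs = set (take T xs)" by (auto simp: stored_def)
    then have eq: "query_error (D \<omega>) xs T x = indicator (space P - G) \<omega>" if "\<omega> \<in> space P" for \<omega>
      using that by (simp add: query_error_def query_answer_def conf_def G_def indicator_def)
    have "integrable P (\<lambda>\<omega>. query_error (D \<omega>) xs T x) \<longleftrightarrow> integrable P (indicator (space P - G) :: _ \<Rightarrow> real)"
      by (rule Bochner_Integration.integrable_cong) (simp_all add: eq)
    moreover have "integrable P (indicator (space P - G) :: _ \<Rightarrow> real)"
      using G by (intro integrable_real_indicator) (auto simp: emeasure_eq_measure)
    moreover have "(\<integral>\<omega>. query_error (D \<omega>) xs T x \<partial>P) = (\<integral>\<omega>. indicator (space P - G) \<omega> \<partial>P)"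
      by (rule Bochner_Integration.integral_cong) (simp_all add: eq)
    moreover have "(\<integral>\<omega>. indicator (space P - G) \<omega> \<partial>P) = 1 - measure P G"
      using G prob_compl[of G] by (simp add: Int_absorb1)
    ultimately show ?thesis using G by simp
  qed
  have f3: "integrable P f3 \<and> (\<integral>\<omega>. f3 \<omega> \<partial>P) \<le> (\<Sum>xs\<in>S. \<Sum>T\<in>{E<..L}. \<Sum>x\<in>U. C)"
    unfolding f3_def by (intro integral_sum_le error)
  have f4: "integrable P f4 \<and> (\<integral>\<omega>. f4 \<omega> \<partial>P) \<le> (\<Sum>xs\<in>S. \<Sum>T\<in>{E<..L}. \<Sum>i<m. C / \<beta>)"
    unfolding f4_def
  proof (intro integral_sum_le)
    fix xs T and i :: nat assume xs: "xs \<in> S" and T: "T \<in> {E<..L}"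
    have l: "0 < ?l i" using k by simp
    have "integrable P (\<lambda>\<omega>. \<Sum>t\<in>W T i. query_error (D \<omega>) xs T (xs ! t)) \<and>
        (\<integral>\<omega>. (\<Sum>t\<in>W T i. query_error (D \<omega>) xs T (xs ! t)) \<partial>P) \<le> (\<Sum>t\<in>W T i. C)"
    proof (rule integral_sum_le)
      fix t assume "t \<in> W T i"
      then have "t < length xs" using T seq[OF xs] by (auto simp: W_def)
      then have "xs ! t \<in> U" using seq[OF xs] unfolding U_def by (meson nth_mem subsetD)
      then show "integrable P (\<lambda>\<omega>. query_error (D \<omega>) xs T (xs ! t)) \<and>
        (\<integral>\<omega>. query_error (D \<omega>) xs T (xs ! t) \<partial>P) \<le> C" by (rule error[OF xs])
    qed
    moreover have "(\<Sum>t\<in>W T i. C) \<le> ?l i * C"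
    proof -
      have "real (card (W T i)) \<le> ?l i" unfolding of_nat_le_iff by (simp add: W_def)
      then show ?thesis using C unfolding sum_constant by (rule mult_right_mono)
    qed
    ultimately have "integrable P (\<lambda>\<omega>. \<Sum>t\<in>W T i. query_error (D \<omega>) xs T (xs ! t))"
      "(\<integral>\<omega>. (\<Sum>t\<in>W T i. query_error (D \<omega>) xs T (xs ! t)) \<partial>P) \<le> ?l i * C" by auto
    moreover from this(2) have "(\<integral>\<omega>. (\<Sum>t\<in>W T i. query_error (D \<omega>) xs T (xs ! t)) \<partial>P) / (\<beta> * ?l i)
        \<le> C / \<beta>"
      using l pos by (simp add: field_simps)
    ultimately show "integrable P (\<lambda>\<omega>. (\<Sum>t\<in>W T i. query_error (D \<omega>) xs T (xs ! t)) / (\<beta> * ?l i)) \<and>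
        (\<integral>\<omega>. (\<Sum>t\<in>W T i. query_error (D \<omega>) xs T (xs ! t)) / (\<beta> * ?l i) \<partial>P) \<le> C / \<beta>"
      by simp
  qed

  define a0 where "a0 = R * real m * real (card S) * ((1 / 2) ^ k + real M / real k + real L / (\<delta> * N))"
  define a1 where "a1 = (real m + 3 * real w) / (real b - 1) + real m / \<alpha>"
  define a2 where "a2 = (4 / \<eta> + 1 / \<delta>) / N"
  define a3 where "a3 = real m / (\<delta> * N)"
  have a: "0 \<le> a1" "0 \<le> a2" "0 \<le> a3" using k pos N by (simp_all add: a1_def a2_def a3_def)
  have "R * real m * real (card S) = (\<integral>\<omega>. R * real m * real (card S) \<partial>P)" by (simp add: prob_space)
  also have "\<dots> \<le> (\<integral>\<omega>. a0 + a1 * f1 \<omega> + a2 * f2 \<omega> + a3 * f3 \<omega> + f4 \<omega> \<partial>P)"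
  proof (rule integral_mono)
    fix \<omega> assume "\<omega> \<in> space P"
    from deterministic_bound[OF wf[OF this] U_def U(1) k E(1,2) pos \<rho>]
    show "R * real m * real (card S) \<le> a0 + a1 * f1 \<omega> + a2 * f2 \<omega> + a3 * f3 \<omega> + f4 \<omega>"
      unfolding a0_def a1_def a2_def a3_def f1_def f2_def f3_def f4_def W_def S_def N_def R_def .
  qed (use f1 f2 f3 f4 in auto)
  also have "\<dots> = a0 + a1 * (\<integral>\<omega>. f1 \<omega> \<partial>P) + a2 * (\<integral>\<omega>. f2 \<omega> \<partial>P) + a3 * (\<integral>\<omega>. f3 \<omega> \<partial>P) + (\<integral>\<omega>. f4 \<omega> \<partial>P)"
    using f1 f2 f3 f4 by (simp add: prob_space)
  also have "\<dots> \<le> a0 + a1 * (\<Sum>xs\<in>S. t * real L) + a2 * (\<Sum>xs\<in>S. \<Sum>T\<in>{E<..L}. \<Sum>x\<in>U. q)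
      + a3 * (\<Sum>xs\<in>S. \<Sum>T\<in>{E<..L}. \<Sum>x\<in>U. C) + (\<Sum>xs\<in>S. \<Sum>T\<in>{E<..L}. \<Sum>i<m. C / \<beta>)"
    using f1 f2 f3 f4 a by (intro add_mono mult_left_mono) auto
  also have "\<dots> = real (card S) * (R * real m * ((1 / 2) ^ k + real M / real k + real L / (\<delta> * N))
      + a1 * (t * real L) + (4 / \<eta> + 1 / \<delta>) * (R * q) + R * real m * (C / \<delta> + C / \<beta>))"
  proof -
    have "a2 * (\<Sum>xs\<in>S. \<Sum>T\<in>{E<..L}. \<Sum>x\<in>U. q) = real (card S) * ((4 / \<eta> + 1 / \<delta>) * (R * q))"
      using N(2) by (simp add: a2_def R_def N_def)
    moreover have "a3 * (\<Sum>xs\<in>S. \<Sum>T\<in>{E<..L}. \<Sum>x\<in>U. C) = real (card S) * (R * real m * (C / \<delta>))"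
      using N(2) by (simp add: a3_def R_def N_def)
    moreover have "(\<Sum>xs\<in>S. \<Sum>T\<in>{E<..L}. \<Sum>i<m. C / \<beta>) = real (card S) * (R * real m * (C / \<beta>))"
      by (simp add: R_def)
    ultimately show ?thesis by (simp add: a0_def ring_distribs mult_ac)
  qed
  finally have "real (card S) * (R * real m) \<le> real (card S) * (R * real m * ((1 / 2) ^ k + real M / real k + real L / (\<delta> * N))
      + a1 * (t * real L) + (4 / \<eta> + 1 / \<delta>) * (R * q) + R * real m * (C / \<delta> + C / \<beta>))"
    by (simp add: mult_ac)
  then show ?thesis unfolding mult_le_cancel_left_pos[OF S] a1_def N(1) .
qed

section \<open>Numerical estimates for the parameters\<close>

lemma log2_le_sqrt:
  fixes x :: real
  assumes "1 \<le> x"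
  shows "log 2 x \<le> 3 * sqrt x"
proof -
  have s: "0 < sqrt x" using assms by simp
  have "ln x = ln (sqrt x * sqrt x)" using assms by simp
  also have "\<dots> = 2 * ln (sqrt x)" using s by (simp only: ln_mult_pos)
  also have "\<dots> \<le> 2 * sqrt x" using ln_le_minus_one[OF s] by simp
  finally have "ln x \<le> 2 * sqrt x" .
  moreover have "2 * sqrt x \<le> 3 * sqrt x * ln 2"
    using ln2_ge_two_thirds s by (simp add: field_simps)
  ultimately show ?thesis by (simp add: log_def field_simps)
qed

lemma eventually_powr_neg_le:
  fixes a c :: real
  assumes "0 < a" "0 < c"
  shows "eventually (\<lambda>n :: nat. real n powr (- a) \<le> c) sequentially"
proof -
  have "((\<lambda>n :: nat. real n powr (- a)) \<longlongrightarrow> 0) sequentially"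
    using assms by (intro tendsto_neg_powr filterlim_real_sequentially) auto
  then have "eventually (\<lambda>n :: nat. real n powr (- a) < c) sequentially"
    using assms(2) by (rule order_tendstoD(2))
  then show ?thesis by (rule eventually_mono) simp
qed

text \<open>\<open>k\<close> exceeds the admissible state size by a factor n powr (\<epsilon> / 2),
  so the state is negligible in every epoch. Since b ^ (m - 1) \<le> n powr (\<epsilon> / 4), all
  epochs together span o(n) insertions, and few query times are lost.\<close>

lemma epochs_fit:
  fixes n b :: nat and \<epsilon> :: real
  assumes n: "1 \<le> n" and \<epsilon>: "0 < \<epsilon>" "\<epsilon> \<le> 1" and b: "2 \<le> b"
  defines "m \<equiv> Suc (nat \<lfloor>\<epsilon> / 4 * log 2 (real n) / log 2 (real b)\<rfloor>)"
    and "k \<equiv> nat \<lceil>real n powr (1 - \<epsilon> / 2)\<rceil>"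
  shows "\<epsilon> / 4 * log 2 (real n) \<le> real m * log 2 (real b)"
    and "real n powr (1 - \<epsilon> / 2) \<le> real k" and "0 < k"
    and "real (epoch_end k b m) \<le> 4 * real n powr (1 - \<epsilon> / 4)"
proof -
  define y where "y = \<epsilon> / 4 * log 2 (real n) / log 2 (real b)"
  have lb: "0 < log 2 (real b)" and ln: "0 \<le> log 2 (real n)" using b n by auto
  have y: "0 \<le> y" using lb ln \<epsilon> by (simp add: y_def)
  have "y \<le> real m" using y unfolding m_def y_def[symmetric] by linarith
  then show "\<epsilon> / 4 * log 2 (real n) \<le> real m * log 2 (real b)"
    using lb by (simp add: y_def field_simps)
  have p: "1 \<le> real n powr (1 - \<epsilon> / 2)" using n \<epsilon> by (intro ge_one_powr_ge_zero) auto
  then show k: "real n powr (1 - \<epsilon> / 2) \<le> real k" unfolding k_def by linarith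
  with p show "0 < k" by (cases k) auto
  have k2: "real k \<le> 2 * real n powr (1 - \<epsilon> / 2)" using p unfolding k_def by linarith
  have "real b ^ (m - 1) = (2 powr log 2 (real b)) powr real (m - 1)"
    using b by (simp add: powr_realpow)
  also have "\<dots> = 2 powr (real (m - 1) * log 2 (real b))"
    by (simp only: powr_powr mult.commute)
  also have "\<dots> \<le> 2 powr (y * log 2 (real b))"
    using y lb unfolding m_def y_def[symmetric] by (simp add: mult_right_mono)
  also have "\<dots> = 2 powr (log 2 (real n) * (\<epsilon> / 4))" using lb by (simp add: y_def mult.commute)
  also have "\<dots> = (2 powr log 2 (real n)) powr (\<epsilon> / 4)" by (simp only: powr_powr)
  also have "\<dots> = real n powr (\<epsilon> / 4)" using n by simp
  finally have bm: "real b ^ (m - 1) \<le> real n powr (\<epsilon> / 4)" .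
  have "m = Suc (m - 1)" by (simp add: m_def)
  then have "real (epoch_end k b m) \<le> 2 * real (k * b ^ (m - 1))"
    using epoch_end_Suc_le[OF b, of k "m - 1"] by simp
  also have "\<dots> = 2 * (real k * real b ^ (m - 1))" by simp
  also have "\<dots> \<le> 2 * ((2 * real n powr (1 - \<epsilon> / 2)) * real n powr (\<epsilon> / 4))"
    using k2 bm by (intro mult_left_mono mult_mono) auto
  also have "\<dots> = 4 * real n powr (1 - \<epsilon> / 4)"
    by (simp add: powr_add[symmetric])
  finally show "real (epoch_end k b m) \<le> 4 * real n powr (1 - \<epsilon> / 4)" .
qed

text \<open>As log 2 b \<le> 3 sqrt b, the term is of order K r / (\<epsilon> sqrt b), and sqrt b
  \<ge> c r cancels \<open>r\<close>. The constant is 14400 = 24 * 3 * 2 * 100.\<close>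

lemma transfer_term_le:
  fixes \<epsilon> K r c :: real and b :: nat
  assumes \<epsilon>: "0 < \<epsilon>" and K: "0 < K" and r: "2 \<le> r"
    and c: "14400 * K / \<epsilon>\<^sup>2 \<le> c" "2 \<le> c" and b: "c\<^sup>2 * r\<^sup>2 \<le> real b"
  shows "24 * K * r * log 2 (real b) / (\<epsilon> * (real b - 1)) \<le> \<epsilon> / 100"
proof -
  have c0: "0 < c" using c by simp
  have "c * r \<le> sqrt (real b)"
    using b c0 r by (intro real_le_rsqrt) (simp add: power_mult_distrib)
  moreover have "2 * 2 \<le> c * r" using c r by (intro mult_mono) auto
  ultimately have s: "c * r \<le> sqrt (real b)" "4 \<le> sqrt (real b)" by auto
  define s where "s = sqrt (real b)"
  have s': "4 \<le> s" "c * r \<le> s" "real b = s * s" using s by (simp_all add: s_def)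
  have s1: "1 \<le> s * s" using s'(1) by (metis mult_mono one_le_numeral order_trans mult_1 zero_le_one zero_le_numeral)
  have "log 2 (real b) \<le> 3 * s" unfolding s_def using s' s1 by (intro log2_le_sqrt) simp
  moreover have "s * s / 2 \<le> real b - 1"
  proof -
    have "2 \<le> s * s" using s'(1) mult_mono[of 4 s 4 s] by simp
    then show ?thesis using s' by simp
  qed
  ultimately have "24 * K * r * log 2 (real b) / (\<epsilon> * (real b - 1)) \<le> 24 * K * r * (3 * s) / (\<epsilon> * (s * s / 2))"
    using K r \<epsilon> s' by (intro frac_le mult_left_mono mult_pos_pos) auto
  also have "\<dots> = 144 * K * r / (\<epsilon> * s)" using s' \<epsilon> by (simp add: field_simps)
  also have "\<dots> \<le> 144 * K * r / (\<epsilon> * (c * r))"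
    using s' \<epsilon> K r c0 by (intro divide_left_mono mult_left_mono mult_pos_pos) auto
  also have "\<dots> = 144 * K / (\<epsilon> * c)" using r by simp
  also have "\<dots> \<le> \<epsilon> / 100"
    using c \<epsilon> c0 K by (simp add: field_simps power2_eq_square)
  finally show ?thesis .
qed

text \<open>1 - \<epsilon> / 2 is the threshold for cells written per key; each term with b - 1
  costs at most \<epsilon> / 100. The query times lost at the beginning, a share of \<epsilon> / 16,
  raise the cost per query time by a factor of at most 1 + \<epsilon> / 8.\<close>

lemma update_term_le:
  fixes \<epsilon> t L R m w b :: real
  assumes \<epsilon>: "0 < \<epsilon>" "\<epsilon> \<le> 1 / 2" and t: "0 \<le> t" "t \<le> 1 - \<epsilon>" and L: "0 < L" "(1 - \<epsilon> / 16) * L \<le> R"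
    and b: "1 + 200 / \<epsilon> \<le> b" and m: "0 < m" and w: "6 * (w * t) / (m * (b - 1)) \<le> \<epsilon> / 100"
    and w0: "0 \<le> w"
  shows "((m + 3 * w) / (b - 1) + m / (1 - \<epsilon> / 2)) * (t * L) \<le> R * m * (1 - 3 * \<epsilon> / 8 + \<epsilon> / 50)"
proof -
  define u where "u = t * L / R"
  have "(1 / 2) * L \<le> (1 - \<epsilon> / 16) * L" using \<epsilon> L by (intro mult_right_mono) auto
  then have R: "0 < R" "L \<le> 2 * R" using L by linarith+
  have b1: "200 / \<epsilon> \<le> b - 1" "0 < b - 1" using b \<epsilon> by (auto simp: add_pos_pos intro: less_le_trans[of _ "200/\<epsilon>"])
  have u2: "u \<le> 2 * t" using R t mult_left_mono[OF R(2) t(1)] by (simp add: u_def field_simps)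
  have u0: "0 \<le> u" using R t L by (simp add: u_def)
  have "L * ((1 - \<epsilon> / 16) * (1 + \<epsilon> / 8)) \<le> R * (1 + \<epsilon> / 8)"
    using L(2) \<epsilon> mult_right_mono[OF L(2), of "1 + \<epsilon> / 8"] by (simp add: mult_ac)
  moreover have "1 \<le> (1 - \<epsilon> / 16) * (1 + \<epsilon> / 8)"
  proof -
    have "(1 - \<epsilon> / 16) * (1 + \<epsilon> / 8) = 1 + \<epsilon> / 16 * (1 - \<epsilon> / 8)" by (simp add: field_simps)
    then show ?thesis using \<epsilon> by simp
  qed
  then have "L * 1 \<le> L * ((1 - \<epsilon> / 16) * (1 + \<epsilon> / 8))" using L by (intro mult_left_mono) auto
  ultimately have LR: "L / R \<le> 1 + \<epsilon> / 8" using R by (simp add: field_simps)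
  have "u = t * (L / R)" by (simp add: u_def)
  also have "\<dots> \<le> (1 - \<epsilon>) * (1 + \<epsilon> / 8)" using t LR L R \<epsilon> by (intro mult_mono) auto
  \<comment> \<open>The share 3 \<epsilon> / 8 makes the linear terms agree: both sides are 1 - 7
    \<epsilon> / 8 up to a quadratic term.\<close>
  also have "\<dots> \<le> (1 - 3 * \<epsilon> / 8) * (1 - \<epsilon> / 2)"
  proof -
    have "(1 - 3 * \<epsilon> / 8) * (1 - \<epsilon> / 2) - (1 - \<epsilon>) * (1 + \<epsilon> / 8) = 5 / 16 * (\<epsilon> * \<epsilon>)"
      by (simp add: field_simps)
    moreover have "0 \<le> \<epsilon> * \<epsilon>" by simp
    ultimately show ?thesis by linarith
  qed
  finally have "u / (1 - \<epsilon> / 2) \<le> 1 - 3 * \<epsilon> / 8" using \<epsilon> by (simp add: field_simps)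
  moreover have "u / (b - 1) \<le> \<epsilon> / 100"
  proof -
    have "u / (b - 1) \<le> 2 / (200 / \<epsilon>)" using u2 t b1 \<epsilon> u0 by (intro frac_le) auto
    then show ?thesis by simp
  qed
  moreover have "3 * w * u / (m * (b - 1)) \<le> \<epsilon> / 100"
  proof -
    have "3 * w * u / (m * (b - 1)) \<le> 6 * (w * t) / (m * (b - 1))"
      using mult_right_mono[OF u2 w0] m b1 by (intro divide_right_mono) (auto simp: mult_ac)
    then show ?thesis using w by linarith
  qed
  ultimately have "u / (b - 1) + 3 * w * u / (m * (b - 1)) + u / (1 - \<epsilon> / 2) \<le> 1 - 3 * \<epsilon> / 8 + \<epsilon> / 50"
    by linarith
  then have "R * m * (u / (b - 1) + 3 * w * u / (m * (b - 1)) + u / (1 - \<epsilon> / 2))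
      \<le> R * m * (1 - 3 * \<epsilon> / 8 + \<epsilon> / 50)"
    using R m by (intro mult_left_mono) auto
  moreover have "R * m * (u / d + 3 * w * u / (m * d) + u / f) = ((m + 3 * w) / d + m / f) * (R * u)"
    if "0 < d" "0 < f" for d f using m that by (simp add: field_simps)
  then have "R * m * (u / (b - 1) + 3 * w * u / (m * (b - 1)) + u / (1 - \<epsilon> / 2))
      = ((m + 3 * w) / (b - 1) + m / (1 - \<epsilon> / 2)) * (R * u)"
    using b1 \<epsilon> by simp
  moreover have "R * u = t * L" using R by (simp add: u_def)
  ultimately show ?thesis by simp
qed


lemma membership_lower_bound:
  fixes \<epsilon> :: real
  assumes \<epsilon>: "0 < \<epsilon>" "\<epsilon> \<le> 1 / 2"
  shows "\<exists>C::real. C > 0 \<and> (\<forall>K::real. K > 0 \<longrightarrow> (\<exists>c::real. c > 0 \<and> (\<exists>n0::nat. \<forall>n \<ge> n0.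
    \<forall>(B::real) (M::nat) (w::nat) (P :: seed measure) (D :: seed \<Rightarrow> det_ds) (t\<^sub>u::real) (t\<^sub>q::real).
      B \<ge> log 2 (real n) \<longrightarrow>
      real M \<le> real n powr (1 - \<epsilon>) \<longrightarrow>
      real w \<le> K * B * log 2 (real n) \<longrightarrow>
      randomized_ds n M w P D \<longrightarrow>
      solves_membership n C P D \<longrightarrow>
      expected_amortized_update_time_le n P D t\<^sub>u \<longrightarrow>
      query_time_le n P D t\<^sub>q \<longrightarrow>
      t\<^sub>u \<le> 1 - \<epsilon> \<longrightarrow>
      t\<^sub>q \<ge> c * (log 2 (real n) / log 2 (max 2 (B * t\<^sub>u))))))"
proof -
  txt \<open>Then \<open>\<theta>\<close> to the power \<open>\<epsilon> / 4\<close> is \<open>1 / 32\<close>, which outweighs the constant factors per key lost in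
    the union bounds. Moreover \<open>\<gamma>\<close> is both the error probability and the fraction of \<open>n\<close> inserted.\<close>
  define \<theta> where "\<theta> = 2 powr (- (20 / \<epsilon>))"
  define \<delta> where "\<delta> = \<theta> / 6"
  define \<eta> where "\<eta> = (\<theta> / 4)\<^sup>2"
  define \<gamma> where "\<gamma> = \<epsilon> * \<theta> / 1000"
  define \<Gamma> where "\<Gamma> = 4 / \<eta> + 1 / \<delta>"
  have \<theta>0: "0 < \<theta>" by (simp add: \<theta>_def)
  have \<theta>\<epsilon>: "\<theta> \<le> \<epsilon> / 20"
  proof -
    have "20 / \<epsilon> = log 2 (2 powr (20 / \<epsilon>))" by simp
    also have "\<dots> \<le> 2 powr (20 / \<epsilon>)"
    proof -
      have "20 / \<epsilon> \<le> real (Suc (nat \<lfloor>20 / \<epsilon>\<rfloor>))" by linarith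
      also have "\<dots> \<le> 2 ^ nat \<lfloor>20 / \<epsilon>\<rfloor>"
        using less_exp[of "nat \<lfloor>20 / \<epsilon>\<rfloor>"] by (metis Suc_leI of_nat_le_iff of_nat_numeral of_nat_power)
      also have "\<dots> = 2 powr real (nat \<lfloor>20 / \<epsilon>\<rfloor>)" by (simp add: powr_realpow)
      also have "\<dots> \<le> 2 powr (20 / \<epsilon>)" using \<epsilon> by (intro powr_mono) auto
      finally show ?thesis by simp
    qed
    finally have "20 / \<epsilon> \<le> 2 powr (20 / \<epsilon>)" .
    then show ?thesis using \<epsilon> by (simp add: \<theta>_def powr_minus field_simps)
  qed
  then have \<theta>1: "\<theta> \<le> 1" using \<epsilon> by simp
  have pos: "0 < \<eta>" "0 < \<delta>" "0 < 1 - \<epsilon> / 2" "0 < \<epsilon> / 4"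
    using \<theta>0 \<epsilon> by (simp_all add: \<eta>_def \<delta>_def)
  have \<gamma>0: "0 < \<gamma>" using \<epsilon> \<theta>0 by (simp add: \<gamma>_def)
  have \<gamma>1: "\<gamma> \<le> 1" using \<epsilon> \<theta>0 \<theta>1 mult_mono[of \<epsilon> 1 \<theta> 1] by (simp add: \<gamma>_def)
  have \<Gamma>0: "0 < \<Gamma>" using pos by (simp add: \<Gamma>_def add_pos_pos)
  \<comment> \<open>\<theta> takes the role of \<rho>, with \<alpha> = 1 - \<epsilon> / 2 and
    \<beta> = \<epsilon> / 4. It is split evenly: 3 \<delta> and 2 sqrt \<eta> are \<theta> / 2
    each.\<close>
  have \<rho>: "\<eta> \<le> 1" "3 * \<delta> + 2 * sqrt \<eta> \<le> \<theta>" "\<theta> \<le> 1" "\<theta> powr (1 - \<epsilon> / 4 - (1 - \<epsilon> / 2)) \<le> 1 / 32"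
  proof -
    show "\<eta> \<le> 1" unfolding \<eta>_def using \<theta>0 \<theta>1 by (intro power_le_one) auto
    have "sqrt \<eta> = \<theta> / 4" using \<theta>0 by (simp add: \<eta>_def real_sqrt_unique)
    then show "3 * \<delta> + 2 * sqrt \<eta> \<le> \<theta>" by (simp add: \<delta>_def)
    have "\<theta> powr (1 - \<epsilon> / 4 - (1 - \<epsilon> / 2)) = 2 powr (- (20 / \<epsilon>) * (\<epsilon> / 4))"
      unfolding \<theta>_def by (simp add: powr_powr)
    also have "\<dots> = 2 powr (- 5)" using \<epsilon> by simp
    also have "\<dots> = 1 / 2 ^ 5" by (subst powr_minus_divide) (simp add: powr_numeral)
    finally show "\<theta> powr (1 - \<epsilon> / 4 - (1 - \<epsilon> / 2)) \<le> 1 / 32" by simp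
  qed (rule \<theta>1)
  show ?thesis
  proof (rule exI[of _ \<gamma>], intro conjI \<gamma>0 allI impI)
    fix K :: real assume K: "K > 0"
    \<comment> \<open>The summands serve the transfers, the flags of later insertions, and the
      positivity of log 2 g, in this order.\<close>
    define g where "g = 14400 * K / \<epsilon>\<^sup>2 + 200 / \<epsilon> + 2"
    have gK: "14400 * K / \<epsilon>\<^sup>2 \<le> g" "200 / \<epsilon> \<le> g" "2 \<le> g"
      using K \<epsilon> by (simp_all add: g_def)
    have lg: "0 < log 2 g" using gK by simp
    \<comment> \<open>Obtained by combining m \<epsilon> / (4 \<Gamma>) \<le>
      \<open>t\<^sub>q\<close>, m \<ge> (\<epsilon> / 4) lg n / lg b and lg b \<le> (3 + 2 lg g) lg
      r.\<close>
    define c where "c = \<epsilon>\<^sup>2 / (16 * \<Gamma> * (3 + 2 * log 2 g))"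
    have c0: "0 < c" using \<epsilon> \<Gamma>0 lg by (simp add: c_def add_pos_pos)
    \<comment> \<open>In this order: the state and (1 / 2) ^ k are negligible; the epochs span at
      most \<epsilon> / 16 of the sequence; rounding \<gamma> n down loses at most half; and lg n,
      hence B, is at least 4.\<close>
    have "eventually (\<lambda>n :: nat. real n powr (- (\<epsilon> / 2)) \<le> \<epsilon> / 200 \<and>
        real n powr (- (\<epsilon> / 4)) \<le> \<epsilon> * \<gamma> / 128 \<and> n \<ge> nat \<lceil>2 / \<gamma>\<rceil> \<and> n \<ge> 16) sequentially"
      using \<epsilon> \<gamma>0 by (intro eventually_conj eventually_powr_neg_le eventually_ge_at_top) auto
    then obtain n0 where n0: "\<And>n. n \<ge> n0 \<Longrightarrow> real n powr (- (\<epsilon> / 2)) \<le> \<epsilon> / 200 \<and>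
        real n powr (- (\<epsilon> / 4)) \<le> \<epsilon> * \<gamma> / 128 \<and> n \<ge> nat \<lceil>2 / \<gamma>\<rceil> \<and> n \<ge> 16"
      unfolding eventually_sequentially by blast
    show "\<exists>c::real. c > 0 \<and> (\<exists>n0::nat. \<forall>n \<ge> n0.
      \<forall>(B::real) (M::nat) (w::nat) (P :: seed measure) (D :: seed \<Rightarrow> det_ds) (t\<^sub>u::real) (t\<^sub>q::real).
        B \<ge> log 2 (real n) \<longrightarrow> real M \<le> real n powr (1 - \<epsilon>) \<longrightarrow> real w \<le> K * B * log 2 (real n) \<longrightarrow>
        randomized_ds n M w P D \<longrightarrow> solves_membership n \<gamma> P D \<longrightarrow>
        expected_amortized_update_time_le n P D t\<^sub>u \<longrightarrow> query_time_le n P D t\<^sub>q \<longrightarrow>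
        t\<^sub>u \<le> 1 - \<epsilon> \<longrightarrow> t\<^sub>q \<ge> c * (log 2 (real n) / log 2 (max 2 (B * t\<^sub>u))))"
    proof (intro exI[of _ c] conjI c0 exI[of _ n0] allI impI)
      fix n M w :: nat and B t\<^sub>u t\<^sub>q :: real and P :: "seed measure" and D :: "seed \<Rightarrow> det_ds"
      assume n: "n0 \<le> n" and B: "B \<ge> log 2 (real n)" and M: "real M \<le> real n powr (1 - \<epsilon>)"
        and w: "real w \<le> K * B * log 2 (real n)" and ds: "randomized_ds n M w P D"
        and correct: "solves_membership n \<gamma> P D"
        and update: "expected_amortized_update_time_le n P D t\<^sub>u"
        and query: "query_time_le n P D t\<^sub>q" and tu: "t\<^sub>u \<le> 1 - \<epsilon>"
      from n0[OF n] have n2: "real n powr (- (\<epsilon> / 2)) \<le> \<epsilon> / 200"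
        and n4: "real n powr (- (\<epsilon> / 4)) \<le> \<epsilon> * \<gamma> / 128" and n\<gamma>: "nat \<lceil>2 / \<gamma>\<rceil> \<le> n" and n16: "16 \<le> n" by auto
      have "4 = log 2 (2 powr 4)" by (simp only: log_powr_cancel)
      also have "\<dots> \<le> log 2 (real n)" using n16 by simp
      finally have lgn: "4 \<le> log 2 (real n)" .
      then have B4: "4 \<le> B" using B by linarith
      define r where "r = max 2 (B * t\<^sub>u)"
      \<comment> \<open>Raising \<open>t\<^sub>u\<close> to \<open>t\<close> gives B t = r \<ge> 2
        exactly. The bound 1 - \<epsilon> survives: if \<open>t\<close> is strictly larger, then t =
        2 / B \<le> 1 / 2.\<close>
      define t where "t = r / B"
      have r2: "2 \<le> r" by (simp add: r_def)
      have t0: "0 \<le> t" using r2 B4 by (simp add: t_def)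
      have tut: "t\<^sub>u \<le> t" using B4 by (simp add: t_def r_def field_simps)
      have t1: "t \<le> 1 - \<epsilon>"
      proof (cases "2 \<le> B * t\<^sub>u")
        case True
        then show ?thesis using B4 tu by (simp add: t_def r_def)
      next
        case False
        then have "t = 2 / B" by (simp add: t_def r_def)
        also have "\<dots> \<le> 2 / 4" using B4 by (intro divide_left_mono) auto
        finally show ?thesis using \<epsilon> by simp
      qed
      have update': "expected_amortized_update_time_le n P D t"
        using update unfolding expected_amortized_update_time_le_def
        by (meson mult_right_mono[OF tut] of_nat_0_le_iff order_trans)
      \<comment> \<open>Quadratic in \<open>r\<close>: one factor outweighs the bits transferred per
        key, the other the factor lg b, while lg b remains O(lg r).\<close>
      define b where "b = nat \<lceil>g\<^sup>2 * r\<^sup>2\<rceil>"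
      define k where "k = nat \<lceil>real n powr (1 - \<epsilon> / 2)\<rceil>"
      define m where "m = Suc (nat \<lfloor>\<epsilon> / 4 * log 2 (real n) / log 2 (real b)\<rfloor>)"
      define E where "E = epoch_end k b m"
      define L where "L = nat \<lfloor>\<gamma> * real n\<rfloor>"
      define R where "R = real (L - E)"
      have gr: "g * 4 \<le> g\<^sup>2 * r\<^sup>2"
      proof -
        have "g * 1 \<le> g * g" using gK by (intro mult_left_mono) auto
        moreover have "2 * 2 \<le> r * r" using r2 by (intro mult_mono) auto
        ultimately have "g * 4 \<le> (g * g) * (r * r)" using gK by (intro mult_mono) auto
        then show ?thesis by (simp add: power2_eq_square)
      qed
      have b_ge: "g\<^sup>2 * r\<^sup>2 \<le> real b" and b_le: "real b \<le> 2 * (g\<^sup>2 * r\<^sup>2)"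
        using gr gK unfolding b_def by linarith+
      have b200: "1 + 200 / \<epsilon> \<le> real b" using gr b_ge gK by linarith
      have b2: "2 \<le> b" using gr b_ge gK by linarith
      have "1 \<le> n" "\<epsilon> \<le> 1" using n16 \<epsilon> by simp_all
      note fit = epochs_fit[OF \<open>1 \<le> n\<close> \<epsilon>(1) \<open>\<epsilon> \<le> 1\<close> b2, folded m_def k_def, folded E_def]
      have m0: "0 < real m" by (simp add: m_def)
      have k0: "0 < k"
      proof -
        have "0 < real n powr (1 - \<epsilon> / 2)" using n16 by simp
        then show ?thesis using fit(2) by linarith
      qed
      have L_ge: "\<gamma> * real n / 2 \<le> real L" and L_le: "real L \<le> \<gamma> * real n" and L0: "0 < real L"
      proof -
        have "2 / \<gamma> \<le> real n" using n\<gamma> by linarith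
        then have "2 \<le> \<gamma> * real n" using \<gamma>0 by (simp add: field_simps)
        then show "\<gamma> * real n / 2 \<le> real L" "real L \<le> \<gamma> * real n" "0 < real L"
          unfolding L_def by linarith+
      qed
      have Ln: "L \<le> n"
      proof -
        have "\<gamma> * real n \<le> 1 * real n" using \<gamma>1 by (intro mult_right_mono) auto
        then show ?thesis using L_le by simp
      qed
      have EL: "real E \<le> \<epsilon> / 16 * real L"
      proof -
        have "real E \<le> 4 * real n powr (1 - \<epsilon> / 4)" by (rule fit(4))
        also have "real n powr (1 - \<epsilon> / 4) = real n * real n powr (- (\<epsilon> / 4))"
          using n16 powr_add[of "real n" 1 "- (\<epsilon> / 4)"] by simp
        also have "4 * (real n * real n powr (- (\<epsilon> / 4))) \<le> 4 * (real n * (\<epsilon> * \<gamma> / 128))"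
          using n4 by (intro mult_left_mono) auto
        also have "\<dots> = \<epsilon> / 16 * (\<gamma> * real n / 2)" by simp
        also have "\<dots> \<le> \<epsilon> / 16 * real L" using L_ge \<epsilon> by (intro mult_left_mono) auto
        finally show ?thesis .
      qed
      have "\<epsilon> / 16 * real L \<le> 1 * real L" using \<epsilon> by (intro mult_right_mono) auto
      then have EL': "E \<le> L" using EL by simp
      have R_ge: "(1 - \<epsilon> / 16) * real L \<le> R" using EL EL' by (simp add: R_def algebra_simps of_nat_diff)
      have "0 < (1 - \<epsilon> / 16) * real L" using \<epsilon> L0 by (intro mult_pos_pos) auto
      then have R0: "0 < R" using R_ge by linarith

      have "R * real m \<le> R * real m * ((1 / 2) ^ k + real M / real k + real L / (\<delta> * (2 * real n)))
        + ((real m + 3 * real w) / (real b - 1) + real m / (1 - \<epsilon> / 2)) * (t * real L)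
        + (4 / \<eta> + 1 / \<delta>) * (R * t\<^sub>q) + R * real m * (\<gamma> / \<delta> + \<gamma> / (\<epsilon> / 4))"
        unfolding R_def using n16 \<gamma>0
        by (intro randomized_bound[OF ds correct update' query _ _ k0 b2 E_def EL' Ln pos \<rho>]) auto
      also have "((real m + 3 * real w) / (real b - 1) + real m / (1 - \<epsilon> / 2)) * (t * real L)
          \<le> R * real m * (1 - 3 * \<epsilon> / 8 + \<epsilon> / 50)"
      proof (rule update_term_le[OF \<epsilon> t0 t1 L0 R_ge b200 m0])
        \<comment> \<open>The transfers carry no factor \<open>m\<close>, but cells have a factor lg
          n: \<open>B\<close> cancels against \<open>t\<close>, and lg n is at most (4 / \<epsilon>)
          m lg b.\<close>
        have "real w * t \<le> K * B * log 2 (real n) * t" using w t0 by (intro mult_right_mono)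
        also have "\<dots> = K * r * log 2 (real n)" using B4 by (simp add: t_def)
        also have "\<dots> \<le> K * r * (4 / \<epsilon> * (real m * log 2 (real b)))"
          using fit(1) K r2 \<epsilon> by (intro mult_left_mono) (auto simp: field_simps)
        finally have "6 * (real w * t) / (real m * (real b - 1))
            \<le> 6 * (K * r * (4 / \<epsilon> * (real m * log 2 (real b)))) / (real m * (real b - 1))"
          using b2 m0 by (intro divide_right_mono mult_left_mono) auto
        also have "\<dots> = 24 * K * r * log 2 (real b) / (\<epsilon> * (real b - 1))"
          using m0 by simp
        also have "\<dots> \<le> \<epsilon> / 100"
          by (rule transfer_term_le[OF \<epsilon>(1) K r2 gK(1,3) b_ge])
        finally show "6 * (real w * t) / (real m * (real b - 1)) \<le> \<epsilon> / 100" .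
      qed simp
      also have "(1 / 2) ^ k + real M / real k + real L / (\<delta> * (2 * real n)) \<le> \<epsilon> / 200 + \<epsilon> / 200 + 3 * \<epsilon> / 1000"
      proof (intro add_mono)
        have p: "0 < real n powr (1 - \<epsilon> / 2)" using n16 by simp
        have "real k * 1 \<le> 2 ^ k" using less_exp[of k]
          by (metis less_imp_le mult.right_neutral of_nat_le_iff of_nat_numeral of_nat_power)
        then have "(1 / 2 :: real) ^ k \<le> 1 / real k" using k0 by (simp add: power_one_over field_simps)
        also have "\<dots> \<le> 1 / real n powr (1 - \<epsilon> / 2)"
          using fit(2) p by (intro frac_le) auto
        also have "\<dots> = real n powr (- (1 - \<epsilon> / 2))" by (rule powr_minus_divide[symmetric])
        also have "\<dots> \<le> real n powr (- (\<epsilon> / 2))" using n16 \<epsilon> by (intro powr_mono) auto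
        finally show "(1 / 2) ^ k \<le> \<epsilon> / 200" using n2 by linarith
        have "real M / real k \<le> real n powr (1 - \<epsilon>) / real n powr (1 - \<epsilon> / 2)"
          using M fit(2) p by (intro frac_le) auto
        also have "\<dots> = real n powr (- (\<epsilon> / 2))" by (simp add: powr_diff[symmetric])
        finally show "real M / real k \<le> \<epsilon> / 200" using n2 by linarith
        have "real L / (\<delta> * (2 * real n)) \<le> \<gamma> * real n / (\<delta> * (2 * real n))"
          using L_le pos by (intro divide_right_mono) auto
        also have "\<dots> = 3 * \<epsilon> / 1000" using n16 \<theta>0 by (simp add: \<gamma>_def \<delta>_def)
        finally show "real L / (\<delta> * (2 * real n)) \<le> 3 * \<epsilon> / 1000" .
      qed
      \<comment> \<open>\<gamma> / \<delta> is 6 \<epsilon> / 1000, and the other term 4 \<theta> /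
        1000 is below \<epsilon> / 1000 since \<theta> \<le> \<epsilon> / 20.\<close>
      also have "\<gamma> / \<delta> + \<gamma> / (\<epsilon> / 4) \<le> 7 * \<epsilon> / 1000"
        using \<theta>0 \<epsilon> \<theta>\<epsilon> by (simp add: \<gamma>_def \<delta>_def)
      finally have main: "R * real m \<le> R * real m * (\<epsilon> / 200 + \<epsilon> / 200 + 3 * \<epsilon> / 1000)
        + R * real m * (1 - 3 * \<epsilon> / 8 + \<epsilon> / 50) + \<Gamma> * (R * t\<^sub>q) + R * real m * (7 * \<epsilon> / 1000)"
        using R0 m0 by (simp add: \<Gamma>_def)
      \<comment> \<open>In units of \<epsilon> / 1000, the share 375 left by the updates is reduced
        by 13 (good windows, state, inserted keys), 20 (flags and transfers) and 7 (errors).\<close>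
      have "R * real m * (\<epsilon> / 4) \<le> R * real m * (\<epsilon> * (3 / 8 - 40 / 1000))"
        using R0 m0 \<epsilon> by (intro mult_left_mono) auto
      with main have "R * (real m * (\<epsilon> / 4)) \<le> R * (\<Gamma> * t\<^sub>q)" by (simp add: algebra_simps)
      then have "real m * (\<epsilon> / 4) \<le> \<Gamma> * t\<^sub>q" using R0 by simp
      then have tq: "real m * \<epsilon> / (4 * \<Gamma>) \<le> t\<^sub>q" using \<Gamma>0 by (simp add: field_simps)

      have lr: "1 \<le> log 2 r" using r2 by simp
      have lb0: "0 < log 2 (real b)" using b2 by simp
      have "log 2 (real b) \<le> log 2 (2 * (g\<^sup>2 * r\<^sup>2))" using b_le b2 by simp
      also have "\<dots> = 1 + 2 * log 2 g + 2 * log 2 r"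
        using gK r2 by (simp add: log_mult log_nat_power)
      also have "\<dots> \<le> (3 + 2 * log 2 g) * log 2 r"
        using lr mult_left_mono[OF lr, of "1 + 2 * log 2 g"] lg by (simp add: algebra_simps)
      finally have lb: "log 2 (real b) \<le> (3 + 2 * log 2 g) * log 2 r" .
      have "c * (log 2 (real n) / log 2 r)
          = \<epsilon> / (4 * \<Gamma>) * (\<epsilon> / 4 * log 2 (real n) / ((3 + 2 * log 2 g) * log 2 r))"
        by (simp add: c_def power2_eq_square)
      also have "\<dots> \<le> \<epsilon> / (4 * \<Gamma>) * (\<epsilon> / 4 * log 2 (real n) / log 2 (real b))"
        using lb lb0 lgn \<epsilon> \<Gamma>0 by (intro mult_left_mono frac_le) auto
      also have "\<dots> \<le> \<epsilon> / (4 * \<Gamma>) * real m"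
        using fit(1) lb0 \<epsilon> \<Gamma>0 by (intro mult_left_mono) (auto simp: field_simps)
      also have "\<dots> \<le> t\<^sub>q" using tq by (simp add: mult.commute)
      finally show "t\<^sub>q \<ge> c * (log 2 (real n) / log 2 (max 2 (B * t\<^sub>u)))" by (simp add: r_def)
    qed
  qed
qed

(* The denominator is lg (B * t_u) with its argument clipped at 2: the unclipped quotient is
   negative, undefined or unbounded when B * t_u is below, equal to or just above 1. *)
theorem theorem3:
  fixes \<epsilon> :: real
  assumes "\<epsilon> > 0"
  shows "\<exists>C::real. C > 0 \<and> (\<forall>K::real. K > 0 \<longrightarrow> (\<exists>c::real. c > 0 \<and> (\<exists>n0::nat. \<forall>n \<ge> n0.
    \<forall>(B::real) (M::nat) (w::nat) (P :: seed measure) (D :: seed \<Rightarrow> det_ds) (t\<^sub>u::real) (t\<^sub>q::real).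
      B \<ge> log 2 (real n) \<longrightarrow>
      real M \<le> real n powr (1 - \<epsilon>) \<longrightarrow>
      real w \<le> K * B * log 2 (real n) \<longrightarrow>
      randomized_ds n M w P D \<longrightarrow>
      solves_membership n C P D \<longrightarrow>
      expected_amortized_update_time_le n P D t\<^sub>u \<longrightarrow>
      query_time_le n P D t\<^sub>q \<longrightarrow>
      t\<^sub>u \<le> 1 - \<epsilon> \<longrightarrow>
      t\<^sub>q \<ge> c * (log 2 (real n) / log 2 (max 2 (B * t\<^sub>u))))))"
proof -
  \<comment> \<open>The bounds on \<open>M\<close> and \<open>t\<^sub>u\<close> only become weaker
    when \<epsilon> decreases, for \<open>M\<close> provided n \<ge> 1; so \<epsilon> may be lowered
    to 1 / 2.\<close>
  define \<epsilon>' where "\<epsilon>' = min \<epsilon> (1 / 2)"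
  have \<epsilon>': "0 < \<epsilon>'" "\<epsilon>' \<le> 1 / 2" "\<epsilon>' \<le> \<epsilon>" using assms by (auto simp: \<epsilon>'_def)
  obtain C :: real where C: "C > 0" and lower: "\<And>K :: real. K > 0 \<Longrightarrow> \<exists>c::real. c > 0 \<and> (\<exists>n0::nat. \<forall>n \<ge> n0.
    \<forall>(B::real) (M::nat) (w::nat) (P :: seed measure) (D :: seed \<Rightarrow> det_ds) (t\<^sub>u::real) (t\<^sub>q::real).
      B \<ge> log 2 (real n) \<longrightarrow> real M \<le> real n powr (1 - \<epsilon>') \<longrightarrow> real w \<le> K * B * log 2 (real n) \<longrightarrow>
      randomized_ds n M w P D \<longrightarrow> solves_membership n C P D \<longrightarrow>
      expected_amortized_update_time_le n P D t\<^sub>u \<longrightarrow> query_time_le n P D t\<^sub>q \<longrightarrow> t\<^sub>u \<le> 1 - \<epsilon>' \<longrightarrow>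
      t\<^sub>q \<ge> c * (log 2 (real n) / log 2 (max 2 (B * t\<^sub>u))))"
    using membership_lower_bound[OF \<epsilon>'(1,2)] by metis
  show ?thesis
  proof (rule exI[of _ C], intro conjI C allI impI)
    fix K :: real assume "K > 0"
    from lower[OF this] obtain c :: real and n0 :: nat where c: "c > 0" and bound: "\<forall>n \<ge> n0.
      \<forall>(B::real) (M::nat) (w::nat) (P :: seed measure) (D :: seed \<Rightarrow> det_ds) (t\<^sub>u::real) (t\<^sub>q::real).
        B \<ge> log 2 (real n) \<longrightarrow> real M \<le> real n powr (1 - \<epsilon>') \<longrightarrow> real w \<le> K * B * log 2 (real n) \<longrightarrow>
        randomized_ds n M w P D \<longrightarrow> solves_membership n C P D \<longrightarrow>
        expected_amortized_update_time_le n P D t\<^sub>u \<longrightarrow> query_time_le n P D t\<^sub>q \<longrightarrow> t\<^sub>u \<le> 1 - \<epsilon>' \<longrightarrow>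
        t\<^sub>q \<ge> c * (log 2 (real n) / log 2 (max 2 (B * t\<^sub>u)))" by auto
    show "\<exists>c::real. c > 0 \<and> (\<exists>n0::nat. \<forall>n \<ge> n0.
      \<forall>(B::real) (M::nat) (w::nat) (P :: seed measure) (D :: seed \<Rightarrow> det_ds) (t\<^sub>u::real) (t\<^sub>q::real).
        B \<ge> log 2 (real n) \<longrightarrow> real M \<le> real n powr (1 - \<epsilon>) \<longrightarrow> real w \<le> K * B * log 2 (real n) \<longrightarrow>
        randomized_ds n M w P D \<longrightarrow> solves_membership n C P D \<longrightarrow>
        expected_amortized_update_time_le n P D t\<^sub>u \<longrightarrow> query_time_le n P D t\<^sub>q \<longrightarrow> t\<^sub>u \<le> 1 - \<epsilon> \<longrightarrow>
        t\<^sub>q \<ge> c * (log 2 (real n) / log 2 (max 2 (B * t\<^sub>u))))"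
    proof (intro exI[of _ c] conjI c exI[of _ "max 1 n0"] allI impI)
      fix n M w :: nat and B t\<^sub>u t\<^sub>q :: real and P :: "seed measure" and D :: "seed \<Rightarrow> det_ds"
      assume n: "max 1 n0 \<le> n" and B: "B \<ge> log 2 (real n)" and M: "real M \<le> real n powr (1 - \<epsilon>)"
        and w: "real w \<le> K * B * log 2 (real n)" and ds: "randomized_ds n M w P D"
        "solves_membership n C P D" "expected_amortized_update_time_le n P D t\<^sub>u"
        "query_time_le n P D t\<^sub>q" and tu: "t\<^sub>u \<le> 1 - \<epsilon>"
      have "real n powr (1 - \<epsilon>) \<le> real n powr (1 - \<epsilon>')" using n \<epsilon>' by (intro powr_mono) auto
      then have M': "real M \<le> real n powr (1 - \<epsilon>')" using M by linarith
      have tu': "t\<^sub>u \<le> 1 - \<epsilon>'" using tu \<epsilon>' by linarith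
      have n0: "n0 \<le> n" using n by simp
      show "t\<^sub>q \<ge> c * (log 2 (real n) / log 2 (max 2 (B * t\<^sub>u)))"
        by (rule bound[rule_format, OF n0 B M' w ds tu'])
    qed
  qed
qed

end
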